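(* Let $E$ be a reflexive real Fréchet space with an unconditional Schauder basis $\{e_k\}_{k\in\mathbb{N}}$ and the associated partial order $\ll$, let $T>0$, $I_T=[0,T]$, $\hat x\in E$, and let $f:I_T\times E\to E$, $f(t,x)=\sum_{k=1}^\infty f_k(t,x)e_k$, satisfy: (i) for every $k\in\mathbb{N}$ and every fixed $t\in I_T$ the function $f_k(t,\cdot):E\to\mathbb{R}$ is left continuous; (ii) for every fixed $x\in E$ the function $t\mapsto f(t,x)$ is integrable on $I_T$; (iii) there exists $C\in E$ such that $f(t,x)\ll C$ for all $(t,x)\in I_T\times E$; (iv) there exists $x_*\in E$ such that $x_*\ll \hat x+\int_0^t f(\xi,x_* )\,d\xi$ for all $t\in I_T$; (v) $f$ is monotone: for all $x,y\in E$ and all $t\in I_T$, $x\ll y$ implies $f(t,x)\ll f(t,y)$. Then the initial value problem $\dot x(t)=f(t,x(t))$, $x(0)=\hat x$, has a solution $x\in C(I_T,E)$ which is weakly differentiable almost everywhere: for almost all $t\in I_T$ there exists $\dot x(t)\in E$ such that $$\Big(\psi,\frac{x(t+h)-x(t)}{h}\Big)\to(\psi,\dot x(t)),\quad h\to0,\ h\neq0,\quad\forall\psi\in E',$$ and $\dot x(t)=f(t,x(t))$ for almost all $t\in I_T$.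
   Context: The topology of the Fréchet space $E$ (Hausdorff, complete) is defined by a countable family of seminorms $\{\|\cdot\|_n\}_{n\in\mathbb{N}}$. $E'$ is the space of continuous linear functionals on $E$, and $(\psi,x)$ denotes the value of $\psi\in E'$ at $x\in E$. In the difference quotient, $h$ is such that $t+h\in I_T$. A sequence $\{e_k\}_{k\in\mathbb{N}}\subset E$ is a Schauder basis if for every $x\in E$ there is a unique sequence of scalars $\{x_k\}$ with $x=\sum_{k=1}^\infty x_ke_k$ (convergence in the topology of $E$). It is unconditional if for every $x\in E$ and every permutation $\pi:\mathbb{N}\to\mathbb{N}$ the series $\sum_k x_{\pi(k)}e_{\pi(k)}$ converges to the same element $x$. Partial order: for $x=\sum x_ke_k$, $y=\sum y_ke_k$ in $E$, $x\ll y$ means $x_i\le y_i$ for all $i\in\mathbb{N}$. A function $g:E\to\mathbb{R}$ is left continuous if for every $x'\in E$ and every sequence $x_k\to x'$ in $E$ with $x_k\ll x_{k+1}$ for all $k\in\mathbb{N}$, one has $\lim_{k\to\infty}g(x_k)=g(x')$. Integrability: $I_T$ carries Lebesgue measure $\mu$. A step function $h:I_T\to E$ is a function with finitely many values $a_1,\dots,a_\nu$, each level set $A_k=h^{-1}(a_k)$ being measurable; its integral is $\sum_{a_k\neq0}a_k\mu(A_k)$. A function $g:I_T\to E$ is integrable if there is a sequence of step functions $h_n$ with $h_n\to g$ almost everywhere and, for every $s\in\mathbb{N}$, $\int\|h_n-h_m\|_s\to0$ as $n,m\to\infty$; then $\int g:=\lim_n\int h_n$ (limit in $E$, independent of the choice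 of $h_n$). Solution: a function $x\in C(I_T,E)$ is a solution of the initial value problem if $t\mapsto f(t,x(t))$ is integrable on $I_T$ and $x(t)=\hat x+\int_0^t f(\xi,x(\xi))\,d\xi$ for all $t\in I_T$. *)

theory Defs
  imports "HOL-Analysis.Analysis"
begin

section \<open>Seminormed spaces and Frechet spaces\<close>

definition seminorm :: "('a::real_vector \<Rightarrow> real) \<Rightarrow> bool" where
  "seminorm q \<longleftrightarrow>
     (\<forall>x y. q (x + y) \<le> q x + q y) \<and> (\<forall>c x. q (c *\<^sub>R x) = \<bar>c\<bar> * q x)"

text \<open>The carrier \<open>V\<close> is explicit because the same construction is used for the dual and the
  bidual, which are sets of functions (with the pointwise difference).\<close>

definition seminorm_topology :: "'v::minus set \<Rightarrow> ('v \<Rightarrow> real) set \<Rightarrow> 'v topology" where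
  "seminorm_topology V Q = topology_generated_by
     (insert V {{y \<in> V. q (y - x) < \<epsilon>} | q x \<epsilon>. q \<in> Q \<and> x \<in> V \<and> 0 < \<epsilon>})"

definition seminorm_bounded :: "'v set \<Rightarrow> ('v \<Rightarrow> real) set \<Rightarrow> 'v set \<Rightarrow> bool" where
  "seminorm_bounded V Q B \<longleftrightarrow> B \<subseteq> V \<and> (\<forall>q\<in>Q. bdd_above (q ` B))"

text \<open>A sequence \<open>p\<close> of seminorms on a whole type represents the space \<open>E\<close>.\<close>

abbreviation frechet_topology :: "(nat \<Rightarrow> 'a::real_vector \<Rightarrow> real) \<Rightarrow> 'a topology" where
  "frechet_topology p \<equiv> seminorm_topology UNIV (range p)"

definition seminorm_Cauchy ::
  "(nat \<Rightarrow> 'a::real_vector \<Rightarrow> real) \<Rightarrow> (nat \<Rightarrow> 'a) \<Rightarrow> bool" where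
  "seminorm_Cauchy p \<sigma> \<longleftrightarrow>
     (\<forall>s. \<forall>\<epsilon>>0. \<exists>N. \<forall>m\<ge>N. \<forall>n\<ge>N. p s (\<sigma> m - \<sigma> n) < \<epsilon>)"

definition frechet_space :: "(nat \<Rightarrow> 'a::real_vector \<Rightarrow> real) \<Rightarrow> bool" where
  "frechet_space p \<longleftrightarrow>
     (\<forall>n. seminorm (p n)) \<and>
     Hausdorff_space (frechet_topology p) \<and>
     (\<forall>\<sigma>. seminorm_Cauchy p \<sigma> \<longrightarrow> (\<exists>l. limitin (frechet_topology p) \<sigma> l sequentially))"

section \<open>Duality and reflexivity\<close>

definition dual_space :: "(nat \<Rightarrow> 'a::real_vector \<Rightarrow> real) \<Rightarrow> ('a \<Rightarrow> real) set" where
  "dual_space p = {\<psi>. linear \<psi> \<and> continuous_map (frechet_topology p) euclideanreal \<psi>}"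

text \<open>The strong topology on the dual: uniform convergence on bounded sets. The index sets are
  required to be nonempty because \<open>Sup {}\<close> is unspecified on the reals.\<close>

definition strong_dual_seminorms ::
  "(nat \<Rightarrow> 'a::real_vector \<Rightarrow> real) \<Rightarrow> (('a \<Rightarrow> real) \<Rightarrow> real) set" where
  "strong_dual_seminorms p =
     {\<lambda>\<psi>. SUP x\<in>B. \<bar>\<psi> x\<bar> | B. B \<noteq> {} \<and> seminorm_bounded UNIV (range p) B}"

definition strong_dual_topology ::
  "(nat \<Rightarrow> 'a::real_vector \<Rightarrow> real) \<Rightarrow> ('a \<Rightarrow> real) topology" where
  "strong_dual_topology p = seminorm_topology (dual_space p) (strong_dual_seminorms p)"

text \<open>Functionals on the dual are only meaningful on \<open>dual_space p\<close>; extensionality makes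
  each of them a single HOL function.\<close>

definition bidual_space ::
  "(nat \<Rightarrow> 'a::real_vector \<Rightarrow> real) \<Rightarrow> (('a \<Rightarrow> real) \<Rightarrow> real) set" where
  "bidual_space p = {F \<in> extensional (dual_space p).
     (\<forall>\<phi>\<in>dual_space p. \<forall>\<psi>\<in>dual_space p. F (\<lambda>x. \<phi> x + \<psi> x) = F \<phi> + F \<psi>) \<and>
     (\<forall>c. \<forall>\<psi>\<in>dual_space p. F (\<lambda>x. c * \<psi> x) = c * F \<psi>) \<and>
     continuous_map (strong_dual_topology p) euclideanreal F}"

definition strong_bidual_seminorms ::
  "(nat \<Rightarrow> 'a::real_vector \<Rightarrow> real) \<Rightarrow> ((('a \<Rightarrow> real) \<Rightarrow> real) \<Rightarrow> real) set" where
  "strong_bidual_seminorms p =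
     {\<lambda>F. SUP \<psi>\<in>\<Phi>. \<bar>F \<psi>\<bar> | \<Phi>.
        \<Phi> \<noteq> {} \<and> seminorm_bounded (dual_space p) (strong_dual_seminorms p) \<Phi>}"

definition strong_bidual_topology ::
  "(nat \<Rightarrow> 'a::real_vector \<Rightarrow> real) \<Rightarrow> (('a \<Rightarrow> real) \<Rightarrow> real) topology" where
  "strong_bidual_topology p = seminorm_topology (bidual_space p) (strong_bidual_seminorms p)"

text \<open>The canonical map is linear, so being a homeomorphism onto the strong bidual makes it an
  isomorphism of topological vector spaces.\<close>

definition reflexive_space :: "(nat \<Rightarrow> 'a::real_vector \<Rightarrow> real) \<Rightarrow> bool" where
  "reflexive_space p \<longleftrightarrow>
     homeomorphic_map (frechet_topology p) (strong_bidual_topology p)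
       (\<lambda>x. \<lambda>\<psi>\<in>dual_space p. \<psi> x)"

section \<open>Schauder bases and the induced order\<close>

text \<open>Basis vectors are indexed from \<open>0\<close>.\<close>

definition basis_expansion ::
  "(nat \<Rightarrow> 'a::real_vector \<Rightarrow> real) \<Rightarrow> (nat \<Rightarrow> 'a) \<Rightarrow> 'a \<Rightarrow> (nat \<Rightarrow> real) \<Rightarrow> bool" where
  "basis_expansion p e x c \<longleftrightarrow>
     limitin (frechet_topology p) (\<lambda>n. \<Sum>k<n. c k *\<^sub>R e k) x sequentially"

definition schauder_basis ::
  "(nat \<Rightarrow> 'a::real_vector \<Rightarrow> real) \<Rightarrow> (nat \<Rightarrow> 'a) \<Rightarrow> bool" where
  "schauder_basis p e \<longleftrightarrow> (\<forall>x. \<exists>!c. basis_expansion p e x c)"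

definition basis_coord ::
  "(nat \<Rightarrow> 'a::real_vector \<Rightarrow> real) \<Rightarrow> (nat \<Rightarrow> 'a) \<Rightarrow> 'a \<Rightarrow> nat \<Rightarrow> real" where
  "basis_coord p e x = (THE c. basis_expansion p e x c)"

definition unconditional_basis ::
  "(nat \<Rightarrow> 'a::real_vector \<Rightarrow> real) \<Rightarrow> (nat \<Rightarrow> 'a) \<Rightarrow> bool" where
  "unconditional_basis p e \<longleftrightarrow> schauder_basis p e \<and>
     (\<forall>x \<pi>. bij \<pi> \<longrightarrow>
        limitin (frechet_topology p)
          (\<lambda>n. \<Sum>k<n. basis_coord p e x (\<pi> k) *\<^sub>R e (\<pi> k)) x sequentially)"

definition basis_le ::
  "(nat \<Rightarrow> 'a::real_vector \<Rightarrow> real) \<Rightarrow> (nat \<Rightarrow> 'a) \<Rightarrow> 'a \<Rightarrow> 'a \<Rightarrow> bool" where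
  "basis_le p e x y \<longleftrightarrow> (\<forall>i. basis_coord p e x i \<le> basis_coord p e y i)"

definition left_continuous ::
  "(nat \<Rightarrow> 'a::real_vector \<Rightarrow> real) \<Rightarrow> (nat \<Rightarrow> 'a) \<Rightarrow> ('a \<Rightarrow> real) \<Rightarrow> bool" where
  "left_continuous p e g \<longleftrightarrow>
     (\<forall>x' X. limitin (frechet_topology p) X x' sequentially \<and>
             (\<forall>k. basis_le p e (X k) (X (Suc k)))
         \<longrightarrow> (\<lambda>k. g (X k)) \<longlonglongrightarrow> g x')"

section \<open>Integration of vector-valued functions\<close>

text \<open>Functions are total on \<open>real\<close>; only their values on the interval \<open>S\<close> matter.\<close>

definition step_function :: "real set \<Rightarrow> (real \<Rightarrow> 'a) \<Rightarrow> bool" where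
  "step_function S h \<longleftrightarrow> finite (h ` S) \<and> (\<forall>a. {t \<in> S. h t = a} \<in> sets lebesgue)"

definition step_integral :: "real set \<Rightarrow> (real \<Rightarrow> 'a::real_vector) \<Rightarrow> 'a" where
  "step_integral S h = (\<Sum>a\<in>h ` S - {0}. measure lebesgue {t \<in> S. h t = a} *\<^sub>R a)"

definition approximating_steps ::
  "(nat \<Rightarrow> 'a::real_vector \<Rightarrow> real) \<Rightarrow> real set \<Rightarrow> (real \<Rightarrow> 'a) \<Rightarrow> (nat \<Rightarrow> real \<Rightarrow> 'a) \<Rightarrow> bool"
  where
  "approximating_steps p S g h \<longleftrightarrow>
     (\<forall>n. step_function S (h n)) \<and>
     (AE t in lebesgue_on S. limitin (frechet_topology p) (\<lambda>n. h n t) (g t) sequentially) \<and>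
     (\<forall>s. ((\<lambda>(n, m). integral\<^sup>L (lebesgue_on S) (\<lambda>t. p s (h n t - h m t))) \<longlongrightarrow> 0)
            (sequentially \<times>\<^sub>F sequentially))"

definition frechet_integrable ::
  "(nat \<Rightarrow> 'a::real_vector \<Rightarrow> real) \<Rightarrow> real set \<Rightarrow> (real \<Rightarrow> 'a) \<Rightarrow> bool" where
  "frechet_integrable p S g \<longleftrightarrow> (\<exists>h. approximating_steps p S g h)"

definition frechet_integral ::
  "(nat \<Rightarrow> 'a::real_vector \<Rightarrow> real) \<Rightarrow> real set \<Rightarrow> (real \<Rightarrow> 'a) \<Rightarrow> 'a" where
  "frechet_integral p S g = (THE I. \<exists>h. approximating_steps p S g h \<and>
     limitin (frechet_topology p) (\<lambda>n. step_integral S (h n)) I sequentially)"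

section \<open>The initial value problem\<close>

definition ivp_solution ::
  "(nat \<Rightarrow> 'a::real_vector \<Rightarrow> real) \<Rightarrow> real \<Rightarrow> (real \<Rightarrow> 'a \<Rightarrow> 'a) \<Rightarrow> 'a \<Rightarrow> (real \<Rightarrow> 'a) \<Rightarrow> bool"
  where
  "ivp_solution p T f x\<^sub>0 x \<longleftrightarrow>
     continuous_map (top_of_set {0..T}) (frechet_topology p) x \<and>
     frechet_integrable p {0..T} (\<lambda>t. f t (x t)) \<and>
     (\<forall>t\<in>{0..T}. x t = x\<^sub>0 + frechet_integral p {0..t} (\<lambda>\<xi>. f \<xi> (x \<xi>)))"

definition has_weak_derivative ::
  "(nat \<Rightarrow> 'a::real_vector \<Rightarrow> real) \<Rightarrow> real set \<Rightarrow> (real \<Rightarrow> 'a) \<Rightarrow> 'a \<Rightarrow> real \<Rightarrow> bool" where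
  "has_weak_derivative p S x d t \<longleftrightarrow>
     (\<forall>\<psi>\<in>dual_space p.
        ((\<lambda>h. \<psi> ((x (t + h) - x t) /\<^sub>R h)) \<longlongrightarrow> \<psi> d) (at 0 within {h. t + h \<in> S}))"

end

theory Submission
  imports Defs
begin

text \<open>The solution is the limit of the Picard iterates \<open>x\<^sub>0 = x_star\<close>,
  \<open>x\<^sub>n\<^sub>+\<^sub>1(t) = x_hat + \<integral>\<^sub>0\<^sup>t f(\<xi>, x\<^sub>n(\<xi>)) d\<xi>\<close>. By monotonicity of \<open>f\<close> and the choice of \<open>x_star\<close> they
  increase, and the upper bound \<open>C\<close> of \<open>f\<close> keeps \<open>x\<^sub>n(t)\<close> in the order interval from \<open>x_star\<close> to
  \<open>x_hat + t *\<^sub>R C\<close>, so all coordinates converge. Everything then rests on what an order interval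
  \<open>[lo, hi]\<close> of an unconditional basis is like: each sequence of numbers between the coordinates of
  \<open>lo\<close> and of \<open>hi\<close> is the coordinate sequence of an element (\<open>order_interval_element\<close>), and
  coordinatewise convergence inside the interval is convergence in the topology
  (\<open>order_interval_tends\<close>), because the tails of all its elements are controlled by those of
  \<open>hi - lo\<close>. The coordinates of \<open>f(t, x\<^sub>n(t))\<close> converge by left continuity, and dominated
  convergence for the order (\<open>order_dominated_convergence\<close>) passes to the limit in the integral.

  The tool behind the statements on order intervals is the seminorm \<open>q s x\<close>, the supremum of \<open>p s\<close>
  over all finite partial sums of the expansion of \<open>x\<close>. It is finite since the expansion is Cauchy
  with respect to finite index sets (\<open>permutations_imp_unordered_Cauchy\<close>), and it is monotone on
  positive elements. The space is also complete for the seminorms \<open>q s\<close>, so by the open mapping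
  argument (\<open>complete_finer_seminorms_dominated\<close>) they are continuous. This makes the coordinates
  continuous, the integral order preserving, and the function \<open>p s (g t)\<close> dominated by an integrable
  one whenever \<open>g\<close> lies between two integrable functions.

  For the iteration to make sense, \<open>t \<mapsto> f(t, x(t))\<close> must be integrable for a continuous curve \<open>x\<close>
  although \<open>f\<close> is only left continuous in its second argument. A curve bounded below is an increasing
  limit of step functions, namely of its infima over dyadic cells, and left continuity suffices along
  such a sequence (\<open>superposition_integrable\<close>).

  The derivative exists even in the topology of the space: an integrable function is almost everywhere
  a limit of step functions, which reduces Lebesgue's differentiation theorem to countably many real
  functions (\<open>indefinite_integral_differentiable_AE\<close>).\<close>

section \<open>Convergence in a Frechet space\<close>

lemma seminorm_zero: "seminorm q \<Longrightarrow> q 0 = 0"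
  unfolding seminorm_def by (metis abs_zero mult_zero_left scaleR_zero_left)

lemma seminorm_triangle: "seminorm q \<Longrightarrow> q (x + y) \<le> q x + q y"
  unfolding seminorm_def by blast

lemma seminorm_scale: "seminorm q \<Longrightarrow> q (c *\<^sub>R x) = \<bar>c\<bar> * q x"
  unfolding seminorm_def by blast

lemma seminorm_minus: "seminorm q \<Longrightarrow> q (- x) = q x"
  using seminorm_scale[of q "-1" x] by simp

lemma seminorm_diff_commute: "seminorm q \<Longrightarrow> q (x - y) = q (y - x)"
  using seminorm_minus[of q "x - y"] by simp

lemma seminorm_diff_triangle: "seminorm q \<Longrightarrow> q (x - z) \<le> q (x - y) + q (y - z)"
  using seminorm_triangle[of q "x - y" "y - z"] by simp

lemma seminorm_diff_le: "seminorm q \<Longrightarrow> q (x - y) \<le> q x + q y"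
  using seminorm_triangle[of q x "- y"] seminorm_minus[of q y] by simp

lemma seminorm_nonneg: "seminorm q \<Longrightarrow> 0 \<le> q x"
  using seminorm_diff_le[of q x x] seminorm_zero[of q] by simp

lemma seminorm_abs_diff: "seminorm q \<Longrightarrow> \<bar>q x - q y\<bar> \<le> q (x - y)"
  using seminorm_triangle[of q "x - y" y] seminorm_triangle[of q "y - x" x]
    seminorm_diff_commute[of q x y] by simp

lemma seminorm_sum: "seminorm q \<Longrightarrow> q (\<Sum>i\<in>F. v i) \<le> (\<Sum>i\<in>F. q (v i))"
proof (induction F rule: infinite_finite_induct)
  case (insert i F)
  then show ?case
    using seminorm_triangle[of q "v i" "\<Sum>i\<in>F. v i"] by simp
qed (simp_all add: seminorm_zero)

lemma seminorm_of_sum: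
  assumes "\<And>i. i \<in> F \<Longrightarrow> seminorm (Q i)"
  shows "seminorm (\<lambda>x. \<Sum>i\<in>F. Q i x)"
  unfolding seminorm_def
proof (intro conjI allI)
  fix x y show "(\<Sum>i\<in>F. Q i (x + y)) \<le> (\<Sum>i\<in>F. Q i x) + (\<Sum>i\<in>F. Q i y)"
    by (subst sum.distrib[symmetric], rule sum_mono, rule seminorm_triangle[OF assms])
next
  fix c x show "(\<Sum>i\<in>F. Q i (c *\<^sub>R x)) = \<bar>c\<bar> * (\<Sum>i\<in>F. Q i x)"
    by (subst sum_distrib_left, rule sum.cong[OF refl], rule seminorm_scale[OF assms])
qed

locale frechet =
  fixes p :: "nat \<Rightarrow> 'a::real_vector \<Rightarrow> real"
  assumes frechet_space: "frechet_space p"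
begin

lemma seminorm_p: "seminorm (p s)"
  using frechet_space unfolding frechet_space_def by blast

lemmas p_zero = seminorm_zero[OF seminorm_p]
  and p_triangle = seminorm_triangle[OF seminorm_p]
  and p_scale = seminorm_scale[OF seminorm_p]
  and p_commute = seminorm_diff_commute[OF seminorm_p]
  and p_diff_triangle = seminorm_diff_triangle[OF seminorm_p]
  and p_nonneg = seminorm_nonneg[OF seminorm_p]
  and p_abs_diff = seminorm_abs_diff[OF seminorm_p]

definition tends :: "('b \<Rightarrow> 'a) \<Rightarrow> 'a \<Rightarrow> 'b filter \<Rightarrow> bool" where
  "tends \<sigma> l F \<longleftrightarrow> (\<forall>s. ((\<lambda>n. p s (\<sigma> n - l)) \<longlongrightarrow> 0) F)"

lemma topspace_frechet: "topspace (frechet_topology p) = UNIV"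
  unfolding seminorm_topology_def topology_generated_by_topspace by auto

lemma tends_eventually_in_open:
  assumes \<sigma>: "tends \<sigma> l F" and "openin (frechet_topology p) U" and "l \<in> U"
  shows "eventually (\<lambda>n. \<sigma> n \<in> U) F"
proof -
  have "generate_topology_on
      (insert UNIV {{y \<in> UNIV. q (y - x) < \<epsilon>} | q x \<epsilon>. q \<in> range p \<and> x \<in> UNIV \<and> 0 < \<epsilon>}) U"
    using assms(2) unfolding seminorm_topology_def by (simp add: openin_topology_generated_by_iff)
  then show ?thesis using \<open>l \<in> U\<close>
  proof (induction rule: generate_topology_on.induct)
    case (UN K)
    then obtain k where k: "k \<in> K" "l \<in> k" by auto
    from UN.IH[OF k] show ?case by eventually_elim (use k in auto)
  next
    case (Basis b)
    show ?case
    proof (cases "b = UNIV")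
      case False
      with Basis obtain s x \<epsilon> where b: "b = {y. p s (y - x) < \<epsilon>}" by auto
      with Basis have "0 < \<epsilon> - p s (l - x)" by auto
      then have "eventually (\<lambda>n. p s (\<sigma> n - l) < \<epsilon> - p s (l - x)) F"
        using \<sigma> unfolding tends_def by (intro order_tendstoD(2)[of _ 0]) auto
      then show ?thesis
      proof eventually_elim
        case (elim n)
        then show ?case using p_diff_triangle[of s "\<sigma> n" x l] by (simp add: b)
      qed
    qed simp
  qed (auto intro: eventually_conj)
qed

lemma limitin_iff_tends: "limitin (frechet_topology p) \<sigma> l F \<longleftrightarrow> tends \<sigma> l F"
proof
  assume L: "limitin (frechet_topology p) \<sigma> l F"
  show "tends \<sigma> l F" unfolding tends_def
  proof (intro allI tendstoI)
    fix s and \<epsilon> :: real assume "0 < \<epsilon>"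
    then have "openin (frechet_topology p) {y \<in> UNIV. p s (y - l) < \<epsilon>}"
      unfolding seminorm_topology_def by (intro topology_generated_by_Basis) blast
    then have "eventually (\<lambda>n. \<sigma> n \<in> {y \<in> UNIV. p s (y - l) < \<epsilon>}) F"
      using L \<open>0 < \<epsilon>\<close> p_zero[of s] unfolding limitin_def
      by (elim conjE allE[of _ "{y \<in> UNIV. p s (y - l) < \<epsilon>}"]) simp
    then show "eventually (\<lambda>n. dist (p s (\<sigma> n - l)) 0 < \<epsilon>) F"
      by eventually_elim (simp add: p_nonneg)
  qed
next
  assume "tends \<sigma> l F"
  then show "limitin (frechet_topology p) \<sigma> l F"
    unfolding limitin_def topspace_frechet using tends_eventually_in_open by blast
qed

lemma separated: "(\<And>s. p s x = 0) \<Longrightarrow> x = 0"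
proof -
  assume x: "\<And>s. p s x = 0"
  have "Hausdorff_space (frechet_topology p)"
    using frechet_space unfolding frechet_space_def by blast
  moreover have "limitin (frechet_topology p) (\<lambda>n::nat. x) x sequentially"
    "limitin (frechet_topology p) (\<lambda>n::nat. x) 0 sequentially"
    unfolding limitin_iff_tends tends_def by (simp_all add: x p_zero)
  ultimately show "x = 0"
    by (meson limitin_Hausdorff_unique trivial_limit_sequentially)
qed

lemma tends_const: "tends (\<lambda>n. x) x F"
  unfolding tends_def by (simp add: p_zero)

lemma tends_unique:
  assumes "tends \<sigma> l F" "tends \<sigma> l' F" "F \<noteq> bot" shows "l = l'"
proof -
  have "p s (l - l') = 0" for s
  proof -
    have "((\<lambda>n. p s (\<sigma> n - l) + p s (\<sigma> n - l')) \<longlongrightarrow> 0 + 0) F"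
      using assms(1,2) unfolding tends_def by (intro tendsto_add) auto
    moreover have "p s (l - l') \<le> p s (\<sigma> n - l) + p s (\<sigma> n - l')" for n
      using p_diff_triangle[of s l l' "\<sigma> n"] p_commute[of s l "\<sigma> n"] by simp
    ultimately have "p s (l - l') \<le> 0 + 0"
      using assms(3) by (intro tendsto_lowerbound) (auto intro: always_eventually)
    then show ?thesis using p_nonneg[of s "l - l'"] by simp
  qed
  then show ?thesis using separated[of "l - l'"] by simp
qed

lemma complete:
  assumes "\<And>s \<epsilon>. 0 < \<epsilon> \<Longrightarrow> \<exists>N. \<forall>m\<ge>N. \<forall>n\<ge>N. p s (\<sigma> m - \<sigma> n) < \<epsilon>"
  obtains l where "tends \<sigma> l sequentially"
proof -
  have "seminorm_Cauchy p \<sigma>" unfolding seminorm_Cauchy_def using assms by blast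
  then show ?thesis
    using frechet_space that unfolding frechet_space_def limitin_iff_tends by blast
qed

lemma tends_add:
  assumes "tends \<sigma> l F" "tends \<tau> m F" shows "tends (\<lambda>n. \<sigma> n + \<tau> n) (l + m) F"
  unfolding tends_def
proof
  fix s
  have "((\<lambda>n. p s (\<sigma> n - l) + p s (\<tau> n - m)) \<longlongrightarrow> 0 + 0) F"
    using assms unfolding tends_def by (intro tendsto_add) auto
  moreover have "p s (\<sigma> n + \<tau> n - (l + m)) \<le> p s (\<sigma> n - l) + p s (\<tau> n - m)" for n
    using p_triangle[of s "\<sigma> n - l" "\<tau> n - m"] by (simp add: algebra_simps)
  ultimately show "((\<lambda>n. p s (\<sigma> n + \<tau> n - (l + m))) \<longlongrightarrow> 0) F"
    using tendsto_sandwich[of "\<lambda>n. 0" "\<lambda>n. p s (\<sigma> n + \<tau> n - (l + m))" F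
      "\<lambda>n. p s (\<sigma> n - l) + p s (\<tau> n - m)" 0]
    by (simp add: p_nonneg)
qed

lemma tends_scale:
  assumes "tends \<sigma> l F" shows "tends (\<lambda>n. c *\<^sub>R \<sigma> n) (c *\<^sub>R l) F"
  unfolding tends_def
proof
  fix s
  have "((\<lambda>n. \<bar>c\<bar> * p s (\<sigma> n - l)) \<longlongrightarrow> \<bar>c\<bar> * 0) F"
    using assms unfolding tends_def by (intro tendsto_mult_left) auto
  then show "((\<lambda>n. p s (c *\<^sub>R \<sigma> n - c *\<^sub>R l)) \<longlongrightarrow> 0) F"
    by (simp add: p_scale flip: scaleR_diff_right)
qed

lemma tends_diff:
  assumes "tends \<sigma> l F" "tends \<tau> m F" shows "tends (\<lambda>n. \<sigma> n - \<tau> n) (l - m) F"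
  using tends_add[OF assms(1) tends_scale[OF assms(2), of "-1"]] by simp

lemma tends_p:
  assumes "tends \<sigma> l F" shows "((\<lambda>n. p s (\<sigma> n)) \<longlongrightarrow> p s l) F"
proof -
  have "((\<lambda>n. p s (\<sigma> n) - p s l) \<longlongrightarrow> 0) F"
  proof (rule Lim_null_comparison)
    show "eventually (\<lambda>n. norm (p s (\<sigma> n) - p s l) \<le> p s (\<sigma> n - l)) F"
      by (rule always_eventually, rule allI, subst real_norm_def, rule p_abs_diff)
    show "((\<lambda>n. p s (\<sigma> n - l)) \<longlongrightarrow> 0) F"
      using assms unfolding tends_def by blast
  qed
  then show ?thesis by (simp add: LIM_zero_iff)
qed

end

section \<open>Step functions\<close>

lemma step_function_levels: "step_function S h \<Longrightarrow> {t \<in> S. h t \<in> A} \<in> sets lebesgue"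
proof -
  assume h: "step_function S h"
  have "{t \<in> S. h t \<in> A} = (\<Union>a\<in>h ` S \<inter> A. {t \<in> S. h t = a})" by auto
  also have "\<dots> \<in> sets lebesgue"
    using h unfolding step_function_def by (intro sets.finite_UN finite_Int) auto
  finally show ?thesis .
qed

lemma step_function_comp:
  assumes "step_function S h" shows "step_function S (\<lambda>t. F (h t))"
  unfolding step_function_def
proof (intro conjI allI)
  show "finite ((\<lambda>t. F (h t)) ` S)"
    using assms unfolding step_function_def image_image[symmetric] by blast
  show "{t \<in> S. F (h t) = a} \<in> sets lebesgue" for a
    using step_function_levels[OF assms, of "{b. F b = a}"] by simp
qed

lemma step_function_Pair:
  assumes "step_function S h" "step_function S k"
  shows "step_function S (\<lambda>t. (h t, k t))"
  unfolding step_function_def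
proof (intro conjI allI)
  have "(\<lambda>t. (h t, k t)) ` S \<subseteq> h ` S \<times> k ` S" by auto
  then show "finite ((\<lambda>t. (h t, k t)) ` S)"
    using assms finite_subset unfolding step_function_def by blast
  fix ab
  have "{t \<in> S. (h t, k t) = ab} = {t \<in> S. h t = fst ab} \<inter> {t \<in> S. k t = snd ab}" by auto
  then show "{t \<in> S. (h t, k t) = ab} \<in> sets lebesgue"
    using assms unfolding step_function_def by auto
qed

lemma step_function_comp2:
  assumes "step_function S h" "step_function S k"
  shows "step_function S (\<lambda>t. F (h t) (k t))"
  using step_function_comp[OF step_function_Pair[OF assms], of "case_prod F"] by simp

lemma step_function_const: "S \<in> sets lebesgue \<Longrightarrow> step_function S (\<lambda>t. c)"
  unfolding step_function_def by (auto simp: image_constant_conv)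

lemma step_function_if:
  assumes "step_function S h" "A \<in> sets lebesgue" "S \<in> sets lebesgue"
  shows "step_function S (\<lambda>t. if t \<in> A then h t else c)"
proof -
  have "step_function S (\<lambda>t. t \<in> A)" unfolding step_function_def
  proof (intro conjI allI)
    fix b
    have "{t \<in> S. (t \<in> A) = b} = (if b then S \<inter> A else S - A)" by auto
    then show "{t \<in> S. (t \<in> A) = b} \<in> sets lebesgue" using assms by auto
  qed auto
  from step_function_comp2[OF this assms(1), of "\<lambda>b x. if b then x else c"] show ?thesis .
qed

lemma step_function_subset:
  assumes "step_function S h" "A \<in> sets lebesgue" "A \<subseteq> S"
  shows "step_function A h"
  unfolding step_function_def
proof (intro conjI allI)
  show "finite (h ` A)"
    using assms finite_subset[of "h ` A" "h ` S"] unfolding step_function_def by blast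
  fix a
  have "{t \<in> A. h t = a} = {t \<in> S. h t = a} \<inter> A" using assms by auto
  then show "{t \<in> A. h t = a} \<in> sets lebesgue"
    using assms unfolding step_function_def by auto
qed

text \<open>The level sets of \<open>F \<circ> u\<close> are unions of level sets of \<open>u\<close>. Applied to a pair of step functions
  this gives their common refinement, hence the additivity of the integral.\<close>

lemma step_integral_comp:
  assumes u: "step_function S u" and S: "S \<in> lmeasurable"
  shows "step_integral S (\<lambda>t. F (u t)) = (\<Sum>b\<in>u ` S. measure lebesgue {t \<in> S. u t = b} *\<^sub>R F b)"
proof -
  let ?m = "\<lambda>b. measure lebesgue {t \<in> S. u t = b}"
  have fin: "finite (u ` S)" using u unfolding step_function_def by blast
  have lm: "{t \<in> S. u t = b} \<in> lmeasurable" for b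
    using u S fmeasurableI2[of S lebesgue "{t \<in> S. u t = b}"] unfolding step_function_def by auto
  have level: "measure lebesgue {t \<in> S. F (u t) = a} = (\<Sum>b\<in>{b\<in>u ` S. F b = a}. ?m b)" for a
  proof -
    have "{t \<in> S. F (u t) = a} = (\<Union>b\<in>{b\<in>u ` S. F b = a}. {t \<in> S. u t = b})" by auto
    also have "measure lebesgue \<dots> = (\<Sum>b\<in>{b\<in>u ` S. F b = a}. ?m b)"
      using fin lm fmeasurableD2[OF lm] by (intro measure_finite_Union) (auto simp: disjoint_family_on_def)
    finally show ?thesis .
  qed
  have img: "(\<lambda>t. F (u t)) ` S = F ` u ` S" by auto
  have "step_integral S (\<lambda>t. F (u t)) = (\<Sum>a\<in>F ` u ` S. measure lebesgue {t \<in> S. F (u t) = a} *\<^sub>R a)"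
    unfolding step_integral_def img using fin by (intro sum.mono_neutral_left) auto
  also have "\<dots> = (\<Sum>a\<in>F ` u ` S. \<Sum>b\<in>{b\<in>u ` S. F b = a}. ?m b *\<^sub>R F b)"
    unfolding level scaleR_left.sum by (intro sum.cong) auto
  also have "\<dots> = (\<Sum>b\<in>u ` S. ?m b *\<^sub>R F b)"
    using fin by (intro sum.group) auto
  finally show ?thesis .
qed

lemma step_integral_add:
  assumes "step_function S h" "step_function S k" "S \<in> lmeasurable"
  shows "step_integral S (\<lambda>t. h t + k t) = step_integral S h + step_integral S k"
  using step_integral_comp[OF step_function_Pair[OF assms(1,2)] assms(3), of "\<lambda>(x,y). x + y"]
    step_integral_comp[OF step_function_Pair[OF assms(1,2)] assms(3), of fst]
    step_integral_comp[OF step_function_Pair[OF assms(1,2)] assms(3), of snd]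
  by (simp add: sum.distrib[symmetric] scaleR_add_right case_prod_beta)

lemma step_integral_scale:
  assumes "step_function S h" "S \<in> lmeasurable"
  shows "step_integral S (\<lambda>t. c *\<^sub>R h t) = c *\<^sub>R step_integral S h"
  using step_integral_comp[OF assms, of "\<lambda>x. c *\<^sub>R x"] step_integral_comp[OF assms, of "\<lambda>x. x"]
  by (simp add: scaleR_right.sum mult.commute)

lemma step_integral_diff:
  assumes "step_function S h" "step_function S k" "S \<in> lmeasurable"
  shows "step_integral S (\<lambda>t. h t - k t) = step_integral S h - step_integral S k"
  using step_integral_add[OF assms(1) step_function_comp[OF assms(2), of "\<lambda>x. (-1) *\<^sub>R x"] assms(3)]
    step_integral_scale[OF assms(2,3), of "-1"]
  by simp

lemma step_integral_const:
  assumes "S \<in> lmeasurable"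
  shows "step_integral S (\<lambda>t. c) = measure lebesgue S *\<^sub>R c"
  unfolding step_integral_def by (cases "S = {}"; cases "c = 0") (auto simp: image_constant_conv)

lemma step_function_real_integral:
  fixes F :: "'b \<Rightarrow> real"
  assumes u: "step_function S u" and S: "S \<in> lmeasurable"
  shows "integrable (lebesgue_on S) (\<lambda>t. F (u t))"
    and "integral\<^sup>L (lebesgue_on S) (\<lambda>t. F (u t))
      = (\<Sum>b\<in>u ` S. measure lebesgue {t \<in> S. u t = b} * F b)"
proof -
  have Sm: "S \<in> sets lebesgue" using S by auto
  have fin: "finite (u ` S)" using u unfolding step_function_def by blast
  have lm: "{t \<in> S. u t = b} \<in> lmeasurable" for b
    using u S fmeasurableI2[of S lebesgue "{t \<in> S. u t = b}"] unfolding step_function_def by auto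
  have m: "measure (lebesgue_on S) {t \<in> S. u t = b} = measure lebesgue {t \<in> S. u t = b}"
    and sets: "{t \<in> S. u t = b} \<in> sets (lebesgue_on S)"
    and em: "emeasure (lebesgue_on S) {t \<in> S. u t = b} < \<infinity>" for b
    using lm[of b] Sm by (auto simp: measure_restrict_space emeasure_restrict_space sets_restrict_space fmeasurable_def)
  have eq: "F (u t) = (\<Sum>b\<in>u ` S. indicator {t \<in> S. u t = b} t * F b)" if "t \<in> S" for t
  proof -
    have "(\<Sum>b\<in>u ` S. indicator {t \<in> S. u t = b} t * F b) = (\<Sum>b\<in>{u t}. indicator {t \<in> S. u t = b} t * F b)"
      using fin that by (intro sum.mono_neutral_right) auto
    then show ?thesis using that by simp
  qed
  have int: "integrable (lebesgue_on S) (\<lambda>t. indicator {t \<in> S. u t = b} t * F b)" for b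
    using sets[of b] em[of b] by (intro integrable_mult_left) (auto intro: integrable_real_indicator)
  have "integrable (lebesgue_on S) (\<lambda>t. \<Sum>b\<in>u ` S. indicator {t \<in> S. u t = b} t * F b)"
    using int by auto
  moreover have cong: "integrable (lebesgue_on S) (\<lambda>t. F (u t))
      = integrable (lebesgue_on S) (\<lambda>t. \<Sum>b\<in>u ` S. indicator {t \<in> S. u t = b} t * F b)"
    by (rule Bochner_Integration.integrable_cong) (auto simp: eq)
  ultimately show "integrable (lebesgue_on S) (\<lambda>t. F (u t))" by simp
  have "integral\<^sup>L (lebesgue_on S) (\<lambda>t. F (u t))
      = integral\<^sup>L (lebesgue_on S) (\<lambda>t. \<Sum>b\<in>u ` S. indicator {t \<in> S. u t = b} t * F b)"
    by (rule Bochner_Integration.integral_cong) (auto simp: eq)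
  also have "\<dots> = (\<Sum>b\<in>u ` S. integral\<^sup>L (lebesgue_on S) (\<lambda>t. indicator {t \<in> S. u t = b} t * F b))"
    using int by (intro Bochner_Integration.integral_sum) auto
  also have "\<dots> = (\<Sum>b\<in>u ` S. measure lebesgue {t \<in> S. u t = b} * F b)"
    using sets by (intro sum.cong refl) (simp add: m[symmetric] Int_absorb2 Collect_restrict)
  finally show "integral\<^sup>L (lebesgue_on S) (\<lambda>t. F (u t))
      = (\<Sum>b\<in>u ` S. measure lebesgue {t \<in> S. u t = b} * F b)" .
qed

lemma seminorm_step_integral_le:
  assumes q: "seminorm q" and h: "step_function S h" and S: "S \<in> lmeasurable"
  shows "q (step_integral S h) \<le> integral\<^sup>L (lebesgue_on S) (\<lambda>t. q (h t))"
proof -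
  have "step_integral S h = (\<Sum>b\<in>h ` S. measure lebesgue {t \<in> S. h t = b} *\<^sub>R b)"
    using step_integral_comp[OF h S, of "\<lambda>x. x"] by simp
  also have "q \<dots> \<le> (\<Sum>b\<in>h ` S. q (measure lebesgue {t \<in> S. h t = b} *\<^sub>R b))"
    by (rule seminorm_sum[OF q])
  also have "\<dots> = integral\<^sup>L (lebesgue_on S) (\<lambda>t. q (h t))"
    unfolding step_function_real_integral(2)[OF h S] seminorm_scale[OF q] by simp
  finally show ?thesis .
qed

lemma linear_step_integral:
  fixes \<phi> :: "'a::real_vector \<Rightarrow> real"
  assumes \<phi>: "linear \<phi>" and h: "step_function S h" and S: "S \<in> lmeasurable"
  shows "\<phi> (step_integral S h) = integral\<^sup>L (lebesgue_on S) (\<lambda>t. \<phi> (h t))"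
proof -
  have "step_integral S h = (\<Sum>b\<in>h ` S. measure lebesgue {t \<in> S. h t = b} *\<^sub>R b)"
    using step_integral_comp[OF h S, of "\<lambda>x. x"] by simp
  then show ?thesis
    unfolding step_function_real_integral(2)[OF h S] using \<phi> by (simp add: linear_sum linear_scale)
qed

lemma step_integral_if:
  assumes h: "step_function S h" and S: "S \<in> lmeasurable" and A: "A \<in> sets lebesgue" "A \<subseteq> S"
  shows "step_integral S (\<lambda>t. if t \<in> A then h t else 0) = step_integral A h"
  unfolding step_integral_def
  by (rule sum.cong) (use A in \<open>auto intro!: arg_cong2[where f = scaleR] arg_cong[where f = "measure lebesgue"] split: if_splits\<close>)

section \<open>Almost everywhere limits of real functions\<close>

text \<open>Completeness of Lebesgue measure allows the exceptional set to be arbitrary.\<close>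

lemma borel_measurable_lebesgue_on_AE_limit:
  fixes u :: "nat \<Rightarrow> real \<Rightarrow> real"
  assumes S: "S \<in> sets lebesgue" and u: "\<And>n. u n \<in> borel_measurable (lebesgue_on S)"
    and lim: "AE x in lebesgue_on S. (\<lambda>n. u n x) \<longlonglongrightarrow> v x"
  shows "v \<in> borel_measurable (lebesgue_on S)"
proof -
  have "AE x in lebesgue. x \<in> S \<longrightarrow> (\<lambda>n. u n x) \<longlonglongrightarrow> v x"
    using lim S by (subst (asm) AE_restrict_space_iff) auto
  then obtain N where N: "N \<in> null_sets lebesgue" "{x. \<not> (x \<in> S \<longrightarrow> (\<lambda>n. u n x) \<longlonglongrightarrow> v x)} \<subseteq> N"
    unfolding eventually_ae_filter by auto
  define w where "w n x = (if x \<in> S - N then u n x else 0)" for n x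
  have SN: "S - N \<in> sets lebesgue" using S N by auto
  have w: "w n \<in> borel_measurable lebesgue" for n
  proof -
    have "u n \<in> borel_measurable (lebesgue_on (S - N))"
      using u[of n] by (rule measurable_restrict_mono) auto
    from borel_measurable_if_I[OF this SN] show ?thesis unfolding w_def .
  qed
  have "(\<lambda>n. w n x) \<longlonglongrightarrow> (if x \<in> S - N then v x else 0)" for x
    unfolding w_def using N by (cases "x \<in> S - N") auto
  then have lim_meas: "(\<lambda>x. if x \<in> S - N then v x else 0) \<in> borel_measurable lebesgue"
    using w by (rule borel_measurable_LIMSEQ_real)
  have "AE x in lebesgue. (if x \<in> S - N then v x else 0) = (if x \<in> S then v x else 0)"
    using AE_not_in[OF N(1)] by eventually_elim auto
  from borel_measurable_AE[OF lim_meas this]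
  show ?thesis
    by (rule borel_measurable_if_D)
qed

lemma Fatou_bound:
  fixes u :: "nat \<Rightarrow> 'b \<Rightarrow> real"
  assumes u: "\<And>n. integrable M (u n)" and pos: "\<And>n x. 0 \<le> u n x"
    and lim: "AE x in M. (\<lambda>n. u n x) \<longlonglongrightarrow> v x" and v: "v \<in> borel_measurable M" "\<And>x. 0 \<le> v x"
    and bound: "\<And>n. N \<le> n \<Longrightarrow> integral\<^sup>L M (u n) \<le> c"
  shows "integrable M v" and "integral\<^sup>L M v \<le> c"
proof -
  have "0 \<le> integral\<^sup>L M (u N)" by (rule integral_nonneg_AE) (simp add: pos)
  then have c: "0 \<le> c" using bound[of N] by simp
  have "(\<integral>\<^sup>+x. ennreal (v x) \<partial>M) = (\<integral>\<^sup>+x. liminf (\<lambda>n. ennreal (u n x)) \<partial>M)"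
    using lim by (intro nn_integral_cong_AE)
      (auto elim!: eventually_mono intro!: lim_imp_Liminf[symmetric] tendsto_ennrealI)
  also have "\<dots> \<le> liminf (\<lambda>n. \<integral>\<^sup>+x. ennreal (u n x) \<partial>M)"
    using u by (intro nn_integral_liminf) auto
  also have "\<dots> \<le> liminf (\<lambda>n. ennreal c)"
  proof (rule Liminf_mono)
    show "eventually (\<lambda>n. (\<integral>\<^sup>+x. ennreal (u n x) \<partial>M) \<le> ennreal c) sequentially"
      using eventually_ge_at_top[of N]
      by eventually_elim
        (subst nn_integral_eq_integral[OF u], auto simp: pos intro!: ennreal_leI bound)
  qed
  also have "\<dots> = ennreal c" by (simp add: Liminf_const)
  finally have le: "(\<integral>\<^sup>+x. ennreal (v x) \<partial>M) \<le> ennreal c" .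
  then show int: "integrable M v"
    using v by (intro integrableI_nonneg) (auto intro: order_le_less_trans)
  have "ennreal (integral\<^sup>L M v) \<le> ennreal c"
    using le nn_integral_eq_integral[OF int] v(2) by simp
  then show "integral\<^sup>L M v \<le> c" using c by simp
qed

lemma AE_tendsto_zero_of_summable_integrals:
  fixes u :: "nat \<Rightarrow> 'b \<Rightarrow> real"
  assumes u: "\<And>n. integrable M (u n)" and pos: "\<And>n x. 0 \<le> u n x"
    and sum: "summable (\<lambda>n. integral\<^sup>L M (u n))"
  shows "AE x in M. (\<lambda>n. u n x) \<longlonglongrightarrow> 0"
proof -
  have "(\<integral>\<^sup>+x. (\<Sum>n. ennreal (u n x)) \<partial>M) = (\<Sum>n. \<integral>\<^sup>+x. ennreal (u n x) \<partial>M)"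
    using u by (intro nn_integral_suminf) auto
  also have "\<dots> = (\<Sum>n. ennreal (integral\<^sup>L M (u n)))"
    using u pos by (simp add: nn_integral_eq_integral)
  also have "\<dots> = ennreal (\<Sum>n. integral\<^sup>L M (u n))"
    using sum by (intro suminf_ennreal2) (auto intro!: integral_nonneg_AE simp: pos)
  finally have "(\<integral>\<^sup>+x. (\<Sum>n. ennreal (u n x)) \<partial>M) \<noteq> \<infinity>" by simp
  then have "AE x in M. (\<Sum>n. ennreal (u n x)) \<noteq> \<infinity>"
    using u by (intro nn_integral_PInf_AE) auto
  then show ?thesis
  proof eventually_elim
    case (elim x)
    then have "summable (\<lambda>n. u n x)"
      using pos by (intro summable_suminf_not_top) auto
    then show ?case by (rule summable_LIMSEQ_zero)
  qed
qed

section \<open>The integral of Frechet-valued functions\<close>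

context frechet
begin

text \<open>The relation behind the description operator in \<open>frechet_integral\<close>; it can be used before
  uniqueness of the integral is known.\<close>

definition has_frechet_integral :: "real set \<Rightarrow> (real \<Rightarrow> 'a) \<Rightarrow> 'a \<Rightarrow> bool" where
  "has_frechet_integral S g I \<longleftrightarrow> (\<exists>h. approximating_steps p S g h \<and>
     tends (\<lambda>n. step_integral S (h n)) I sequentially)"

text \<open>A double sequence is Cauchy in the mean as soon as it is bounded by \<open>a s n + a s m\<close> with null
  sequences \<open>a s\<close>; \<open>approximating_steps_mean\<close> supplies such sequences, the mean distances
  to the limit.\<close>

lemma approximating_stepsI:
  assumes step: "\<And>n. step_function S (h n)"
    and lim: "AE t in lebesgue_on S. tends (\<lambda>n. h n t) (g t) sequentially"
    and a: "\<And>s. a s \<longlonglongrightarrow> 0"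
    and bound: "\<And>s n m. integral\<^sup>L (lebesgue_on S) (\<lambda>t. p s (h n t - h m t)) \<le> a s n + a s m"
  shows "approximating_steps p S g h"
  unfolding approximating_steps_def limitin_iff_tends
proof (intro conjI allI step lim)
  fix s
  have "((\<lambda>(n, m). a s n + a s m) \<longlongrightarrow> 0 + 0) (sequentially \<times>\<^sub>F sequentially)"
    unfolding case_prod_beta
    by (intro tendsto_add filterlim_compose[OF a filterlim_fst] filterlim_compose[OF a filterlim_snd])
  then have le: "((\<lambda>(n, m). a s n + a s m) \<longlongrightarrow> 0) (sequentially \<times>\<^sub>F sequentially)" by simp
  show "((\<lambda>(n, m). integral\<^sup>L (lebesgue_on S) (\<lambda>t. p s (h n t - h m t))) \<longlongrightarrow> 0)
      (sequentially \<times>\<^sub>F sequentially)"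
  proof (rule tendsto_sandwich[OF _ _ tendsto_const le])
    show "\<forall>\<^sub>F x in sequentially \<times>\<^sub>F sequentially.
        0 \<le> (case x of (n, m) \<Rightarrow> integral\<^sup>L (lebesgue_on S) (\<lambda>t. p s (h n t - h m t)))"
      by (auto intro!: always_eventually integral_nonneg_AE simp: p_nonneg)
    show "\<forall>\<^sub>F x in sequentially \<times>\<^sub>F sequentially.
        (case x of (n, m) \<Rightarrow> integral\<^sup>L (lebesgue_on S) (\<lambda>t. p s (h n t - h m t)))
        \<le> (case x of (n, m) \<Rightarrow> a s n + a s m)"
      using bound by (auto intro!: always_eventually)
  qed
qed

lemma approximating_steps_step: "approximating_steps p S g h \<Longrightarrow> step_function S (h n)"
  unfolding approximating_steps_def by blast

lemma approximating_steps_AE: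
  "approximating_steps p S g h \<Longrightarrow> AE t in lebesgue_on S. tends (\<lambda>n. h n t) (g t) sequentially"
  unfolding approximating_steps_def limitin_iff_tends by blast

lemma step_function_integrable_p:
  assumes "step_function S h" "S \<in> lmeasurable"
  shows "integrable (lebesgue_on S) (\<lambda>t. p s (h t))"
  by (rule step_function_real_integral[OF assms])

lemma integrable_p_step_diff:
  assumes "step_function S h" "step_function S k" "S \<in> lmeasurable"
  shows "integrable (lebesgue_on S) (\<lambda>t. p s (h t - k t))"
  by (rule step_function_integrable_p[OF step_function_comp2[OF assms(1,2)] assms(3)])

text \<open>Approximation in mean: by Fatou's lemma, the Cauchy condition in \<open>approximating_steps\<close>
  already yields convergence of the step functions to \<open>g\<close> in every mean seminorm.\<close>

lemma approximating_steps_mean: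
  assumes h: "approximating_steps p S g h" and S: "S \<in> lmeasurable"
  shows "integrable (lebesgue_on S) (\<lambda>t. p s (h n t - g t))"
    and "(\<lambda>n. integral\<^sup>L (lebesgue_on S) (\<lambda>t. p s (h n t - g t))) \<longlonglongrightarrow> 0"
proof -
  have Sm: "S \<in> sets lebesgue" using S by auto
  note step = approximating_steps_step[OF h]
  note int = integrable_p_step_diff[OF step step S]
  have lim: "AE t in lebesgue_on S. (\<lambda>m. p s (h n t - h m t)) \<longlonglongrightarrow> p s (h n t - g t)" for n
    using approximating_steps_AE[OF h]
    by eventually_elim (rule tends_p, rule tends_diff, rule tends_const)
  have meas: "(\<lambda>t. p s (h n t - g t)) \<in> borel_measurable (lebesgue_on S)" for n
    by (rule borel_measurable_lebesgue_on_AE_limit[OF Sm borel_measurable_integrable[OF int] lim])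
  have mean: "\<exists>N. \<forall>n\<ge>N. integrable (lebesgue_on S) (\<lambda>t. p s (h n t - g t)) \<and>
      integral\<^sup>L (lebesgue_on S) (\<lambda>t. p s (h n t - g t)) \<le> \<epsilon>" if "0 < \<epsilon>" for \<epsilon>
  proof -
    have "((\<lambda>(n, m). integral\<^sup>L (lebesgue_on S) (\<lambda>t. p s (h n t - h m t))) \<longlongrightarrow> 0)
        (sequentially \<times>\<^sub>F sequentially)"
      using h unfolding approximating_steps_def by blast
    then have "\<forall>\<^sub>F x in sequentially \<times>\<^sub>F sequentially.
        (case x of (n, m) \<Rightarrow> integral\<^sup>L (lebesgue_on S) (\<lambda>t. p s (h n t - h m t))) < \<epsilon>"
      using that by (rule order_tendstoD(2))
    then obtain P Q where PQ: "eventually P sequentially" "eventually Q sequentially"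
      and le: "\<And>n m. P n \<Longrightarrow> Q m \<Longrightarrow> integral\<^sup>L (lebesgue_on S) (\<lambda>t. p s (h n t - h m t)) < \<epsilon>"
      unfolding eventually_prod_filter by auto
    then obtain N M where N: "\<And>n. N \<le> n \<Longrightarrow> P n" and M: "\<And>m. M \<le> m \<Longrightarrow> Q m"
      unfolding eventually_sequentially by blast
    have "integrable (lebesgue_on S) (\<lambda>t. p s (h n t - g t)) \<and>
      integral\<^sup>L (lebesgue_on S) (\<lambda>t. p s (h n t - g t)) \<le> \<epsilon>" if "N \<le> n" for n
    proof -
      note fatou = Fatou_bound[where u = "\<lambda>m t. p s (h n t - h m t)" and N = M and c = \<epsilon>,
          OF int p_nonneg lim[of n] meas p_nonneg less_imp_le[OF le[OF N[OF that] M]]]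
      show ?thesis using fatou by blast
    qed
    then show ?thesis by blast
  qed
  from mean[of 1] obtain N where N: "integrable (lebesgue_on S) (\<lambda>t. p s (h N t - g t))" by auto
  have int_g: "integrable (lebesgue_on S) (\<lambda>t. p s (h n t - g t))" for n
  proof (rule Bochner_Integration.integrable_bound[OF Bochner_Integration.integrable_add[OF int[of s n N] N] meas])
    have "norm (p s (h n t - g t)) \<le> norm (p s (h n t - h N t) + p s (h N t - g t))" for t
      using p_diff_triangle[of s "h n t" "g t" "h N t"] by (simp add: p_nonneg)
    then show "AE t in lebesgue_on S. norm (p s (h n t - g t)) \<le> norm (p s (h n t - h N t) + p s (h N t - g t))"
      by (rule AE_I2)
  qed
  then show "integrable (lebesgue_on S) (\<lambda>t. p s (h n t - g t))" .
  show "(\<lambda>n. integral\<^sup>L (lebesgue_on S) (\<lambda>t. p s (h n t - g t))) \<longlonglongrightarrow> 0"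
  proof (rule LIMSEQ_I)
    fix \<epsilon> :: real assume \<epsilon>: "0 < \<epsilon>"
    then obtain N where N: "\<And>n. N \<le> n \<Longrightarrow> integral\<^sup>L (lebesgue_on S) (\<lambda>t. p s (h n t - g t)) \<le> \<epsilon> / 2"
      using mean[of "\<epsilon> / 2"] by auto
    have "norm (integral\<^sup>L (lebesgue_on S) (\<lambda>t. p s (h n t - g t)) - 0) < \<epsilon>" if "N \<le> n" for n
    proof -
      have "0 \<le> integral\<^sup>L (lebesgue_on S) (\<lambda>t. p s (h n t - g t))"
        by (rule integral_nonneg_AE) (simp add: p_nonneg)
      then show ?thesis using N[OF that] \<epsilon> by simp
    qed
    then show "\<exists>no. \<forall>n\<ge>no. norm (integral\<^sup>L (lebesgue_on S) (\<lambda>t. p s (h n t - g t)) - 0) < \<epsilon>"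
      by blast
  qed
qed

lemma integral_step_diff_le:
  assumes h: "approximating_steps p S g h" and S: "S \<in> lmeasurable"
  shows "integral\<^sup>L (lebesgue_on S) (\<lambda>t. p s (h n t - h m t))
     \<le> integral\<^sup>L (lebesgue_on S) (\<lambda>t. p s (h n t - g t)) + integral\<^sup>L (lebesgue_on S) (\<lambda>t. p s (h m t - g t))"
proof -
  note mean = approximating_steps_mean(1)[OF h S]
  note step = approximating_steps_step[OF h]
  have "integral\<^sup>L (lebesgue_on S) (\<lambda>t. p s (h n t - h m t))
     \<le> integral\<^sup>L (lebesgue_on S) (\<lambda>t. p s (h n t - g t) + p s (h m t - g t))"
  proof (rule integral_mono)
    show "p s (h n t - h m t) \<le> p s (h n t - g t) + p s (h m t - g t)" for t
      using p_diff_triangle[of s "h n t" "h m t" "g t"] p_commute[of s "h m t" "g t"] by simp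
  qed (use mean integrable_p_step_diff[OF step step S] in auto)
  then show ?thesis using mean by simp
qed

lemma integrable_p:
  assumes "frechet_integrable p S g" and S: "S \<in> lmeasurable"
  shows "integrable (lebesgue_on S) (\<lambda>t. p s (g t))"
proof -
  obtain h where h: "approximating_steps p S g h"
    using assms unfolding frechet_integrable_def by blast
  note step = approximating_steps_step[OF h]
  have "AE t in lebesgue_on S. (\<lambda>n. p s (h n t)) \<longlonglongrightarrow> p s (g t)"
    using approximating_steps_AE[OF h] by eventually_elim (rule tends_p)
  then have meas: "(\<lambda>t. p s (g t)) \<in> borel_measurable (lebesgue_on S)"
    by (rule borel_measurable_lebesgue_on_AE_limit[OF fmeasurableD[OF S]
          borel_measurable_integrable[OF step_function_integrable_p[OF step S]]])
  have "norm (p s (g t)) \<le> norm (p s (h 0 t) + p s (h 0 t - g t))" for t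
    using p_diff_triangle[of s "g t" 0 "h 0 t"] p_commute[of s "g t" "h 0 t"] by (simp add: p_nonneg)
  then show ?thesis
    by (intro Bochner_Integration.integrable_bound[OF Bochner_Integration.integrable_add[OF
        step_function_integrable_p[OF step[of 0] S] approximating_steps_mean(1)[OF h S, of s 0]] meas] AE_I2)
qed

lemma approximating_steps_add:
  assumes h: "approximating_steps p S g h" and h': "approximating_steps p S g' h'" and S: "S \<in> lmeasurable"
  shows "approximating_steps p S (\<lambda>t. g t + g' t) (\<lambda>n t. h n t + h' n t)"
proof (rule approximating_stepsI)
  note step = approximating_steps_step[OF h] approximating_steps_step[OF h']
  show "step_function S (\<lambda>t. h n t + h' n t)" for n
    by (rule step_function_comp2[OF step, where F = "(+)"])
  show "AE t in lebesgue_on S. tends (\<lambda>n. h n t + h' n t) (g t + g' t) sequentially"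
    using approximating_steps_AE[OF h] approximating_steps_AE[OF h']
    by eventually_elim (rule tends_add)
  let ?a = "\<lambda>s n. integral\<^sup>L (lebesgue_on S) (\<lambda>t. p s (h n t - g t))
        + integral\<^sup>L (lebesgue_on S) (\<lambda>t. p s (h' n t - g' t))"
  have "?a s \<longlonglongrightarrow> 0 + 0" for s
    by (intro tendsto_add approximating_steps_mean(2)[OF h S] approximating_steps_mean(2)[OF h' S])
  then show "?a s \<longlonglongrightarrow> 0" for s by simp
  show "integral\<^sup>L (lebesgue_on S) (\<lambda>t. p s (h n t + h' n t - (h m t + h' m t))) \<le> ?a s n + ?a s m" for s n m
  proof -
    note i = integrable_p_step_diff[OF step(1) step(1) S] integrable_p_step_diff[OF step(2) step(2) S]
    have "integral\<^sup>L (lebesgue_on S) (\<lambda>t. p s (h n t + h' n t - (h m t + h' m t)))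
      \<le> integral\<^sup>L (lebesgue_on S) (\<lambda>t. p s (h n t - h m t) + p s (h' n t - h' m t))"
    proof (rule integral_mono)
      show "p s (h n t + h' n t - (h m t + h' m t)) \<le> p s (h n t - h m t) + p s (h' n t - h' m t)" for t
        using p_triangle[of s "h n t - h m t" "h' n t - h' m t"] by (simp add: algebra_simps)
      show "integrable (lebesgue_on S) (\<lambda>t. p s (h n t + h' n t - (h m t + h' m t)))"
        by (intro integrable_p_step_diff step_function_comp2[OF step, where F = "(+)"] S)
    qed (use i in auto)
    also have "\<dots> = integral\<^sup>L (lebesgue_on S) (\<lambda>t. p s (h n t - h m t))
        + integral\<^sup>L (lebesgue_on S) (\<lambda>t. p s (h' n t - h' m t))"
      using i by simp
    also have "\<dots> \<le> ?a s n + ?a s m"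
      using integral_step_diff_le[OF h S, of s n m] integral_step_diff_le[OF h' S, of s n m] by simp
    finally show ?thesis .
  qed
qed

lemma approximating_steps_scale:
  assumes h: "approximating_steps p S g h" and S: "S \<in> lmeasurable"
  shows "approximating_steps p S (\<lambda>t. c *\<^sub>R g t) (\<lambda>n t. c *\<^sub>R h n t)"
proof (rule approximating_stepsI)
  show "step_function S (\<lambda>t. c *\<^sub>R h n t)" for n
    by (rule step_function_comp[OF approximating_steps_step[OF h]])
  show "AE t in lebesgue_on S. tends (\<lambda>n. c *\<^sub>R h n t) (c *\<^sub>R g t) sequentially"
    using approximating_steps_AE[OF h] by eventually_elim (rule tends_scale)
  let ?a = "\<lambda>s n. \<bar>c\<bar> * integral\<^sup>L (lebesgue_on S) (\<lambda>t. p s (h n t - g t))"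
  have "?a s \<longlonglongrightarrow> \<bar>c\<bar> * 0" for s
    by (intro tendsto_mult_left approximating_steps_mean(2)[OF h S])
  then show "?a s \<longlonglongrightarrow> 0" for s by simp
  show "integral\<^sup>L (lebesgue_on S) (\<lambda>t. p s (c *\<^sub>R h n t - c *\<^sub>R h m t)) \<le> ?a s n + ?a s m" for s n m
    using mult_left_mono[OF integral_step_diff_le[OF h S, of s n m], of "\<bar>c\<bar>"]
    by (simp add: p_scale distrib_left flip: scaleR_diff_right)
qed

lemma approximating_steps_const:
  assumes "S \<in> lmeasurable" shows "approximating_steps p S (\<lambda>t. c) (\<lambda>n t. c)"
proof (rule approximating_stepsI[where a = "\<lambda>s n. 0"])
  show "step_function S (\<lambda>t. c)" by (rule step_function_const[OF fmeasurableD[OF assms]])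
  show "AE t in lebesgue_on S. tends (\<lambda>n. c) c sequentially" by (rule AE_I2, rule tends_const)
qed (simp_all add: p_zero)

lemma approximating_steps_integral_converges:
  assumes h: "approximating_steps p S g h" and S: "S \<in> lmeasurable"
  obtains I where "tends (\<lambda>n. step_integral S (h n)) I sequentially"
proof -
  let ?a = "\<lambda>s n. integral\<^sup>L (lebesgue_on S) (\<lambda>t. p s (h n t - g t))"
  note step = approximating_steps_step[OF h]
  have le: "p s (step_integral S (h m) - step_integral S (h n)) \<le> ?a s m + ?a s n" for s m n
  proof -
    have "p s (step_integral S (\<lambda>t. h m t - h n t)) \<le> integral\<^sup>L (lebesgue_on S) (\<lambda>t. p s (h m t - h n t))"
      by (rule seminorm_step_integral_le[OF seminorm_p step_function_comp2[OF step step, where F = "(-)"] S])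
    then show ?thesis
      using integral_step_diff_le[OF h S, of s m n] step_integral_diff[OF step step S, of m n] by simp
  qed
  have "\<exists>N. \<forall>m\<ge>N. \<forall>n\<ge>N. p s (step_integral S (h m) - step_integral S (h n)) < \<epsilon>" if "0 < \<epsilon>" for s \<epsilon>
  proof -
    have "eventually (\<lambda>n. ?a s n < \<epsilon> / 2) sequentially"
      using that by (intro order_tendstoD(2)[OF approximating_steps_mean(2)[OF h S]]) simp
    then obtain N where N: "\<And>n. N \<le> n \<Longrightarrow> ?a s n < \<epsilon> / 2"
      unfolding eventually_sequentially by blast
    have "p s (step_integral S (h m) - step_integral S (h n)) < \<epsilon>" if "N \<le> m" "N \<le> n" for m n
      using le[of s m n] N[OF that(1)] N[OF that(2)] by linarith
    then show ?thesis by blast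
  qed
  then show thesis by (rule complete) (assumption, erule that)
qed

lemma integrable_has_integral:
  assumes "frechet_integrable p S g" "S \<in> lmeasurable"
  obtains I where "has_frechet_integral S g I"
proof -
  obtain h where h: "approximating_steps p S g h"
    using assms(1) unfolding frechet_integrable_def by blast
  with approximating_steps_integral_converges[OF h assms(2)] that show thesis
    unfolding has_frechet_integral_def by blast
qed

lemma has_integral_integrable: "has_frechet_integral S g I \<Longrightarrow> frechet_integrable p S g"
  unfolding frechet_integrable_def has_frechet_integral_def by blast

lemma has_integral_add:
  assumes "has_frechet_integral S g I" "has_frechet_integral S g' I'" and S: "S \<in> lmeasurable"
  shows "has_frechet_integral S (\<lambda>t. g t + g' t) (I + I')"
proof -
  obtain h h' where h: "approximating_steps p S g h" "tends (\<lambda>n. step_integral S (h n)) I sequentially"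
    and h': "approximating_steps p S g' h'" "tends (\<lambda>n. step_integral S (h' n)) I' sequentially"
    using assms unfolding has_frechet_integral_def by blast
  show ?thesis unfolding has_frechet_integral_def
    using approximating_steps_add[OF h(1) h'(1) S] tends_add[OF h(2) h'(2)]
      step_integral_add[OF approximating_steps_step[OF h(1)] approximating_steps_step[OF h'(1)] S]
    by auto
qed

lemma has_integral_scale:
  assumes "has_frechet_integral S g I" and S: "S \<in> lmeasurable"
  shows "has_frechet_integral S (\<lambda>t. c *\<^sub>R g t) (c *\<^sub>R I)"
proof -
  obtain h where h: "approximating_steps p S g h" "tends (\<lambda>n. step_integral S (h n)) I sequentially"
    using assms unfolding has_frechet_integral_def by blast
  show ?thesis unfolding has_frechet_integral_def
    using approximating_steps_scale[OF h(1) S, of c] tends_scale[OF h(2), of c]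
      step_integral_scale[OF approximating_steps_step[OF h(1)] S, of c]
    by auto
qed

lemma has_integral_diff:
  assumes "has_frechet_integral S g I" "has_frechet_integral S g' I'" and S: "S \<in> lmeasurable"
  shows "has_frechet_integral S (\<lambda>t. g t - g' t) (I - I')"
  using has_integral_add[OF assms(1) has_integral_scale[OF assms(2) S, of "-1"] S] by simp

lemma has_integral_const:
  assumes "S \<in> lmeasurable"
  shows "has_frechet_integral S (\<lambda>t. c) (measure lebesgue S *\<^sub>R c)"
  unfolding has_frechet_integral_def
  by (rule exI[of _ "\<lambda>n t. c"], rule conjI, rule approximating_steps_const[OF assms])
     (simp only: step_integral_const[OF assms] tends_const)

lemma approximating_steps_cong:
  assumes h: "approximating_steps p S g h" and S: "S \<in> sets lebesgue"
    and eq: "\<And>t. t \<in> S \<Longrightarrow> g t = g' t"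
  shows "approximating_steps p S g' h"
proof -
  have "AE t in lebesgue_on S. tends (\<lambda>n. h n t) (g' t) sequentially"
    using approximating_steps_AE[OF h] AE_space[of "lebesgue_on S"]
    by eventually_elim (simp add: eq)
  then show ?thesis
    using h unfolding approximating_steps_def limitin_iff_tends by blast
qed

lemma integrable_cong:
  assumes "frechet_integrable p S g" and "S \<in> sets lebesgue"
    and "\<And>t. t \<in> S \<Longrightarrow> g t = g' t"
  shows "frechet_integrable p S g'"
proof -
  obtain h where h: "approximating_steps p S g h"
    using assms(1) unfolding frechet_integrable_def by blast
  show ?thesis unfolding frechet_integrable_def
    using approximating_steps_cong[OF h assms(2,3)] by blast
qed

lemma p_integral_le:
  assumes I: "has_frechet_integral S g I" and S: "S \<in> lmeasurable"
  shows "p s I \<le> integral\<^sup>L (lebesgue_on S) (\<lambda>t. p s (g t))"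
proof -
  obtain h where h: "approximating_steps p S g h" and lim: "tends (\<lambda>n. step_integral S (h n)) I sequentially"
    using I unfolding has_frechet_integral_def by blast
  note step = approximating_steps_step[OF h]
  note int = integrable_p[OF has_integral_integrable[OF I] S, of s]
  let ?a = "\<lambda>n. integral\<^sup>L (lebesgue_on S) (\<lambda>t. p s (h n t - g t))"
  have "p s (step_integral S (h n)) \<le> ?a n + integral\<^sup>L (lebesgue_on S) (\<lambda>t. p s (g t))" for n
  proof -
    have "p s (step_integral S (h n)) \<le> integral\<^sup>L (lebesgue_on S) (\<lambda>t. p s (h n t))"
      by (rule seminorm_step_integral_le[OF seminorm_p step S])
    also have "\<dots> \<le> integral\<^sup>L (lebesgue_on S) (\<lambda>t. p s (h n t - g t) + p s (g t))"
    proof (rule integral_mono)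
      show "p s (h n t) \<le> p s (h n t - g t) + p s (g t)" for t
        using p_triangle[of s "h n t - g t" "g t"] by simp
    qed (use int step_function_integrable_p[OF step S] approximating_steps_mean(1)[OF h S] in auto)
    also have "\<dots> = ?a n + integral\<^sup>L (lebesgue_on S) (\<lambda>t. p s (g t))"
      using int approximating_steps_mean(1)[OF h S] by simp
    finally show ?thesis .
  qed
  moreover have "(\<lambda>n. ?a n + integral\<^sup>L (lebesgue_on S) (\<lambda>t. p s (g t)))
      \<longlonglongrightarrow> 0 + integral\<^sup>L (lebesgue_on S) (\<lambda>t. p s (g t))"
    by (intro tendsto_add tendsto_const approximating_steps_mean(2)[OF h S])
  ultimately have "p s I \<le> 0 + integral\<^sup>L (lebesgue_on S) (\<lambda>t. p s (g t))"
    by (intro LIMSEQ_le[OF tends_p[OF lim, of s]]) blast+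
  then show ?thesis by simp
qed

lemma has_integral_unique:
  assumes "has_frechet_integral S g I" "has_frechet_integral S g I'" and S: "S \<in> lmeasurable"
  shows "I = I'"
proof -
  have "p s (I - I') = 0" for s
    using p_integral_le[OF has_integral_diff[OF assms] S, of s] p_nonneg[of s "I - I'"]
    by (simp add: p_zero)
  then show ?thesis using separated[of "I - I'"] by simp
qed

lemma frechet_integral_eq:
  assumes "has_frechet_integral S g I" and S: "S \<in> lmeasurable"
  shows "frechet_integral p S g = I"
proof -
  have "frechet_integral p S g = (THE I. has_frechet_integral S g I)"
    unfolding frechet_integral_def has_frechet_integral_def limitin_iff_tends ..
  also have "\<dots> = I"
    by (rule the_equality, rule assms(1), rule has_integral_unique[OF _ assms])
  finally show ?thesis .
qed

lemma has_integral_frechet_integral: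
  assumes "frechet_integrable p S g" "S \<in> lmeasurable"
  shows "has_frechet_integral S g (frechet_integral p S g)"
proof -
  obtain I where I: "has_frechet_integral S g I"
    using integrable_has_integral[OF assms] by blast
  then show ?thesis unfolding frechet_integral_eq[OF I assms(2)] .
qed

text \<open>With \<open>\<phi> (g t) \<ge> 0\<close>, the value of \<open>\<phi>\<close> on an approximating step function is at least minus its
  bound on the error, whose integral tends to zero.\<close>

lemma integral_nonneg_functional:
  assumes I: "has_frechet_integral S g I" and S: "S \<in> lmeasurable"
    and \<phi>: "linear \<phi>" and bound: "\<And>x. \<bar>\<phi> x\<bar> \<le> K * (\<Sum>i\<le>N. p i x)"
    and pos: "\<And>t. t \<in> S \<Longrightarrow> 0 \<le> \<phi> (g t)"
  shows "0 \<le> \<phi> I"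
proof -
  obtain h where h: "approximating_steps p S g h" and lim: "tends (\<lambda>n. step_integral S (h n)) I sequentially"
    using I unfolding has_frechet_integral_def by blast
  note step = approximating_steps_step[OF h]
  note mean = approximating_steps_mean[OF h S]
  let ?b = "\<lambda>n. K * (\<Sum>i\<le>N. integral\<^sup>L (lebesgue_on S) (\<lambda>t. p i (h n t - g t)))"
  have lower: "- ?b n \<le> \<phi> (step_integral S (h n))" for n
  proof -
    have "- ?b n = integral\<^sup>L (lebesgue_on S) (\<lambda>t. - (K * (\<Sum>i\<le>N. p i (h n t - g t))))"
      using mean(1) by (simp add: Bochner_Integration.integral_sum)
    also have "\<dots> \<le> integral\<^sup>L (lebesgue_on S) (\<lambda>t. \<phi> (h n t))"
    proof (rule integral_mono)
      show "- (K * (\<Sum>i\<le>N. p i (h n t - g t))) \<le> \<phi> (h n t)" if "t \<in> space (lebesgue_on S)" for t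
        using bound[of "h n t - g t"] pos[of t] that by (simp add: linear_diff[OF \<phi>])
    qed (use mean(1) step_function_real_integral(1)[OF step S] in auto)
    finally show ?thesis by (simp add: linear_step_integral[OF \<phi> step S])
  qed
  have "(\<lambda>n. - ?b n) \<longlonglongrightarrow> - (K * (\<Sum>i\<le>N. 0))"
    by (intro tendsto_minus tendsto_mult_left tendsto_sum mean(2))
  moreover have "(\<lambda>n. \<phi> (step_integral S (h n))) \<longlonglongrightarrow> \<phi> I"
  proof -
    have "(\<lambda>n. K * (\<Sum>i\<le>N. p i (step_integral S (h n) - I))) \<longlonglongrightarrow> K * (\<Sum>i\<le>N. 0)"
      by (intro tendsto_mult_left tendsto_sum lim[unfolded tends_def, rule_format])
    then have to0: "(\<lambda>n. K * (\<Sum>i\<le>N. p i (step_integral S (h n) - I))) \<longlonglongrightarrow> 0" by simp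
    have "norm (\<phi> (step_integral S (h n)) - \<phi> I) \<le> K * (\<Sum>i\<le>N. p i (step_integral S (h n) - I))" for n
      using bound[of "step_integral S (h n) - I"] by (simp add: linear_diff[OF \<phi>])
    then have "(\<lambda>n. \<phi> (step_integral S (h n)) - \<phi> I) \<longlonglongrightarrow> 0"
      by (intro Lim_null_comparison[OF always_eventually to0] allI)
    then show ?thesis by (simp add: LIM_zero_iff)
  qed
  ultimately have "- (K * (\<Sum>i\<le>N. 0)) \<le> \<phi> I"
    by (rule LIMSEQ_le) (use lower in blast)
  then show ?thesis by simp
qed

text \<open>Integrals over subsets become integrals over the whole set, where integrals of different
  restrictions can be added and compared.\<close>

lemma has_integral_restrict:
  assumes g: "frechet_integrable p S g" and S: "S \<in> lmeasurable" and A: "A \<in> sets lebesgue" "A \<subseteq> S"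
  obtains I where "has_frechet_integral A g I" "has_frechet_integral S (\<lambda>t. if t \<in> A then g t else 0) I"
proof -
  obtain h where h: "approximating_steps p S g h" using g unfolding frechet_integrable_def by blast
  let ?a = "\<lambda>s n. integral\<^sup>L (lebesgue_on S) (\<lambda>t. p s (h n t - g t))"
  have Sm: "S \<in> sets lebesgue" and Am: "A \<in> lmeasurable"
    using S A fmeasurableI2 by auto
  note step = approximating_steps_step[OF h]
  have bound: "integral\<^sup>L (lebesgue_on S) (\<lambda>t. p s ((if t \<in> A then h n t else 0) - (if t \<in> A then h m t else 0)))
      \<le> ?a s n + ?a s m" for s n m
  proof -
    have "integral\<^sup>L (lebesgue_on S) (\<lambda>t. p s ((if t \<in> A then h n t else 0) - (if t \<in> A then h m t else 0)))
      \<le> integral\<^sup>L (lebesgue_on S) (\<lambda>t. p s (h n t - h m t))"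
      by (intro integral_mono integrable_p_step_diff step_function_if step S Sm A) (auto simp: p_zero p_nonneg)
    then show ?thesis using integral_step_diff_le[OF h S, of s n m] by linarith
  qed
  have 1: "approximating_steps p S (\<lambda>t. if t \<in> A then g t else 0) (\<lambda>n t. if t \<in> A then h n t else 0)"
  proof (rule approximating_stepsI[OF _ _ _ bound])
    show "AE t in lebesgue_on S. tends (\<lambda>n. if t \<in> A then h n t else 0) (if t \<in> A then g t else 0) sequentially"
      using approximating_steps_AE[OF h] by eventually_elim (auto intro: tends_const)
  qed (use A Sm step approximating_steps_mean(2)[OF h S] in \<open>auto intro: step_function_if\<close>)
  have 2: "approximating_steps p A g h"
  proof (rule approximating_stepsI[where a = ?a])
    show "AE t in lebesgue_on A. tends (\<lambda>n. h n t) (g t) sequentially"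
      using approximating_steps_AE[OF h] Sm A
      by (subst (asm) AE_restrict_space_iff, simp) (subst AE_restrict_space_iff, auto elim: eventually_mono)
    show "integral\<^sup>L (lebesgue_on A) (\<lambda>t. p s (h n t - h m t)) \<le> ?a s n + ?a s m" for s n m
    proof -
      have "integral\<^sup>L (lebesgue_on A) (\<lambda>t. p s (h n t - h m t))
        = integral\<^sup>L (lebesgue_on S) (\<lambda>t. p s ((if t \<in> A then h n t else 0) - (if t \<in> A then h m t else 0)))"
        using A Sm by (subst (1 2) integral_restrict_space)
          (auto intro!: Bochner_Integration.integral_cong simp: p_zero indicator_def)
      then show ?thesis using bound[of s n m] by simp
    qed
  qed (use A step approximating_steps_mean(2)[OF h S] in \<open>auto intro: step_function_subset\<close>)
  obtain I where I: "tends (\<lambda>n. step_integral A (h n)) I sequentially"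
    using approximating_steps_integral_converges[OF 2 Am] by blast
  have "has_frechet_integral A g I" unfolding has_frechet_integral_def using 2 I by blast
  moreover have "has_frechet_integral S (\<lambda>t. if t \<in> A then g t else 0) I"
    unfolding has_frechet_integral_def using 1 I step_integral_if[OF step S A] by auto
  ultimately show ?thesis using that by blast
qed

end

context frechet
begin

text \<open>Diagonal choice: a step function that is within \<open>(1/2) ^ n\<close> of \<open>g n\<close> in the mean of the first
  \<open>n\<close> seminorms has summable errors in each seminorm, so it also converges almost everywhere
  to \<open>g'\<close>.\<close>

lemma dominated_convergence:
  assumes g: "\<And>n. frechet_integrable p S (g n)" and S: "S \<in> lmeasurable"
    and lim: "AE t in lebesgue_on S. tends (\<lambda>n. g n t) (g' t) sequentially"
    and G: "\<And>s. integrable (lebesgue_on S) (G s)"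
    and bound: "\<And>s n t. t \<in> S \<Longrightarrow> p s (g n t) \<le> G s t"
  shows "frechet_integrable p S g'"
    and "tends (\<lambda>n. frechet_integral p S (g n)) (frechet_integral p S g') sequentially"
proof -
  have Sm: "S \<in> sets lebesgue" using S by auto
  have hasI: "has_frechet_integral S (g n) (frechet_integral p S (g n))" for n
    by (rule has_integral_frechet_integral[OF g S])
  have intg: "integrable (lebesgue_on S) (\<lambda>t. p s (g n t - g m t))" for s n m
    by (rule integrable_p[OF has_integral_integrable[OF has_integral_diff[OF hasI hasI S]] S])
  have p_lim: "AE t in lebesgue_on S. (\<lambda>m. p s (g n t - g m t)) \<longlonglongrightarrow> p s (g n t - g' t)" for s n
    using lim by eventually_elim (rule tends_p, rule tends_diff, rule tends_const)
  have meas: "(\<lambda>t. p s (g n t - g' t)) \<in> borel_measurable (lebesgue_on S)" for s n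
    by (rule borel_measurable_lebesgue_on_AE_limit[OF Sm borel_measurable_integrable[OF intg] p_lim])
  have dom: "AE t in lebesgue_on S. norm (p s (g n t - g' t)) \<le> 2 * G s t" for s n
    using p_lim[of s n] AE_space[of "lebesgue_on S"]
  proof eventually_elim
    case (elim t)
    then have t: "t \<in> S" by simp
    have "p s (g n t - g m t) \<le> 2 * G s t" for m
      using seminorm_diff_le[OF seminorm_p, of s "g n t" "g m t"] bound[OF t, of s n] bound[OF t, of s m]
      by linarith
    then have "p s (g n t - g' t) \<le> 2 * G s t"
      by (intro LIMSEQ_le_const2[OF elim(1)]) blast
    then show ?case by (simp add: p_nonneg)
  qed
  have int2G: "integrable (lebesgue_on S) (\<lambda>t. 2 * G s t)" for s using G by simp
  let ?b = "\<lambda>s n. integral\<^sup>L (lebesgue_on S) (\<lambda>t. p s (g n t - g' t))"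
  have to0: "AE t in lebesgue_on S. (\<lambda>n. p s (g n t - g' t)) \<longlonglongrightarrow> 0" for s
    using lim unfolding tends_def by eventually_elim blast
  have int_lim: "integrable (lebesgue_on S) (\<lambda>t. p s (g n t - g' t))" for s n
    by (rule integrable_dominated_convergence2[OF borel_measurable_const meas int2G to0 dom])
  have b: "?b s \<longlonglongrightarrow> 0" for s
    using integral_dominated_convergence[OF borel_measurable_const meas int2G to0 dom] by simp
  have "\<exists>h. step_function S h \<and> (\<forall>s\<le>n. integrable (lebesgue_on S) (\<lambda>t. p s (h t - g n t)) \<and>
      integral\<^sup>L (lebesgue_on S) (\<lambda>t. p s (h t - g n t)) \<le> (1/2) ^ n) \<and>
      (\<forall>s. integrable (lebesgue_on S) (\<lambda>t. p s (h t - g n t)))" for n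
  proof -
    obtain h where h: "approximating_steps p S (g n) h"
      using g[of n] unfolding frechet_integrable_def by blast
    note mean = approximating_steps_mean[OF h S]
    have "\<forall>s\<in>{..n}. eventually (\<lambda>k. integral\<^sup>L (lebesgue_on S) (\<lambda>t. p s (h k t - g n t)) < (1/2) ^ n) sequentially"
      by (intro ballI order_tendstoD(2)[OF mean(2)]) simp
    then have "eventually (\<lambda>k. \<forall>s\<in>{..n}. integral\<^sup>L (lebesgue_on S) (\<lambda>t. p s (h k t - g n t)) < (1/2) ^ n) sequentially"
      by (rule eventually_ball_finite[OF finite_atMost])
    then obtain k where "\<forall>s\<in>{..n}. integral\<^sup>L (lebesgue_on S) (\<lambda>t. p s (h k t - g n t)) < (1/2) ^ n"
      unfolding eventually_sequentially by blast
    then show ?thesis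
      using approximating_steps_step[OF h, of k] mean(1) by (intro exI[of _ "h k"]) (simp add: less_imp_le)
  qed
  then obtain h where step: "\<And>n. step_function S (h n)"
    and small: "\<And>n s. s \<le> n \<Longrightarrow> integral\<^sup>L (lebesgue_on S) (\<lambda>t. p s (h n t - g n t)) \<le> (1/2) ^ n"
    and int_h: "\<And>n s. integrable (lebesgue_on S) (\<lambda>t. p s (h n t - g n t))"
    by metis
  let ?c = "\<lambda>s n. integral\<^sup>L (lebesgue_on S) (\<lambda>t. p s (h n t - g n t))"
  have c_nonneg: "0 \<le> ?c s n" for s n
    by (rule integral_nonneg_AE) (simp add: p_nonneg)
  have c_sum: "summable (?c s)" for s
  proof (rule summable_comparison_test')
    show "summable (\<lambda>n. (1/2 :: real) ^ n)" by (rule summable_geometric) simp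
    show "norm (?c s n) \<le> (1/2) ^ n" if "s \<le> n" for n
      using small[OF that] c_nonneg[of s n] by simp
  qed
  have c: "?c s \<longlonglongrightarrow> 0" for s by (rule summable_LIMSEQ_zero[OF c_sum])
  have "AE t in lebesgue_on S. \<forall>s. (\<lambda>n. p s (h n t - g n t)) \<longlonglongrightarrow> 0"
    unfolding AE_all_countable
    by (intro allI AE_tendsto_zero_of_summable_integrals int_h p_nonneg c_sum)
  then have h_lim: "AE t in lebesgue_on S. tends (\<lambda>n. h n t) (g' t) sequentially"
    using lim
  proof eventually_elim
    case (elim t)
    have "tends (\<lambda>n. h n t - g n t) 0 sequentially"
      using elim(1) unfolding tends_def by simp
    from tends_add[OF this elim(2)] show ?case by simp
  qed
  have "approximating_steps p S g' h"
  proof (rule approximating_stepsI[OF step h_lim])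
    have "(\<lambda>n. ?c s n + ?b s n) \<longlonglongrightarrow> 0 + 0" for s
      by (rule tendsto_add[OF c b])
    then show "(\<lambda>n. ?c s n + ?b s n) \<longlonglongrightarrow> 0" for s by simp
    show "integral\<^sup>L (lebesgue_on S) (\<lambda>t. p s (h n t - h m t)) \<le> (?c s n + ?b s n) + (?c s m + ?b s m)" for s n m
    proof -
      have "integral\<^sup>L (lebesgue_on S) (\<lambda>t. p s (h n t - h m t))
        \<le> integral\<^sup>L (lebesgue_on S) (\<lambda>t. (p s (h n t - g n t) + p s (g n t - g' t))
            + (p s (h m t - g m t) + p s (g m t - g' t)))"
      proof (rule integral_mono)
        show "p s (h n t - h m t) \<le> (p s (h n t - g n t) + p s (g n t - g' t))
            + (p s (h m t - g m t) + p s (g m t - g' t))" for t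
          using p_diff_triangle[of s "h n t" "h m t" "g' t"] p_commute[of s "h m t" "g' t"]
            p_diff_triangle[of s "h n t" "g' t" "g n t"] p_diff_triangle[of s "h m t" "g' t" "g m t"]
          by linarith
        show "integrable (lebesgue_on S) (\<lambda>t. p s (h n t - h m t))"
          by (rule integrable_p_step_diff[OF step step S])
      qed (simp add: int_h int_lim)
      then show ?thesis by (simp add: int_h int_lim)
    qed
  qed
  then show int': "frechet_integrable p S g'" unfolding frechet_integrable_def by blast
  have hasI': "has_frechet_integral S g' (frechet_integral p S g')"
    by (rule has_integral_frechet_integral[OF int' S])
  have le: "p s (frechet_integral p S (g n) - frechet_integral p S g') \<le> ?b s n" for s n
    by (rule p_integral_le[OF has_integral_diff[OF hasI hasI' S] S])
  show "tends (\<lambda>n. frechet_integral p S (g n)) (frechet_integral p S g') sequentially"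
    unfolding tends_def
  proof
    fix s
    show "(\<lambda>n. p s (frechet_integral p S (g n) - frechet_integral p S g')) \<longlonglongrightarrow> 0"
      by (rule tendsto_sandwich[OF _ _ tendsto_const b[of s]])
        (simp_all add: p_nonneg le)
  qed
qed

end

section \<open>Baire category and open mappings\<close>

context frechet
begin

definition psum :: "nat \<Rightarrow> 'a \<Rightarrow> real" where
  "psum N x = (\<Sum>i\<le>N. p i x)"

lemma seminorm_psum: "seminorm (psum N)"
  using seminorm_of_sum[of "{..N}" p, OF seminorm_p] unfolding psum_def[abs_def] .

lemma psum_mono: "M \<le> N \<Longrightarrow> psum M x \<le> psum N x"
  unfolding psum_def by (rule sum_mono2) (auto simp: p_nonneg)

lemma p_le_psum: "i \<le> N \<Longrightarrow> p i x \<le> psum N x"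
  unfolding psum_def by (rule member_le_sum) (auto simp: p_nonneg)

lemma tends_psum: "tends \<sigma> l F \<Longrightarrow> ((\<lambda>n. psum N (\<sigma> n)) \<longlongrightarrow> psum N l) F"
  unfolding psum_def by (intro tendsto_sum tends_p)

text \<open>Baire's theorem for balls of the seminorms \<open>psum N\<close>. If every ball contained a smaller
  ball missing \<open>A n\<close>, nested closed balls with radii tending to \<open>0\<close> would have a common
  point outside all \<open>A n\<close>.\<close>

lemma Baire:
  assumes cover: "\<And>x. \<exists>n::nat. x \<in> A n"
  shows "\<exists>n x N r. 0 < r \<and>
    (\<forall>y M \<epsilon>. psum N (y - x) < r \<longrightarrow> 0 < \<epsilon> \<longrightarrow> (\<exists>z\<in>A n. psum M (y - z) < \<epsilon>))"
proof (rule ccontr)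
  assume neg: "\<not> ?thesis"
  have avoid: "\<exists>y M \<epsilon>. psum N (y - x) < r \<and> 0 < \<epsilon> \<and> (\<forall>z\<in>A n. \<epsilon> \<le> psum M (y - z))"
    if "0 < r" for n x N r
    using neg that by (simp add: not_le[symmetric]) blast
  define ok where "ok n b = (case b of (x, N, r) \<Rightarrow> 0 < r \<and> r \<le> 1 / (real n + 1) \<and> n \<le> N)"
    for n :: nat and b :: "'a \<times> nat \<times> real"
  define inside where "inside z b = (case b of (x, N, r) \<Rightarrow> psum N (z - x) \<le> r)"
    for z and b :: "'a \<times> nat \<times> real"
  have "\<exists>b. ok 0 b" unfolding ok_def by (rule exI[of _ "(0, 0, 1)"]) simp
  moreover have "\<exists>b'. ok (Suc n) b' \<and> (\<forall>z. inside z b' \<longrightarrow> inside z b \<and> z \<notin> A n)" if "ok n b" for n b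
  proof -
    obtain x N r where b: "b = (x, N, r)" by (cases b)
    with that have r: "0 < r" unfolding ok_def by simp
    obtain y M \<epsilon> where y: "psum N (y - x) < r" and \<epsilon>: "0 < \<epsilon>" and far: "\<forall>z\<in>A n. \<epsilon> \<le> psum M (y - z)"
      using avoid[OF r] by blast
    \<comment> \<open>The three bounds give containment in the old ball, disjointness from \<open>A n\<close>,
      and radii tending to \<open>0\<close>.\<close>
    define r' where "r' = min (min (r - psum N (y - x)) (\<epsilon> / 2)) (1 / (real (Suc n) + 1))"
    define N' where "N' = max (max N M) (Suc n)"
    have "ok (Suc n) (y, N', r')"
      using y \<epsilon> unfolding ok_def r'_def N'_def by simp
    moreover have "inside z b \<and> z \<notin> A n" if "inside z (y, N', r')" for z
    proof
      have z: "psum N' (z - y) \<le> r'" using that unfolding inside_def by simp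
      have "psum N (z - x) \<le> psum N (z - y) + psum N (y - x)"
        by (rule seminorm_diff_triangle[OF seminorm_psum])
      also have "psum N (z - y) \<le> psum N' (z - y)" by (rule psum_mono) (simp add: N'_def)
      also have "\<dots> \<le> r - psum N (y - x)" using z by (simp add: r'_def)
      finally show "inside z b" unfolding inside_def b by simp
      have "psum M (y - z) \<le> psum N' (z - y)"
        unfolding seminorm_diff_commute[OF seminorm_psum, of M y] by (rule psum_mono) (simp add: N'_def)
      also have "\<dots> \<le> \<epsilon> / 2" using z by (simp add: r'_def)
      finally show "z \<notin> A n" using far \<epsilon> by force
    qed
    ultimately show ?thesis by blast
  qed
  ultimately obtain b where ok: "\<And>n. ok n (b n)"
    and nested: "\<And>n z. inside z (b (Suc n)) \<Longrightarrow> inside z (b n) \<and> z \<notin> A n"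
    using dependent_nat_choice[of ok "\<lambda>n b b'. \<forall>z. inside z b' \<longrightarrow> inside z b \<and> z \<notin> A n"] by blast
  define c N r where "c n = fst (b n)" and "N n = fst (snd (b n))" and "r n = snd (snd (b n))" for n
  have inside_b: "inside z (b n) \<longleftrightarrow> psum (N n) (z - c n) \<le> r n" for z n
    unfolding inside_def c_def N_def r_def by (simp add: case_prod_beta)
  have r: "0 < r n" "r n \<le> 1 / (real n + 1)" "n \<le> N n" for n
    using ok[of n] unfolding ok_def c_def N_def r_def by (simp_all add: case_prod_beta)
  have down: "inside z (b m)" if "m \<le> n" "inside z (b n)" for m n z
    using that by (induction n rule: dec_induct) (use nested in blast)+
  have near: "psum (N n) (c k - c n) \<le> r n" if "n \<le> k" for n k
    using down[OF that, of "c k"] r(1)[of k] by (simp add: inside_b seminorm_zero[OF seminorm_psum])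
  have "\<exists>n. \<forall>k\<ge>n. \<forall>m\<ge>n. p s (c k - c m) < \<epsilon>" if "0 < \<epsilon>" for s \<epsilon>
  proof -
    obtain n0 where n0: "2 / \<epsilon> < real n0" using reals_Archimedean2 by blast
    define n where "n = max n0 s"
    have "2 / \<epsilon> < real n + 1" using n0 unfolding n_def by simp
    then have small: "2 / (real n + 1) < \<epsilon>" using that by (simp add: field_simps)
    have "p s (c k - c m) < \<epsilon>" if "n \<le> k" "n \<le> m" for k m
    proof -
      have "p s (c j - c n) \<le> 1 / (real n + 1)" if "n \<le> j" for j
        using p_le_psum[of s "N n" "c j - c n"] near[OF that] r(2)[of n] r(3)[of n]
        unfolding n_def by linarith
      from this[OF that(1)] this[OF that(2)] show ?thesis
        using p_diff_triangle[of s "c k" "c m" "c n"] p_commute[of s "c m" "c n"] small by simp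
    qed
    then show ?thesis by blast
  qed
  then obtain l where l: "tends c l sequentially" by (rule complete) 
  have "l \<notin> A n" for n
  proof -
    have "tends (\<lambda>k. c k - c (Suc n)) (l - c (Suc n)) sequentially"
      by (rule tends_diff[OF l tends_const])
    then have "(\<lambda>k. psum (N (Suc n)) (c k - c (Suc n))) \<longlonglongrightarrow> psum (N (Suc n)) (l - c (Suc n))"
      by (rule tends_psum)
    then have "psum (N (Suc n)) (l - c (Suc n)) \<le> r (Suc n)"
      by (rule LIMSEQ_le_const2) (use near in blast)
    then show ?thesis using nested[of l n] inside_b by simp
  qed
  then show False using cover by blast
qed

text \<open>The open mapping theorem for the identity map. By Baire's theorem the closure of
  every \<open>Q\<close>-ball contains a ball of the given topology. An element of the latter is then the sum of a \<open>Q\<close>-convergent series: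
  each term is chosen in a small \<open>Q\<close>-ball to approximate the remainder left by the previous terms.\<close>

lemma complete_finer_seminorms_dominated:
  assumes Q: "\<And>s. seminorm (Q s)" and finer: "\<And>s x. p s x \<le> Q s x"
    and complete_Q: "\<And>\<sigma>. (\<And>s \<epsilon>. 0 < \<epsilon> \<Longrightarrow> \<exists>N. \<forall>m\<ge>N. \<forall>n\<ge>N. Q s (\<sigma> m - \<sigma> n) < \<epsilon>)
      \<Longrightarrow> \<exists>l. \<forall>s. (\<lambda>n. Q s (\<sigma> n - l)) \<longlonglongrightarrow> 0"
  shows "\<exists>K N. 0 \<le> K \<and> (\<forall>x. Q s x \<le> K * psum N x)"
proof -
  define QS where "QS s x = (\<Sum>i\<le>s. Q i x)" for s x
  have QS: "seminorm (QS s)" for s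
    using seminorm_of_sum[of "{..s}" Q, OF Q] unfolding QS_def[abs_def] .
  have Q_le_QS: "i \<le> s \<Longrightarrow> Q i x \<le> QS s x" for i s x
    unfolding QS_def by (rule member_le_sum) (auto simp: seminorm_nonneg[OF Q])
  \<comment> \<open>Baire's theorem, scaled to balls of arbitrary radius \<open>c\<close> around \<open>0\<close>.\<close>
  have dense: "\<exists>N K. 0 \<le> K \<and> (\<forall>x c M \<epsilon>. 0 < c \<longrightarrow> psum N x < c \<longrightarrow> 0 < \<epsilon> \<longrightarrow>
      (\<exists>y. QS s y \<le> K * c \<and> psum M (x - y) < \<epsilon>))" for s
  proof -
    have "\<exists>n. x \<in> {y. QS s y \<le> real n}" for x using real_arch_simple by auto
    from Baire[of "\<lambda>n. {y. QS s y \<le> real n}", OF this]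
    obtain n x0 N r where r: "0 < r" and ball: "\<forall>y M \<epsilon>. psum N (y - x0) < r \<longrightarrow> 0 < \<epsilon> \<longrightarrow>
        (\<exists>z\<in>{y. QS s y \<le> real n}. psum M (y - z) < \<epsilon>)"
      by (elim exE conjE)
    have appr: "\<exists>z. QS s z \<le> real n \<and> psum M (y - z) < \<epsilon>"
      if "psum N (y - x0) < r" "0 < \<epsilon>" for y M \<epsilon>
      using ball that by blast
    have "\<exists>y. QS s y \<le> (2 * real n / r) * c \<and> psum M (x - y) < \<epsilon>"
      if c: "0 < c" and x: "psum N x < c" and \<epsilon>: "0 < \<epsilon>" for x c M \<epsilon>
    proof -
      define u where "u = (r / c) *\<^sub>R x"
      define \<delta> where "\<delta> = \<epsilon> * r / (2 * c)"
      have \<delta>: "0 < \<delta>" using c r \<epsilon> by (simp add: \<delta>_def)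
      have "psum N u < r"
        using c r x by (simp add: u_def seminorm_scale[OF seminorm_psum] field_simps)
      then obtain z1 where z1: "QS s z1 \<le> real n" "psum M (x0 + u - z1) < \<delta>"
        using appr[of "x0 + u" \<delta> M] \<delta> by auto
      obtain z2 where z2: "QS s z2 \<le> real n" "psum M (x0 - z2) < \<delta>"
        using appr[of x0 \<delta> M] \<delta> r by (auto simp: seminorm_zero[OF seminorm_psum])
      define y where "y = (c / r) *\<^sub>R (z1 - z2)"
      have "QS s (z1 - z2) \<le> 2 * real n"
        using seminorm_diff_le[OF QS, of s z1 z2] z1(1) z2(1) by simp
      then have "(c / r) * QS s (z1 - z2) \<le> (c / r) * (2 * real n)"
        using c r by (intro mult_left_mono) auto
      then have 1: "QS s y \<le> (2 * real n / r) * c"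
        using c r unfolding y_def seminorm_scale[OF QS] by (simp add: mult.commute)
      have x_eq: "x - y = (c / r) *\<^sub>R ((x0 + u - z1) - (x0 - z2))"
        using c r by (simp add: y_def u_def algebra_simps)
      have "psum M ((x0 + u - z1) - (x0 - z2)) < 2 * \<delta>"
        using seminorm_diff_le[OF seminorm_psum, of M "x0 + u - z1" "x0 - z2"] z1(2) z2(2) by simp
      then have "(c / r) * psum M ((x0 + u - z1) - (x0 - z2)) < (c / r) * (2 * \<delta>)"
        using c r by (intro mult_strict_left_mono) auto
      then have 2: "psum M (x - y) < \<epsilon>"
        using c r unfolding x_eq by (simp add: seminorm_scale[OF seminorm_psum] \<delta>_def)
      show ?thesis using 1 2 by blast
    qed
    moreover have "0 \<le> 2 * real n / r" using r by simp
    ultimately show ?thesis by blast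
  qed
  then obtain N K where K: "\<And>s. 0 \<le> K s"
    and appr: "\<And>s x c M \<epsilon>. 0 < c \<Longrightarrow> psum (N s) x < c \<Longrightarrow> 0 < \<epsilon> \<Longrightarrow>
      \<exists>y. QS s y \<le> K s * c \<and> psum M (x - y) < \<epsilon>"
    by metis
  have unit: "Q s x \<le> K s + 1" if x: "psum (N s) x < 1" for x
  proof -
    \<comment> \<open>The remainder at stage \<open>j\<close> is kept below \<open>c j\<close>, which forces the next term
      into the \<open>Q\<close>-ball of radius \<open>(1/2) ^ j\<close> if \<open>j > 0\<close>.\<close>
    define c where "c j = (if j = 0 then 1 else (1/2) ^ j / (K (s + j) + 1))" for j
    have c: "0 < c j" for j using K[of "s + j"] by (simp add: c_def)
    have Kc: "K (s + j) * c j \<le> (1/2) ^ j" if "0 < j" for j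
    proof -
      have "K (s + j) / (K (s + j) + 1) \<le> 1" using K[of "s + j"] by simp
      from mult_left_mono[OF this, of "(1/2) ^ j"] show ?thesis
        using that by (simp add: c_def mult.commute)
    qed
    have step: "\<exists>R'. psum (N (s + Suc j)) R' < c (Suc j) \<and>
        (QS (s + j) (R - R') \<le> K (s + j) * c j \<and> psum j R' < (1/2) ^ j)"
      if close: "psum (N (s + j)) R < c j" for j R
    proof -
      obtain y where y: "QS (s + j) y \<le> K (s + j) * c j"
        "psum (max (N (s + Suc j)) j) (R - y) < min (c (Suc j)) ((1/2) ^ j)"
        using appr[OF c close, of "min (c (Suc j)) ((1/2) ^ j)"] c by auto
      show ?thesis
        using y psum_mono[of "N (s + Suc j)" "max (N (s + Suc j)) j" "R - y"]
          psum_mono[of j "max (N (s + Suc j)) j" "R - y"]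
        by (intro exI[of _ "R - y"]) auto
    qed
    define good where "good j R \<longleftrightarrow> psum (N (s + j)) R < c j \<and> (j = 0 \<longrightarrow> R = x)" for j R
    have "\<exists>R. good 0 R" using x by (simp add: good_def c_def)
    moreover have "\<exists>R'. good (Suc j) R' \<and> (QS (s + j) (R - R') \<le> K (s + j) * c j \<and> psum j R' < (1/2) ^ j)"
      if "good j R" for j R
      using step[of j R] that unfolding good_def by auto
    ultimately obtain R where good: "\<And>j. good j (R j)"
      and inc: "\<And>j. QS (s + j) (R j - R (Suc j)) \<le> K (s + j) * c j"
      and small: "\<And>j. psum j (R (Suc j)) < (1/2) ^ j"
      using dependent_nat_choice[of good
        "\<lambda>j R R'. QS (s + j) (R - R') \<le> K (s + j) * c j \<and> psum j R' < (1/2) ^ j"] by blast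
    have R0: "R 0 = x" using good[of 0] unfolding good_def by simp
    define \<sigma> where "\<sigma> j = x - R j" for j
    have one: "Q i (\<sigma> (Suc j) - \<sigma> j) \<le> (1/2) ^ j" if "i \<le> s + j" "0 < j" for i j
      using Q_le_QS[OF that(1), of "R j - R (Suc j)"] inc[of j] Kc[OF that(2)] by (simp add: \<sigma>_def)
    have many: "Q i (\<sigma> (b + d) - \<sigma> b) \<le> 2 * (1/2) ^ b - 2 * (1/2) ^ (b + d)"
      if "i \<le> s + b" "0 < b" for i b d
    proof (induction d)
      case 0 then show ?case by (simp add: seminorm_zero[OF Q])
    next
      case (Suc d)
      have "Q i (\<sigma> (Suc (b + d)) - \<sigma> (b + d)) \<le> (1/2) ^ (b + d)"
        using that by (intro one) auto
      then show ?case
        using Suc seminorm_diff_triangle[OF Q, of i "\<sigma> (Suc (b + d))" "\<sigma> b" "\<sigma> (b + d)"] by simp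
    qed
    have tail: "Q i (\<sigma> a - \<sigma> b) \<le> 2 * (1/2) ^ b" if "i \<le> s + b" "0 < b" "b \<le> a" for i a b
    proof -
      have "Q i (\<sigma> a - \<sigma> b) \<le> 2 * (1/2) ^ b - 2 * (1/2) ^ a"
        using many[OF that(1,2), of "a - b"] that(3) by simp
      moreover have "(0 :: real) \<le> (1/2) ^ a" by simp
      ultimately show ?thesis by linarith
    qed
    have "\<exists>l. \<forall>i. (\<lambda>n. Q i (\<sigma> n - l)) \<longlonglongrightarrow> 0"
    proof (rule complete_Q)
      fix i and \<epsilon> :: real assume \<epsilon>: "0 < \<epsilon>"
      obtain b0 where b0: "(1/2) ^ b0 < \<epsilon> / 4" using real_arch_pow_inv[of "\<epsilon> / 4" "1/2"] \<epsilon> by auto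
      define b where "b = max (Suc i) b0"
      have "(1/2 :: real) ^ b \<le> (1/2) ^ b0" unfolding b_def by (intro power_decreasing) auto
      then have b: "2 * (1/2) ^ b < \<epsilon> / 2" using b0 by linarith
      have "Q i (\<sigma> m - \<sigma> n) < \<epsilon>" if "b \<le> m" "b \<le> n" for m n
      proof -
        have ib: "i \<le> s + b" "0 < b" unfolding b_def by auto
        have "Q i (\<sigma> m - \<sigma> n) \<le> Q i (\<sigma> m - \<sigma> b) + Q i (\<sigma> b - \<sigma> n)"
          by (rule seminorm_diff_triangle[OF Q])
        then show ?thesis
          using tail[OF ib that(1)] tail[OF ib that(2)] b seminorm_diff_commute[OF Q, of i "\<sigma> n" "\<sigma> b"]
          by linarith
      qed
      then show "\<exists>N. \<forall>m\<ge>N. \<forall>n\<ge>N. Q i (\<sigma> m - \<sigma> n) < \<epsilon>" by blast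
    qed
    then obtain l where l: "\<And>i. (\<lambda>n. Q i (\<sigma> n - l)) \<longlonglongrightarrow> 0" by blast
    have "tends \<sigma> l sequentially" unfolding tends_def
    proof
      fix i show "(\<lambda>n. p i (\<sigma> n - l)) \<longlonglongrightarrow> 0"
        by (rule tendsto_sandwich[OF _ _ tendsto_const l[of i]]) (simp_all add: p_nonneg finer)
    qed
    moreover have "tends \<sigma> x sequentially" unfolding tends_def
    proof
      fix i
      have pow0: "(\<lambda>n. 2 * (1/2 :: real) ^ n) \<longlonglongrightarrow> 0"
        by (intro tendsto_mult_right_zero LIMSEQ_power_zero) simp
      show "(\<lambda>n. p i (\<sigma> n - x)) \<longlonglongrightarrow> 0"
      proof (rule tendsto_sandwich[OF _ _ tendsto_const pow0])
        show "eventually (\<lambda>n. p i (\<sigma> n - x) \<le> 2 * (1/2) ^ n) sequentially"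
          unfolding eventually_sequentially
        proof (intro exI allI impI)
          fix n assume "Suc i \<le> n"
          then obtain j where j: "n = Suc j" "i \<le> j" by (cases n) auto
          have "p i (\<sigma> n - x) = p i (R n)" by (simp add: \<sigma>_def seminorm_minus[OF seminorm_p])
          also have "\<dots> \<le> psum j (R n)" using j by (intro p_le_psum) simp
          also have "\<dots> \<le> 2 * (1/2) ^ n" using small[of j] j by simp
          finally show "p i (\<sigma> n - x) \<le> 2 * (1/2) ^ n" .
        qed
      qed (simp add: p_nonneg)
    qed
    ultimately have "l = x" by (rule tends_unique) simp
    with l have lim: "(\<lambda>n. Q s (\<sigma> n - x)) \<longlonglongrightarrow> 0" by simp
    have first: "Q s (\<sigma> 1) \<le> K s"
      using Q_le_QS[of s "s + 0" "R 0 - R (Suc 0)"] inc[of 0] by (simp add: \<sigma>_def R0 c_def)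
    have "Q s x \<le> Q s (\<sigma> n - x) + (K s + 1)" if "1 \<le> n" for n
      using tail[of s 1 n] that first seminorm_diff_triangle[OF Q, of s x 0 "\<sigma> n"]
        seminorm_diff_triangle[OF Q, of s "\<sigma> n" 0 "\<sigma> 1"] seminorm_diff_commute[OF Q, of s x "\<sigma> n"] by simp
    moreover have "(\<lambda>n. Q s (\<sigma> n - x) + (K s + 1)) \<longlonglongrightarrow> 0 + (K s + 1)"
      by (rule tendsto_add[OF lim tendsto_const])
    ultimately have "Q s x \<le> 0 + (K s + 1)"
      by (intro LIMSEQ_le_const) blast+
    then show ?thesis by simp
  qed
  have "Q s x \<le> (K s + 1) * psum (N s) x" for x
  proof (rule field_le_epsilon)
    fix \<epsilon> :: real assume \<epsilon>: "0 < \<epsilon>"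
    define c where "c = psum (N s) x + \<epsilon> / (K s + 1)"
    have K1: "0 < K s + 1" using K[of s] by simp
    have c: "psum (N s) x < c" "0 < c"
      using \<epsilon> K1 seminorm_nonneg[OF seminorm_psum, of "N s" x] by (simp_all add: c_def add_nonneg_pos)
    have "psum (N s) ((1 / c) *\<^sub>R x) < 1"
      using c by (simp add: seminorm_scale[OF seminorm_psum])
    from unit[OF this] have "Q s x \<le> (K s + 1) * c"
      using c by (simp add: seminorm_scale[OF Q] field_simps)
    then show "Q s x \<le> (K s + 1) * psum (N s) x + \<epsilon>"
      using K1 by (simp add: c_def distrib_left)
  qed
  moreover have "0 \<le> K s + 1" using K[of s] by simp
  ultimately show ?thesis by blast
qed

end

section \<open>Unconditional bases\<close>

text \<open>Otherwise there would be disjoint consecutive blocks of indices, each containing a finite set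
  \<open>G\<close> on which the sum is at least \<open>\<epsilon>\<close>. Reordering every block so that it starts with its
  \<open>G\<close> gives a permutation of the series whose partial sums are not Cauchy.\<close>

lemma (in frechet) permutations_imp_unordered_Cauchy:
  fixes a :: "nat \<Rightarrow> 'a"
  assumes perm: "\<And>\<pi>::nat \<Rightarrow> nat. bij \<pi> \<Longrightarrow> tends (\<lambda>n. \<Sum>k<n. a (\<pi> k)) x sequentially" and \<epsilon>: "0 < \<epsilon>"
  shows "\<exists>n. \<forall>G. finite G \<longrightarrow> G \<subseteq> {n..} \<longrightarrow> p s (\<Sum>k\<in>G. a k) < \<epsilon>"
proof (rule ccontr)
  assume neg: "\<not> ?thesis"
  have "\<exists>n'. n < n' \<and> (\<exists>G. G \<subseteq> {n..<n'} \<and> \<epsilon> \<le> p s (\<Sum>k\<in>G. a k))" for n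
  proof -
    obtain G where G: "finite G" "G \<subseteq> {n..}" "\<epsilon> \<le> p s (\<Sum>k\<in>G. a k)"
      using neg by (auto simp: not_less)
    obtain b where "\<And>k. k \<in> G \<Longrightarrow> k \<le> b" using G(1) unfolding finite_nat_set_iff_bounded_le by blast
    then have "G \<subseteq> {n..<Suc (max n b)}" using G(2) by fastforce
    with G(3) show ?thesis by (intro exI[of _ "Suc (max n b)"]) auto
  qed
  then have "\<exists>f. \<forall>n. True \<and> f n < f (Suc n) \<and> (\<exists>G. G \<subseteq> {f n..<f (Suc n)} \<and> \<epsilon> \<le> p s (\<Sum>k\<in>G. a k)) \<and> f 0 = 0"
    using dependent_nat_choice[of "\<lambda>n m. n = 0 \<longrightarrow> m = 0"
      "\<lambda>n m m'. m < m' \<and> (\<exists>G. G \<subseteq> {m..<m'} \<and> \<epsilon> \<le> p s (\<Sum>k\<in>G. a k))"] by simp blast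
  then obtain N where N0: "N 0 = 0" and NS: "\<And>j. N j < N (Suc j)"
    and "\<And>j. \<exists>G. G \<subseteq> {N j..<N (Suc j)} \<and> \<epsilon> \<le> p s (\<Sum>k\<in>G. a k)" by blast
  then obtain G where G: "\<And>j. G j \<subseteq> {N j..<N (Suc j)}" and big: "\<And>j. \<epsilon> \<le> p s (\<Sum>k\<in>G j. a k)"
    by metis
  have strict: "strict_mono N" using NS by (simp add: strict_mono_Suc_iff)
  have finG: "finite (G j)" for j using G[of j] finite_subset by blast
  have cardG: "N j + card (G j) \<le> N (Suc j)" for j
    using card_mono[OF _ G[of j]] NS[of j] by simp
  have "\<exists>\<beta>. bij_betw \<beta> {N j..<N (Suc j)} {N j..<N (Suc j)} \<and> bij_betw \<beta> {N j..<N j + card (G j)} (G j)" for j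
  proof -
    let ?I = "{N j..<N j + card (G j)}" and ?B = "{N j..<N (Suc j)}"
    obtain f where f: "bij_betw f ?I (G j)"
      using finite_same_card_bij[of ?I "G j"] finG by auto
    have sub: "?I \<subseteq> ?B" using cardG[of j] by auto
    have "card (?B - ?I) = card (?B - G j)"
      using sub G[of j] finG[of j] by (simp add: card_Diff_subset)
    then obtain g where g: "bij_betw g (?B - ?I) (?B - G j)"
      using finite_same_card_bij[of "?B - ?I" "?B - G j"] by auto
    let ?h = "\<lambda>k. if k \<in> ?I then f k else g k"
    have hf: "bij_betw ?h ?I (G j)" using f by (rule bij_betw_cong[THEN iffD1, rotated]) auto
    have hg: "bij_betw ?h (?B - ?I) (?B - G j)" using g by (rule bij_betw_cong[THEN iffD1, rotated]) auto
    have "bij_betw ?h (?I \<union> (?B - ?I)) (G j \<union> (?B - G j))"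
      by (rule bij_betw_combine[OF hf hg]) auto
    moreover have "?I \<union> (?B - ?I) = ?B" "G j \<union> (?B - G j) = ?B" using sub G[of j] by auto
    ultimately show ?thesis using hf by (intro exI[of _ ?h]) simp
  qed
  then obtain \<beta> where \<beta>: "\<And>j. bij_betw (\<beta> j) {N j..<N (Suc j)} {N j..<N (Suc j)}"
    and \<beta>G: "\<And>j. bij_betw (\<beta> j) {N j..<N j + card (G j)} (G j)" by metis
  \<comment> \<open>The number of the block that contains \<open>k\<close>.\<close>
  define blk where "blk k = (LEAST j. k < N (Suc j))" for k
  have ex: "k < N (Suc k)" for k using strict_mono_imp_increasing[OF strict, of "Suc k"] by simp
  have blk_upper: "k < N (Suc (blk k))" for k
    unfolding blk_def by (rule LeastI[of "\<lambda>j. k < N (Suc j)", OF ex])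
  have blk_lower: "N (blk k) \<le> k" for k
  proof (cases "blk k")
    case (Suc j)
    then have "\<not> k < N (Suc j)" using not_less_Least[of j "\<lambda>j. k < N (Suc j)"] unfolding blk_def by simp
    then show ?thesis using Suc by simp
  qed (simp add: N0)
  have blk_eq: "blk k = j" if "k \<in> {N j..<N (Suc j)}" for j k
  proof (rule antisym)
    show "blk k \<le> j" unfolding blk_def by (rule Least_le) (use that in simp)
    have "N j < N (Suc (blk k))" using that blk_upper[of k] by simp
    then show "j \<le> blk k" using strict by (simp add: strict_mono_less)
  qed
  have in_blk: "k \<in> {N (blk k)..<N (Suc (blk k))}" for k using blk_lower blk_upper by simp
  define \<pi> where "\<pi> k = \<beta> (blk k) k" for k
  have \<pi>_eq: "\<pi> k = \<beta> j k" if "k \<in> {N j..<N (Suc j)}" for j k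
    unfolding \<pi>_def using blk_eq[OF that] by simp
  have "bij \<pi>"
  proof (rule bijI)
    show "inj \<pi>"
    proof (rule injI)
      fix k k' assume eq: "\<pi> k = \<pi> k'"
      have "\<pi> i \<in> {N (blk i)..<N (Suc (blk i))}" for i
        unfolding \<pi>_def using \<beta>[of "blk i"] in_blk[of i] by (rule bij_betw_apply)
      then have "blk (\<pi> i) = blk i" for i by (rule blk_eq)
      then have "blk k = blk k'" using eq by metis
      then show "k = k'"
        using eq \<beta>[of "blk k"] in_blk[of k] in_blk[of k'] unfolding \<pi>_def bij_betw_def inj_on_def by metis
    qed
    show "surj \<pi>"
      unfolding surj_def
    proof
      fix y
      have "y \<in> \<beta> (blk y) ` {N (blk y)..<N (Suc (blk y))}"
        using \<beta>[of "blk y"] in_blk[of y] unfolding bij_betw_def by simp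
      then obtain k where "y = \<beta> (blk y) k" "k \<in> {N (blk y)..<N (Suc (blk y))}" by blast
      with \<pi>_eq show "\<exists>k. y = \<pi> k" by metis
    qed
  qed
  from perm[OF this] have lim: "(\<lambda>n. p s ((\<Sum>k<n. a (\<pi> k)) - x)) \<longlonglongrightarrow> 0"
    unfolding tends_def by blast
  have "eventually (\<lambda>n. p s ((\<Sum>k<n. a (\<pi> k)) - x) < \<epsilon> / 2) sequentially"
    using \<epsilon> by (intro order_tendstoD(2)[OF lim]) simp
  then obtain n where n: "\<And>m. n \<le> m \<Longrightarrow> p s ((\<Sum>k<m. a (\<pi> k)) - x) < \<epsilon> / 2"
    unfolding eventually_sequentially by blast
  let ?u = "N n" and ?v = "N n + card (G n)"
  have "n \<le> ?u" by (rule strict_mono_imp_increasing[OF strict])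
  then have close: "p s ((\<Sum>k<?v. a (\<pi> k)) - x) < \<epsilon> / 2" "p s ((\<Sum>k<?u. a (\<pi> k)) - x) < \<epsilon> / 2"
    using n by simp_all
  have "(\<Sum>k<?v. a (\<pi> k)) - (\<Sum>k<?u. a (\<pi> k)) = (\<Sum>k\<in>{?u..<?v}. a (\<pi> k))"
    using sum_diff_nat_ivl[of 0 ?u ?v "\<lambda>k. a (\<pi> k)"] by (simp add: atLeast0LessThan)
  also have "\<dots> = (\<Sum>k\<in>{?u..<?v}. a (\<beta> n k))"
    using cardG[of n] by (intro sum.cong refl arg_cong[where f = a] \<pi>_eq) auto
  also have "\<dots> = (\<Sum>k\<in>G n. a k)" by (rule sum.reindex_bij_betw[OF \<beta>G])
  finally have "p s (\<Sum>k\<in>G n. a k) < \<epsilon>"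
    using close p_diff_triangle[of s "\<Sum>k<?v. a (\<pi> k)" "\<Sum>k<?u. a (\<pi> k)" x]
      p_commute[of s "\<Sum>k<?u. a (\<pi> k)" x] by simp
  with big[of n] show False by simp
qed

text \<open>A convex function on a cube is bounded by its values at the vertices.\<close>

lemma seminorm_cube_le:
  assumes q: "seminorm q" and "finite G" and "\<And>k. k \<in> G \<Longrightarrow> 0 \<le> \<theta> k \<and> \<theta> k \<le> 1"
    and "\<And>G'. G' \<subseteq> G \<Longrightarrow> q (b + (\<Sum>k\<in>G'. v k)) \<le> M"
  shows "q (b + (\<Sum>k\<in>G. \<theta> k *\<^sub>R v k)) \<le> M"
  using assms(2-)
proof (induction G arbitrary: b rule: finite_induct)
  case (insert k G)
  let ?S = "\<Sum>i\<in>G. \<theta> i *\<^sub>R v i"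
  have \<theta>: "0 \<le> \<theta> k" "\<theta> k \<le> 1" using insert.prems(1) by auto
  have 0: "q (b + ?S) \<le> M"
    by (rule insert.IH) (use insert.prems in auto)
  have 1: "q ((b + v k) + ?S) \<le> M"
  proof (rule insert.IH)
    fix G' assume G': "G' \<subseteq> G"
    then have "k \<notin> G'" "finite G'" using insert.hyps finite_subset by auto
    then show "q ((b + v k) + (\<Sum>i\<in>G'. v i)) \<le> M"
      using insert.prems(2)[of "insert k G'"] G' by (auto simp: add.assoc)
  qed (use insert.prems in auto)
  have "b + (\<Sum>i\<in>insert k G. \<theta> i *\<^sub>R v i) = (1 - \<theta> k) *\<^sub>R (b + ?S) + \<theta> k *\<^sub>R ((b + v k) + ?S)"
    using insert.hyps by (simp add: algebra_simps)
  then have "q (b + (\<Sum>i\<in>insert k G. \<theta> i *\<^sub>R v i)) \<le> (1 - \<theta> k) * q (b + ?S) + \<theta> k * q ((b + v k) + ?S)"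
    using seminorm_triangle[OF q, of "(1 - \<theta> k) *\<^sub>R (b + ?S)" "\<theta> k *\<^sub>R ((b + v k) + ?S)"] \<theta>
    by (simp add: seminorm_scale[OF q])
  also have "\<dots> \<le> (1 - \<theta> k) * M + \<theta> k * M"
    using \<theta> 0 1 by (intro add_mono mult_left_mono) auto
  finally show ?case by (simp add: algebra_simps)
qed auto

locale unconditional = frechet p for p :: "nat \<Rightarrow> 'a::real_vector \<Rightarrow> real" +
  fixes e :: "nat \<Rightarrow> 'a"
  assumes unconditional_basis: "unconditional_basis p e"
begin

abbreviation coord :: "'a \<Rightarrow> nat \<Rightarrow> real" where "coord \<equiv> basis_coord p e"
abbreviation le :: "'a \<Rightarrow> 'a \<Rightarrow> bool" (infix "\<lless>" 50) where "x \<lless> y \<equiv> basis_le p e x y"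

lemma basis_expansion_iff: "basis_expansion p e x c \<longleftrightarrow> tends (\<lambda>n. \<Sum>k<n. c k *\<^sub>R e k) x sequentially"
  unfolding basis_expansion_def limitin_iff_tends ..

lemma ex1_expansion: "\<exists>!c. tends (\<lambda>n. \<Sum>k<n. c k *\<^sub>R e k) x sequentially"
  using unconditional_basis unfolding unconditional_basis_def schauder_basis_def basis_expansion_iff by blast

lemma expansion: "tends (\<lambda>n. \<Sum>k<n. coord x k *\<^sub>R e k) x sequentially"
  unfolding basis_coord_def basis_expansion_iff by (rule theI'[OF ex1_expansion])

lemma coord_eqI: "tends (\<lambda>n. \<Sum>k<n. c k *\<^sub>R e k) x sequentially \<Longrightarrow> coord x = c"
  using ex1_expansion[of x] expansion[of x] by blast

lemma coord_add: "coord (x + y) k = coord x k + coord y k"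
proof -
  have "coord (x + y) = (\<lambda>k. coord x k + coord y k)"
    using tends_add[OF expansion[of x] expansion[of y]]
    by (intro coord_eqI) (simp add: sum.distrib scaleR_add_left)
  then show ?thesis by simp
qed

lemma coord_scale: "coord (c *\<^sub>R x) k = c * coord x k"
proof -
  have "coord (c *\<^sub>R x) = (\<lambda>k. c * coord x k)"
    using tends_scale[OF expansion[of x], of c] by (intro coord_eqI) (simp add: scaleR_sum_right)
  then show ?thesis by simp
qed

lemma coord_diff: "coord (x - y) k = coord x k - coord y k"
  using coord_add[of x "(-1) *\<^sub>R y" k] coord_scale[of "-1" y k] by simp

lemma linear_coord: "linear (\<lambda>x. coord x k)"
  by (rule linearI) (simp_all add: coord_add coord_scale)

lemma coord_finite_sum: "coord (\<Sum>k<n. c k *\<^sub>R e k) i = (if i < n then c i else 0)"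
proof -
  have "tends (\<lambda>m. \<Sum>k<m. (if k < n then c k else 0) *\<^sub>R e k) (\<Sum>k<n. c k *\<^sub>R e k) sequentially"
    unfolding tends_def
  proof
    fix s
    have "(\<Sum>k<m. (if k < n then c k else 0) *\<^sub>R e k) = (\<Sum>k<n. c k *\<^sub>R e k)" if "n \<le> m" for m
      using that by (intro sum.mono_neutral_cong_right) auto
    then have "eventually (\<lambda>m. p s ((\<Sum>k<m. (if k < n then c k else 0) *\<^sub>R e k) - (\<Sum>k<n. c k *\<^sub>R e k)) = 0) sequentially"
      unfolding eventually_sequentially by (intro exI[of _ n]) (simp add: p_zero)
    then show "(\<lambda>m. p s ((\<Sum>k<m. (if k < n then c k else 0) *\<^sub>R e k) - (\<Sum>k<n. c k *\<^sub>R e k))) \<longlonglongrightarrow> 0"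
      by (rule tendsto_eventually)
  qed
  from coord_eqI[OF this] show ?thesis by simp
qed

text \<open>Otherwise the coefficient of \<open>e k\<close> would not be determined.\<close>

lemma e_nonzero: "\<exists>s. 0 < p s (e k)"
proof -
  have "coord (\<Sum>i<Suc k. (if i = k then 1 else 0) *\<^sub>R e i) k = 1"
    by (subst coord_finite_sum) simp
  moreover have "(\<Sum>i<Suc k. (if i = k then 1 else 0) *\<^sub>R e i) = e k"
    by (simp add: if_distrib[of "\<lambda>c. c *\<^sub>R _"] cong: if_cong)
  ultimately have "coord (e k) k = 1" by simp
  moreover have "coord 0 k = 0" using coord_scale[of 0 0 k] by simp
  ultimately have "e k \<noteq> 0" by auto
  then obtain s where "p s (e k) \<noteq> 0" using separated by blast
  then show ?thesis using p_nonneg[of s "e k"] by (intro exI[of _ s]) simp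
qed

lemma unordered_Cauchy:
  assumes "0 < \<epsilon>"
  shows "\<exists>n. \<forall>G. finite G \<longrightarrow> G \<subseteq> {n..} \<longrightarrow> p s (\<Sum>k\<in>G. coord x k *\<^sub>R e k) < \<epsilon>"
proof (rule permutations_imp_unordered_Cauchy[OF _ assms])
  fix \<pi> :: "nat \<Rightarrow> nat" assume "bij \<pi>"
  then show "tends (\<lambda>n. \<Sum>k<n. coord x (\<pi> k) *\<^sub>R e (\<pi> k)) x sequentially"
    using unconditional_basis unfolding unconditional_basis_def limitin_iff_tends by blast
qed

text \<open>Unlike \<open>p s\<close>, this seminorm is monotone on elements with nonnegative coordinates.\<close>

definition q :: "nat \<Rightarrow> 'a \<Rightarrow> real" where
  "q s x = (SUP G\<in>{G. finite G}. p s (\<Sum>k\<in>G. coord x k *\<^sub>R e k))"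

lemma partial_sums_bounded: "bdd_above ((\<lambda>G. p s (\<Sum>k\<in>G. coord x k *\<^sub>R e k)) ` {G. finite G})"
proof -
  obtain n where n: "\<And>G. finite G \<Longrightarrow> G \<subseteq> {n..} \<Longrightarrow> p s (\<Sum>k\<in>G. coord x k *\<^sub>R e k) < 1"
    using unordered_Cauchy[of 1 s x] by auto
  show ?thesis
  proof (rule bdd_aboveI2)
    fix G :: "nat set" assume "G \<in> {G. finite G}"
    then have G: "finite G" by simp
    let ?f = "\<lambda>k. coord x k *\<^sub>R e k"
    have "sum ?f G = sum ?f (G \<inter> {..<n}) + sum ?f (G - {..<n})"
      using G by (metis Int_Diff_disjoint Int_Diff_Un finite_Diff finite_Int sum.union_disjoint)
    then have "p s (sum ?f G) \<le> p s (sum ?f (G \<inter> {..<n})) + p s (sum ?f (G - {..<n}))"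
      using p_triangle by simp
    also have "p s (sum ?f (G \<inter> {..<n})) \<le> (\<Sum>k\<in>G \<inter> {..<n}. p s (?f k))"
      by (rule seminorm_sum[OF seminorm_p])
    also have "\<dots> \<le> (\<Sum>k<n. p s (?f k))"
      by (rule sum_mono2) (auto simp: p_nonneg)
    also have "p s (sum ?f (G - {..<n})) \<le> 1"
      using n[of "G - {..<n}"] G by force
    finally show "p s (sum ?f G) \<le> (\<Sum>k<n. p s (?f k)) + 1" by simp
  qed
qed

lemma p_sum_le_q: "finite G \<Longrightarrow> p s (\<Sum>k\<in>G. coord x k *\<^sub>R e k) \<le> q s x"
  unfolding q_def by (rule cSUP_upper[OF _ partial_sums_bounded]) simp

lemma q_leI: "(\<And>G. finite G \<Longrightarrow> p s (\<Sum>k\<in>G. coord x k *\<^sub>R e k) \<le> M) \<Longrightarrow> q s x \<le> M"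
  unfolding q_def by (rule cSUP_least) auto

lemma q_scale_le: "q s (c *\<^sub>R x) \<le> \<bar>c\<bar> * q s x"
proof (rule q_leI)
  fix G :: "nat set" assume G: "finite G"
  have "(\<Sum>k\<in>G. coord (c *\<^sub>R x) k *\<^sub>R e k) = c *\<^sub>R (\<Sum>k\<in>G. coord x k *\<^sub>R e k)"
    by (simp add: coord_scale scaleR_sum_right)
  then show "p s (\<Sum>k\<in>G. coord (c *\<^sub>R x) k *\<^sub>R e k) \<le> \<bar>c\<bar> * q s x"
    using p_sum_le_q[OF G, of s x] by (simp add: p_scale mult_left_mono)
qed

lemma seminorm_q: "seminorm (q s)"
  unfolding seminorm_def
proof (intro conjI allI)
  fix x y
  show "q s (x + y) \<le> q s x + q s y"
  proof (rule q_leI)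
    fix G :: "nat set" assume G: "finite G"
    have "p s (\<Sum>k\<in>G. coord (x + y) k *\<^sub>R e k)
        \<le> p s (\<Sum>k\<in>G. coord x k *\<^sub>R e k) + p s (\<Sum>k\<in>G. coord y k *\<^sub>R e k)"
      using p_triangle by (simp add: coord_add scaleR_add_left sum.distrib)
    then show "p s (\<Sum>k\<in>G. coord (x + y) k *\<^sub>R e k) \<le> q s x + q s y"
      using p_sum_le_q[OF G, of s x] p_sum_le_q[OF G, of s y] by linarith
  qed
next
  fix c x
  show "q s (c *\<^sub>R x) = \<bar>c\<bar> * q s x"
  proof (cases "c = 0")
    case True
    have "q s (0 :: 'a) = 0"
      using q_scale_le[of s 0 0] p_sum_le_q[of "{}" s 0] by (simp add: p_zero)
    then show ?thesis using True by simp
  next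
    case False
    have "\<bar>c\<bar> * q s x \<le> \<bar>c\<bar> * (\<bar>1 / c\<bar> * q s (c *\<^sub>R x))"
      using q_scale_le[of s "1 / c" "c *\<^sub>R x"] False by (intro mult_left_mono) auto
    then have "\<bar>c\<bar> * q s x \<le> q s (c *\<^sub>R x)" using False by simp
    with q_scale_le[of s c x] show ?thesis by simp
  qed
qed

lemma p_le_q: "p s x \<le> q s x"
  by (rule LIMSEQ_le_const2[OF tends_p[OF expansion]]) (use p_sum_le_q in blast)

lemma coord_mult_le_q: "\<bar>coord x k\<bar> * p s (e k) \<le> q s x"
  using p_sum_le_q[of "{k}" s x] by (simp add: p_scale)

text \<open>The coordinates of a Cauchy sequence converge, and the estimates of finite partial sums survive the
  limit because they are uniform in the index set. The limiting coordinates are those of the limit in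
  the coarser topology, by uniqueness of expansions.\<close>

lemma q_complete:
  assumes Cauchy: "\<And>s \<epsilon>. 0 < \<epsilon> \<Longrightarrow> \<exists>N. \<forall>m\<ge>N. \<forall>n\<ge>N. q s (\<sigma> m - \<sigma> n) < \<epsilon>"
  shows "\<exists>l. \<forall>s. (\<lambda>n. q s (\<sigma> n - l)) \<longlonglongrightarrow> 0"
proof -
  have "\<exists>N. \<forall>m\<ge>N. \<forall>n\<ge>N. p s (\<sigma> m - \<sigma> n) < \<epsilon>" if "0 < \<epsilon>" for s \<epsilon>
    using Cauchy[OF that, of s] p_le_q order_le_less_trans by blast
  then obtain l where l: "tends \<sigma> l sequentially" by (rule complete)
  have "convergent (\<lambda>n. coord (\<sigma> n) k)" for k
  proof -
    obtain s where s: "0 < p s (e k)" using e_nonzero by blast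
    have "Cauchy (\<lambda>n. coord (\<sigma> n) k)"
    proof (rule metric_CauchyI)
      fix \<epsilon> :: real assume "0 < \<epsilon>"
      then have "0 < \<epsilon> * p s (e k)" using s by simp
      from Cauchy[OF this, of s] obtain N where N: "\<And>m n. N \<le> m \<Longrightarrow> N \<le> n \<Longrightarrow> q s (\<sigma> m - \<sigma> n) < \<epsilon> * p s (e k)"
        by blast
      have "dist (coord (\<sigma> m) k) (coord (\<sigma> n) k) < \<epsilon>" if "N \<le> m" "N \<le> n" for m n
        using N[OF that] coord_mult_le_q[of "\<sigma> m - \<sigma> n" k s] s
        by (simp add: dist_real_def coord_diff) (meson mult_less_cancel_right_pos order_le_less_trans)
      then show "\<exists>N. \<forall>m\<ge>N. \<forall>n\<ge>N. dist (coord (\<sigma> m) k) (coord (\<sigma> n) k) < \<epsilon>" by blast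
    qed
    then show ?thesis by (rule Cauchy_convergent)
  qed
  then obtain c where c: "\<And>k. (\<lambda>n. coord (\<sigma> n) k) \<longlonglongrightarrow> c k"
    unfolding convergent_def by metis
  have unif: "\<exists>N. \<forall>n\<ge>N. \<forall>G. finite G \<longrightarrow> p s (\<Sum>k\<in>G. (coord (\<sigma> n) k - c k) *\<^sub>R e k) \<le> \<epsilon>"
    if "0 < \<epsilon>" for s \<epsilon>
  proof -
    obtain N where N: "\<And>m n. N \<le> m \<Longrightarrow> N \<le> n \<Longrightarrow> q s (\<sigma> m - \<sigma> n) < \<epsilon>"
      using Cauchy[OF \<open>0 < \<epsilon>\<close>, of s] by blast
    have "p s (\<Sum>k\<in>G. (coord (\<sigma> n) k - c k) *\<^sub>R e k) \<le> \<epsilon>" if n: "N \<le> n" and G: "finite G" for n G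
    proof -
      have "tends (\<lambda>m. (\<Sum>k\<in>G. (coord (\<sigma> n) k - coord (\<sigma> m) k) *\<^sub>R e k))
          (\<Sum>k\<in>G. (coord (\<sigma> n) k - c k) *\<^sub>R e k) sequentially"
        unfolding tends_def
      proof
        fix s
        have "(\<lambda>m. \<Sum>k\<in>G. \<bar>coord (\<sigma> m) k - c k\<bar> * p s (e k)) \<longlonglongrightarrow> (\<Sum>k\<in>G. \<bar>c k - c k\<bar> * p s (e k))"
          by (intro tendsto_sum tendsto_mult_right tendsto_rabs tendsto_diff c tendsto_const)
        then have lim: "(\<lambda>m. \<Sum>k\<in>G. \<bar>coord (\<sigma> m) k - c k\<bar> * p s (e k)) \<longlonglongrightarrow> 0" by simp
        have "p s ((\<Sum>k\<in>G. (coord (\<sigma> n) k - coord (\<sigma> m) k) *\<^sub>R e k) - (\<Sum>k\<in>G. (coord (\<sigma> n) k - c k) *\<^sub>R e k))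
            \<le> (\<Sum>k\<in>G. \<bar>coord (\<sigma> m) k - c k\<bar> * p s (e k))" for m
        proof -
          have "(\<Sum>k\<in>G. (coord (\<sigma> n) k - coord (\<sigma> m) k) *\<^sub>R e k) - (\<Sum>k\<in>G. (coord (\<sigma> n) k - c k) *\<^sub>R e k)
            = (\<Sum>k\<in>G. (c k - coord (\<sigma> m) k) *\<^sub>R e k)"
            by (simp add: sum_subtractf[symmetric] scaleR_left_diff_distrib[symmetric])
          also have "p s \<dots> \<le> (\<Sum>k\<in>G. p s ((c k - coord (\<sigma> m) k) *\<^sub>R e k))"
            by (rule seminorm_sum[OF seminorm_p])
          finally show ?thesis by (simp add: p_scale abs_minus_commute)
        qed
        then show "(\<lambda>m. p s ((\<Sum>k\<in>G. (coord (\<sigma> n) k - coord (\<sigma> m) k) *\<^sub>R e k)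
            - (\<Sum>k\<in>G. (coord (\<sigma> n) k - c k) *\<^sub>R e k))) \<longlonglongrightarrow> 0"
          by (intro tendsto_sandwich[OF _ _ tendsto_const lim] always_eventually allI) (simp_all add: p_nonneg)
      qed
      note lim = tends_p[OF this, of s]
      have "p s (\<Sum>k\<in>G. (coord (\<sigma> n) k - coord (\<sigma> m) k) *\<^sub>R e k) \<le> \<epsilon>" if "N \<le> m" for m
        using p_sum_le_q[OF G, of s "\<sigma> n - \<sigma> m"] N[OF n that] by (simp add: coord_diff)
      then show ?thesis by (intro LIMSEQ_le_const2[OF lim]) blast
    qed
    then show ?thesis by blast
  qed
  have "tends (\<lambda>j. \<Sum>k<j. c k *\<^sub>R e k) l sequentially"
    unfolding tends_def
  proof (intro allI LIMSEQ_I)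
    fix s and \<epsilon> :: real assume \<epsilon>: "0 < \<epsilon>"
    obtain N where N: "\<And>n G. N \<le> n \<Longrightarrow> finite G \<Longrightarrow> p s (\<Sum>k\<in>G. (coord (\<sigma> n) k - c k) *\<^sub>R e k) \<le> \<epsilon> / 4"
      using unif[of "\<epsilon> / 4" s] \<epsilon> by auto
    have "eventually (\<lambda>n. p s (\<sigma> n - l) < \<epsilon> / 4) sequentially"
      using l \<epsilon> unfolding tends_def by (intro order_tendstoD(2)[of _ 0]) auto
    then obtain N' where "\<And>n. N' \<le> n \<Longrightarrow> p s (\<sigma> n - l) < \<epsilon> / 4"
      unfolding eventually_sequentially by blast
    then obtain n where n: "N \<le> n" "p s (\<sigma> n - l) < \<epsilon> / 4" using max.cobounded1 max.cobounded2 by metis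
    have "eventually (\<lambda>j. p s ((\<Sum>k<j. coord (\<sigma> n) k *\<^sub>R e k) - \<sigma> n) < \<epsilon> / 4) sequentially"
      using expansion[of "\<sigma> n"] \<epsilon> unfolding tends_def by (intro order_tendstoD(2)[of _ 0]) auto
    then obtain J where J: "\<And>j. J \<le> j \<Longrightarrow> p s ((\<Sum>k<j. coord (\<sigma> n) k *\<^sub>R e k) - \<sigma> n) < \<epsilon> / 4"
      unfolding eventually_sequentially by blast
    have "norm (p s ((\<Sum>k<j. c k *\<^sub>R e k) - l) - 0) < \<epsilon>" if "J \<le> j" for j
    proof -
      let ?c = "\<Sum>k<j. c k *\<^sub>R e k" and ?n = "\<Sum>k<j. coord (\<sigma> n) k *\<^sub>R e k"
      have "p s (?n - ?c) \<le> \<epsilon> / 4"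
        using N[OF n(1), of "{..<j}"] by (simp add: scaleR_left_diff_distrib sum_subtractf)
      moreover have "p s (?c - l) \<le> p s (?c - ?n) + (p s (?n - \<sigma> n) + p s (\<sigma> n - l))"
        using p_diff_triangle[of s ?c l ?n] p_diff_triangle[of s ?n l "\<sigma> n"] by linarith
      ultimately have "p s (?c - l) < \<epsilon>"
        using J[OF that] n(2) p_commute[of s ?c ?n] \<epsilon> by linarith
      then show ?thesis by (simp add: p_nonneg)
    qed
    then show "\<exists>J. \<forall>j\<ge>J. norm (p s ((\<Sum>k<j. c k *\<^sub>R e k) - l) - 0) < \<epsilon>" by blast
  qed
  then have coord_l: "coord l = c" by (rule coord_eqI)
  have "(\<lambda>n. q s (\<sigma> n - l)) \<longlonglongrightarrow> 0" for s
  proof (rule LIMSEQ_I)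
    fix \<epsilon> :: real assume \<epsilon>: "0 < \<epsilon>"
    obtain N where N: "\<And>n G. N \<le> n \<Longrightarrow> finite G \<Longrightarrow> p s (\<Sum>k\<in>G. (coord (\<sigma> n) k - c k) *\<^sub>R e k) \<le> \<epsilon> / 2"
      using unif[of "\<epsilon> / 2" s] \<epsilon> by auto
    have "norm (q s (\<sigma> n - l) - 0) < \<epsilon>" if "N \<le> n" for n
    proof -
      have "q s (\<sigma> n - l) \<le> \<epsilon> / 2"
        by (rule q_leI) (simp only: coord_diff coord_l N[OF that])
      then show ?thesis using \<epsilon> seminorm_nonneg[OF seminorm_q, of s "\<sigma> n - l"] by simp
    qed
    then show "\<exists>N. \<forall>n\<ge>N. norm (q s (\<sigma> n - l) - 0) < \<epsilon>" by blast
  qed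
  then show ?thesis by blast
qed

lemma q_dominated: "\<exists>K N. 0 \<le> K \<and> (\<forall>x. q s x \<le> K * psum N x)"
  by (rule complete_finer_seminorms_dominated[OF seminorm_q p_le_q q_complete])

lemma coord_dominated: "\<exists>K N. \<forall>x. \<bar>coord x k\<bar> \<le> K * psum N x"
proof -
  obtain s where s: "0 < p s (e k)" using e_nonzero by blast
  obtain K N where K: "\<And>x. q s x \<le> K * psum N x" using q_dominated by blast
  have "\<bar>coord x k\<bar> \<le> (K / p s (e k)) * psum N x" for x
    using order_trans[OF coord_mult_le_q[of x k s] K[of x]] s by (simp add: field_simps)
  then show ?thesis by blast
qed

lemma tends_psum_diff: "tends \<sigma> l F \<Longrightarrow> ((\<lambda>n. psum N (\<sigma> n - l)) \<longlongrightarrow> 0) F"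
  using tends_psum[OF tends_diff[OF _ tends_const[of l]], of \<sigma> l F N] by (simp add: seminorm_zero[OF seminorm_psum])

lemma tends_q: assumes "tends \<sigma> l F" shows "((\<lambda>n. q s (\<sigma> n - l)) \<longlongrightarrow> 0) F"
proof -
  obtain K N where K: "\<And>x. q s x \<le> K * psum N x" using q_dominated by blast
  have "((\<lambda>n. K * psum N (\<sigma> n - l)) \<longlongrightarrow> K * 0) F"
    by (intro tendsto_mult_left tends_psum_diff assms)
  then have lim: "((\<lambda>n. K * psum N (\<sigma> n - l)) \<longlongrightarrow> 0) F" by simp
  show ?thesis
    by (rule tendsto_sandwich[OF _ _ tendsto_const lim]) (simp_all add: K seminorm_nonneg[OF seminorm_q])
qed

lemma tends_coord: assumes "tends \<sigma> l F" shows "((\<lambda>n. coord (\<sigma> n) k) \<longlongrightarrow> coord l k) F"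
proof -
  obtain K N where K: "\<And>x. \<bar>coord x k\<bar> \<le> K * psum N x" using coord_dominated by blast
  have "((\<lambda>n. K * psum N (\<sigma> n - l)) \<longlongrightarrow> K * 0) F"
    by (intro tendsto_mult_left tends_psum_diff assms)
  then have lim: "((\<lambda>n. K * psum N (\<sigma> n - l)) \<longlongrightarrow> 0) F" by simp
  have "norm (coord (\<sigma> n) k - coord l k) \<le> K * psum N (\<sigma> n - l)" for n
    using K[of "\<sigma> n - l"] by (simp add: coord_diff)
  then have "((\<lambda>n. coord (\<sigma> n) k - coord l k) \<longlongrightarrow> 0) F"
    by (intro Lim_null_comparison[OF always_eventually lim] allI)
  then show ?thesis by (simp add: LIM_zero_iff)
qed

section \<open>Order intervals\<close>

text \<open>Dividing \<open>a k\<close> by \<open>b k\<close> gives weights in the unit interval.\<close>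

lemma weighted_sum_le:
  assumes G: "finite G" and a: "\<And>k. k \<in> G \<Longrightarrow> 0 \<le> a k \<and> a k \<le> b k"
    and M: "\<And>G'. G' \<subseteq> G \<Longrightarrow> p s (\<Sum>k\<in>G'. b k *\<^sub>R e k) \<le> M"
  shows "p s (\<Sum>k\<in>G. a k *\<^sub>R e k) \<le> M"
proof -
  have "p s (0 + (\<Sum>k\<in>G. (a k / b k) *\<^sub>R b k *\<^sub>R e k)) \<le> M"
  proof (rule seminorm_cube_le[OF seminorm_p G])
    fix k assume "k \<in> G"
    then have ab: "0 \<le> a k" "a k \<le> b k" using a by blast+
    show "0 \<le> a k / b k \<and> a k / b k \<le> 1"
    proof
      show "0 \<le> a k / b k" using ab by (intro divide_nonneg_nonneg) linarith+
      show "a k / b k \<le> 1" using ab by (intro divide_le_eq_1[THEN iffD2]) linarith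
    qed
  qed (simp add: M)
  moreover have "(\<Sum>k\<in>G. (a k / b k) *\<^sub>R b k *\<^sub>R e k) = (\<Sum>k\<in>G. a k *\<^sub>R e k)"
  proof (rule sum.cong[OF refl])
    fix k assume "k \<in> G"
    then have "0 \<le> a k" "a k \<le> b k" using a by blast+
    then have "(a k / b k) * b k = a k" by (cases "b k = 0") simp_all
    then show "(a k / b k) *\<^sub>R b k *\<^sub>R e k = a k *\<^sub>R e k" by (simp only: scaleR_scaleR)
  qed
  ultimately show ?thesis by simp
qed

lemma q_mono:
  assumes "\<And>k. 0 \<le> coord u k" "\<And>k. coord u k \<le> coord v k" shows "q s u \<le> q s v"
proof (rule q_leI)
  fix G :: "nat set" assume G: "finite G"
  show "p s (\<Sum>k\<in>G. coord u k *\<^sub>R e k) \<le> q s v"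
  proof (rule weighted_sum_le[OF G])
    fix G' assume "G' \<subseteq> G"
    then show "p s (\<Sum>k\<in>G'. coord v k *\<^sub>R e k) \<le> q s v"
      using G by (intro p_sum_le_q) (rule finite_subset)
  qed (use assms in auto)
qed

lemma p_le_of_interval:
  assumes "lo \<lless> u" "u \<lless> hi"
  shows "p s u \<le> p s lo + q s (hi - lo)"
proof -
  have "q s (u - lo) \<le> q s (hi - lo)"
    using assms by (intro q_mono) (auto simp: basis_le_def coord_diff)
  then show ?thesis
    using p_le_q[of s "u - lo"] p_triangle[of s lo "u - lo"] by simp
qed

text \<open>The coefficients \<open>a k - coord lo k\<close> are dominated by those of \<open>hi - lo\<close>, whose expansion is Cauchy
  over all finite index sets.\<close>

lemma order_interval_element:
  assumes "\<And>k. coord lo k \<le> a k" "\<And>k. a k \<le> coord hi k"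
  obtains u where "coord u = a"
proof -
  let ?w = "hi - lo" and ?a = "\<lambda>k. a k - coord lo k"
  have a: "0 \<le> ?a k" "?a k \<le> coord ?w k" for k using assms[of k] by (simp_all add: coord_diff)
  have "\<exists>N. \<forall>m\<ge>N. \<forall>n\<ge>N. p s ((\<Sum>k<m. ?a k *\<^sub>R e k) - (\<Sum>k<n. ?a k *\<^sub>R e k)) < \<epsilon>"
    if \<epsilon>: "0 < \<epsilon>" for s \<epsilon>
  proof -
    obtain N where N: "\<And>G. finite G \<Longrightarrow> G \<subseteq> {N..} \<Longrightarrow> p s (\<Sum>k\<in>G. coord ?w k *\<^sub>R e k) < \<epsilon> / 2"
      using unordered_Cauchy[of "\<epsilon> / 2" s ?w] \<epsilon> by auto
    have up: "p s ((\<Sum>k<n. ?a k *\<^sub>R e k) - (\<Sum>k<m. ?a k *\<^sub>R e k)) < \<epsilon>" if "N \<le> m" "m \<le> n" for m n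
    proof -
      have "(\<Sum>k<n. ?a k *\<^sub>R e k) - (\<Sum>k<m. ?a k *\<^sub>R e k) = (\<Sum>k\<in>{m..<n}. ?a k *\<^sub>R e k)"
        using sum_diff_nat_ivl[of 0 m n "\<lambda>k. ?a k *\<^sub>R e k"] that by (simp add: atLeast0LessThan)
      also have "p s \<dots> \<le> \<epsilon> / 2"
      proof (rule weighted_sum_le)
        fix G' assume "G' \<subseteq> {m..<n}"
        then have "finite G'" "G' \<subseteq> {N..}" using that finite_subset by fastforce+
        then show "p s (\<Sum>k\<in>G'. coord ?w k *\<^sub>R e k) \<le> \<epsilon> / 2" using N by (simp add: less_imp_le)
      qed (use a in auto)
      finally show ?thesis using \<epsilon> by simp
    qed
    have "p s ((\<Sum>k<m. ?a k *\<^sub>R e k) - (\<Sum>k<n. ?a k *\<^sub>R e k)) < \<epsilon>" if "N \<le> m" "N \<le> n" for m n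
      using up[of m n] up[of n m] that p_commute[of s "\<Sum>k<m. ?a k *\<^sub>R e k" "\<Sum>k<n. ?a k *\<^sub>R e k"]
      by (cases "m \<le> n") auto
    then show ?thesis by blast
  qed
  then obtain l where "tends (\<lambda>n. \<Sum>k<n. ?a k *\<^sub>R e k) l sequentially" by (rule complete)
  then have l: "coord l = ?a" by (rule coord_eqI)
  have "coord (lo + l) = a" by (rule ext) (simp add: coord_add l)
  then show ?thesis by (rule that)
qed

text \<open>The head of the expansion converges coordinatewise, and the tails of all members
  are controlled by the tail of \<open>hi - lo\<close> alone.\<close>

lemma order_interval_tends:
  assumes lo: "\<And>n. lo \<lless> \<sigma> n" and hi: "\<And>n. \<sigma> n \<lless> hi"
    and lim: "\<And>k. (\<lambda>n. coord (\<sigma> n) k) \<longlonglongrightarrow> coord u k"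
  shows "tends \<sigma> u sequentially"
proof -
  define w where "w = hi - lo"
  define tail where "tail K y = y - (\<Sum>k<K. coord y k *\<^sub>R e k)" for K y
  have coord_tail: "coord (tail K y) k = (if k < K then 0 else coord y k)" for K y k
    unfolding tail_def by (simp add: coord_diff coord_finite_sum)
  have \<sigma>: "coord lo k \<le> coord (\<sigma> n) k" "coord (\<sigma> n) k \<le> coord hi k" for n k
    using lo[of n] hi[of n] unfolding basis_le_def by blast+
  have u: "coord lo k \<le> coord u k" "coord u k \<le> coord hi k" for k
    using LIMSEQ_le_const[OF lim] LIMSEQ_le_const2[OF lim] \<sigma> by blast+
  have tail_\<sigma>: "q s (tail K (\<sigma> n - lo)) \<le> q s (tail K w)" for s K n
    using \<sigma> by (intro q_mono) (auto simp: coord_tail coord_diff w_def)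
  have tail_u: "q s (tail K (u - lo)) \<le> q s (tail K w)" for s K
    using u by (intro q_mono) (auto simp: coord_tail coord_diff w_def)
  have split: "p s (\<sigma> n - u) \<le> (\<Sum>k<K. \<bar>coord (\<sigma> n) k - coord u k\<bar> * p s (e k)) + 2 * q s (tail K w)" for s n K
  proof -
    have "\<sigma> n - u = (\<Sum>k<K. (coord (\<sigma> n) k - coord u k) *\<^sub>R e k) + (tail K (\<sigma> n - lo) - tail K (u - lo))"
      unfolding tail_def by (simp add: coord_diff scaleR_left_diff_distrib sum_subtractf algebra_simps)
    then have "p s (\<sigma> n - u) \<le> p s (\<Sum>k<K. (coord (\<sigma> n) k - coord u k) *\<^sub>R e k)
        + p s (tail K (\<sigma> n - lo) - tail K (u - lo))"
      using p_triangle by metis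
    moreover have "p s (\<Sum>k<K. (coord (\<sigma> n) k - coord u k) *\<^sub>R e k)
        \<le> (\<Sum>k<K. \<bar>coord (\<sigma> n) k - coord u k\<bar> * p s (e k))"
      using seminorm_sum[OF seminorm_p[of s], of "\<lambda>k. (coord (\<sigma> n) k - coord u k) *\<^sub>R e k" "{..<K}"]
      by (simp add: p_scale)
    moreover have "p s (tail K (\<sigma> n - lo) - tail K (u - lo)) \<le> q s (tail K w) + q s (tail K w)"
      using seminorm_diff_le[OF seminorm_p, of s "tail K (\<sigma> n - lo)" "tail K (u - lo)"]
        p_le_q[of s "tail K (\<sigma> n - lo)"] p_le_q[of s "tail K (u - lo)"] tail_\<sigma>[of s K n] tail_u[of s K]
      by linarith
    ultimately show ?thesis by linarith
  qed
  show ?thesis unfolding tends_def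
  proof (intro allI LIMSEQ_I)
    fix s and \<epsilon> :: real assume \<epsilon>: "0 < \<epsilon>"
    have "(\<lambda>K. q s ((\<Sum>k<K. coord w k *\<^sub>R e k) - w)) \<longlonglongrightarrow> 0"
      by (rule tends_q[OF expansion])
    then have "(\<lambda>K. q s (tail K w)) \<longlonglongrightarrow> 0"
      by (simp only: tail_def seminorm_diff_commute[OF seminorm_q, of s w])
    from order_tendstoD(2)[OF this, of "\<epsilon> / 4"] obtain K where K: "q s (tail K w) < \<epsilon> / 4"
      using \<epsilon> unfolding eventually_sequentially by auto
    have "(\<lambda>n. \<Sum>k<K. \<bar>coord (\<sigma> n) k - coord u k\<bar> * p s (e k)) \<longlonglongrightarrow> (\<Sum>k<K. \<bar>coord u k - coord u k\<bar> * p s (e k))"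
      by (intro tendsto_sum tendsto_mult_right tendsto_rabs tendsto_diff lim tendsto_const)
    then have head: "(\<lambda>n. \<Sum>k<K. \<bar>coord (\<sigma> n) k - coord u k\<bar> * p s (e k)) \<longlonglongrightarrow> 0" by simp
    from order_tendstoD(2)[OF head, of "\<epsilon> / 2"] obtain N
      where N: "\<And>n. N \<le> n \<Longrightarrow> (\<Sum>k<K. \<bar>coord (\<sigma> n) k - coord u k\<bar> * p s (e k)) < \<epsilon> / 2"
      using \<epsilon> unfolding eventually_sequentially by auto
    have "norm (p s (\<sigma> n - u) - 0) < \<epsilon>" if "N \<le> n" for n
      using split[of s n K] N[OF that] K p_nonneg[of s "\<sigma> n - u"] by simp
    then show "\<exists>N. \<forall>n\<ge>N. norm (p s (\<sigma> n - u) - 0) < \<epsilon>" by blast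
  qed
qed

end

section \<open>Indefinite integrals\<close>

text \<open>Averages over intervals to the left of a point are averages to the right for the reflected
  function.\<close>

lemma two_sided_averages_AE:
  fixes r :: "real \<Rightarrow> real"
  assumes r: "integrable (lebesgue_on {a..b}) r"
  shows "AE t in lebesgue_on {a..b}. \<forall>\<epsilon>>0. \<exists>\<delta>>0. \<forall>u\<in>{a..b}. u \<noteq> t \<longrightarrow> \<bar>u - t\<bar> < \<delta> \<longrightarrow>
    integral {min t u..max t u} r < (r t + \<epsilon>) * \<bar>u - t\<bar>"
proof -
  let ?S = "{a..b}"
  define r0 where "r0 t = (if t \<in> ?S then r t else 0)" for t
  have "r integrable_on ?S" by (rule integrable_on_lebesgue_on[OF r]) simp
  then have "r0 integrable_on UNIV"
    unfolding r0_def by (simp only: Henstock_Kurzweil_Integration.integrable_restrict_UNIV)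
  then have r0: "r0 integrable_on cbox c d" for c d
    by (rule integrable_on_subcbox) simp
  have r0': "(\<lambda>t. r0 (- t)) integrable_on cbox c d" for c d
    using r0[of "- d" "- c"]
      Henstock_Kurzweil_Integration.integrable_reflect_real[where f = r0 and a = "- d" and b = "- c"] by simp
  obtain N where N: "negligible N" and right: "\<And>x \<epsilon>. x \<notin> N \<Longrightarrow> 0 < \<epsilon> \<Longrightarrow>
      \<exists>d>0. \<forall>h. 0 < h \<and> h < d \<longrightarrow> norm (integral (cbox x (x + h *\<^sub>R One)) r0 /\<^sub>R h ^ DIM(real) - r0 x) < \<epsilon>"
    using integrable_ccontinuous_explicit[of r0, OF r0] by metis
  obtain N' where N': "negligible N'" and left: "\<And>x \<epsilon>. x \<notin> N' \<Longrightarrow> 0 < \<epsilon> \<Longrightarrow>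
      \<exists>d>0. \<forall>h. 0 < h \<and> h < d \<longrightarrow>
        norm (integral (cbox x (x + h *\<^sub>R One)) (\<lambda>t. r0 (- t)) /\<^sub>R h ^ DIM(real) - r0 (- x)) < \<epsilon>"
    using integrable_ccontinuous_explicit[of "\<lambda>t. r0 (- t)", OF r0'] by metis
  have neg: "negligible (N \<union> uminus ` N')"
    by (intro negligible_Un N negligible_differentiable_image_negligible[OF order_refl N']
        derivative_intros)
  have "AE t in lebesgue. t \<notin> N \<union> uminus ` N'"
    using neg by (intro AE_not_in) (simp add: negligible_iff_null_sets)
  then have "AE t in lebesgue_on ?S. t \<notin> N \<union> uminus ` N'"
    by (subst AE_restrict_space_iff) (auto elim: eventually_mono)
  then show ?thesis using AE_space[of "lebesgue_on ?S"]
  proof eventually_elim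
    case (elim t)
    then have t: "t \<in> ?S" "t \<notin> N" "- t \<notin> N'" by force+
    show ?case
    proof (intro allI impI)
      fix \<epsilon> :: real assume "0 < \<epsilon>"
      obtain d1 where d1: "0 < d1" and R: "\<And>h. 0 < h \<Longrightarrow> h < d1 \<Longrightarrow> \<bar>integral {t..t + h} r0 / h - r0 t\<bar> < \<epsilon>"
        using right[OF t(2) \<open>0 < \<epsilon>\<close>] by (auto simp: divide_inverse mult.commute)
      obtain d2 where d2: "0 < d2" and L: "\<And>h. 0 < h \<Longrightarrow> h < d2 \<Longrightarrow>
          \<bar>integral {- t..- t + h} (\<lambda>t. r0 (- t)) / h - r0 t\<bar> < \<epsilon>"
        using left[OF t(3) \<open>0 < \<epsilon>\<close>] by (auto simp: divide_inverse mult.commute)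
      have "integral {min t u..max t u} r < (r t + \<epsilon>) * \<bar>u - t\<bar>"
        if u: "u \<in> ?S" "u \<noteq> t" "\<bar>u - t\<bar> < min d1 d2" for u
      proof -
        define h where "h = \<bar>u - t\<bar>"
        have h: "0 < h" "h < d1" "h < d2" using u by (auto simp: h_def)
        have "integral {min t u..max t u} r = integral {min t u..max t u} r0"
          by (rule Henstock_Kurzweil_Integration.integral_cong) (use u t in \<open>auto simp: r0_def\<close>)
        moreover have "\<bar>integral {min t u..max t u} r0 / h - r0 t\<bar> < \<epsilon>"
        proof (cases "t < u")
          case True
          then show ?thesis using R[OF h(1,2)] by (simp add: h_def)
        next
          case False
          then have eq: "min t u = - (- t + h)" "max t u = - (- t)" by (simp_all add: h_def)
          show ?thesis
            using L[OF h(1,3)] Henstock_Kurzweil_Integration.integral_reflect_real[where f = "\<lambda>t. r0 (- t)" and a = "- t" and b = "- t + h"]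
            unfolding eq by simp
        qed
        moreover have "r0 t = r t" using t by (simp add: r0_def)
        ultimately have "integral {min t u..max t u} r / h < r t + \<epsilon>" by simp
        then show ?thesis using h by (simp add: h_def[symmetric] divide_less_eq)
      qed
      then show "\<exists>\<delta>>0. \<forall>u\<in>?S. u \<noteq> t \<longrightarrow> \<bar>u - t\<bar> < \<delta> \<longrightarrow>
          integral {min t u..max t u} r < (r t + \<epsilon>) * \<bar>u - t\<bar>"
        using d1 d2 by (intro exI[of _ "min d1 d2"]) simp
    qed
  qed
qed

context frechet
begin

lemma integrable_subset:
  assumes "frechet_integrable p S g" "S \<in> lmeasurable" "A \<in> sets lebesgue" "A \<subseteq> S"
  shows "frechet_integrable p A g"
  using has_integral_restrict[OF assms] has_integral_integrable by blast

lemma integrable_const: "S \<in> lmeasurable \<Longrightarrow> frechet_integrable p S (\<lambda>t. c)"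
  by (rule has_integral_integrable[OF has_integral_const])

lemma integrable_diff:
  assumes "frechet_integrable p S g" "frechet_integrable p S g'" "S \<in> lmeasurable"
  shows "frechet_integrable p S (\<lambda>t. g t - g' t)"
  using has_integral_diff[OF has_integral_frechet_integral[OF assms(1,3)]
      has_integral_frechet_integral[OF assms(2,3)] assms(3)] by (rule has_integral_integrable)

lemma integrable_sum:
  assumes "\<And>i. i \<in> F \<Longrightarrow> frechet_integrable p S (g i)" "S \<in> lmeasurable"
  shows "frechet_integrable p S (\<lambda>t. \<Sum>i\<in>F. g i t)"
  using assms(1)
proof (induction F rule: infinite_finite_induct)
  case (insert i F)
  have "has_frechet_integral S (\<lambda>t. g i t + (\<Sum>i\<in>F. g i t))
      (frechet_integral p S (g i) + frechet_integral p S (\<lambda>t. \<Sum>i\<in>F. g i t))"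
    using insert by (intro has_integral_add has_integral_frechet_integral assms(2)) auto
  from has_integral_integrable[OF this] show ?case using insert.hyps by simp
qed (simp_all add: integrable_const[OF assms(2)])

lemma integrable_p_diff_on:
  assumes "frechet_integrable p {0..T} g" "0 \<le> a" "b \<le> T"
  shows "integrable (lebesgue_on {a..b}) (\<lambda>t. p s (g t - v))"
  by (rule integrable_p[OF integrable_diff[OF integrable_subset[OF assms(1)] integrable_const]])
    (use assms in auto)

text \<open>The case \<open>v = 0\<close> gives continuity of the indefinite integral, values \<open>v\<close> close to \<open>g a\<close> or \<open>g b\<close>
  give its derivative.\<close>

lemma indefinite_integral_bound:
  assumes g: "frechet_integrable p {0..T} g" and ab: "0 \<le> a" "a \<le> b" "b \<le> T"
  shows "p s (frechet_integral p {0..b} g - frechet_integral p {0..a} g - (b - a) *\<^sub>R v)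
    \<le> integral {a..b} (\<lambda>t. p s (g t - v))"
proof -
  let ?S = "{0..T}" and ?A = "{a<..b}"
  have S: "?S \<in> lmeasurable" and Sm: "?S \<in> sets lebesgue" and A: "?A \<in> sets lebesgue" "?A \<subseteq> ?S"
    using ab by auto
  have Am: "?A \<in> lmeasurable"
    by (rule bounded_set_imp_lmeasurable) auto
  have initial: "has_frechet_integral ?S (\<lambda>t. if t \<in> {0..c} then g t else 0) (frechet_integral p {0..c} g)"
    if c: "c \<le> T" for c
  proof -
    obtain I where I: "has_frechet_integral {0..c} g I" "has_frechet_integral ?S (\<lambda>t. if t \<in> {0..c} then g t else 0) I"
      by (rule has_integral_restrict[OF g S, of "{0..c}"]) (use c in auto)
    have "frechet_integral p {0..c} g = I" by (rule frechet_integral_eq[OF I(1)]) simp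
    then show ?thesis using I(2) by simp
  qed
  have a: "a \<le> T" using ab by simp
  have 1: "has_frechet_integral ?S (\<lambda>t. (if t \<in> {0..b} then g t else 0) - (if t \<in> {0..a} then g t else 0))
      (frechet_integral p {0..b} g - frechet_integral p {0..a} g)"
    by (rule has_integral_diff[OF initial[OF ab(3)] initial[OF a] S])
  obtain I where I: "has_frechet_integral ?A (\<lambda>t. v) I" "has_frechet_integral ?S (\<lambda>t. if t \<in> ?A then v else 0) I"
    by (rule has_integral_restrict[OF integrable_const[OF S] S A])
  have "I = (b - a) *\<^sub>R v"
    using has_integral_unique[OF I(1) has_integral_const[OF Am] Am] ab by simp
  with has_integral_diff[OF 1 I(2) S]
  have 2: "has_frechet_integral ?S (\<lambda>t. (if t \<in> {0..b} then g t else 0) - (if t \<in> {0..a} then g t else 0)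
        - (if t \<in> ?A then v else 0))
      (frechet_integral p {0..b} g - frechet_integral p {0..a} g - (b - a) *\<^sub>R v)" by simp
  have intA: "integrable (lebesgue_on ?A) (\<lambda>t. p s (g t - v))"
    by (rule integrable_p[OF integrable_diff[OF integrable_subset[OF g S A] integrable_const[OF Am] Am] Am])
  have "p s (frechet_integral p {0..b} g - frechet_integral p {0..a} g - (b - a) *\<^sub>R v)
    \<le> integral\<^sup>L (lebesgue_on ?S) (\<lambda>t. p s ((if t \<in> {0..b} then g t else 0)
        - (if t \<in> {0..a} then g t else 0) - (if t \<in> ?A then v else 0)))"
    by (rule p_integral_le[OF 2 S])
  also have "\<dots> = integral\<^sup>L (lebesgue_on ?S) (\<lambda>t. if t \<in> ?A then p s (g t - v) else 0)"
    by (rule Bochner_Integration.integral_cong[OF refl]) (use ab in \<open>auto simp: p_zero\<close>)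
  also have "\<dots> = integral\<^sup>L (lebesgue_on ?A) (\<lambda>t. p s (g t - v))"
    by (rule Lebesgue_Measure.integral_restrict[OF A(2,1) Sm])
  also have "\<dots> = integral ?A (\<lambda>t. p s (g t - v))"
    by (rule lebesgue_integral_eq_integral[OF intA A(1)])
  also have "\<dots> = integral {a..b} (\<lambda>t. p s (g t - v))"
  proof (rule integral_spike_set)
    show "negligible {t \<in> {a<..b} - {a..b}. p s (g t - v) \<noteq> 0}"
      by (rule negligible_subset[OF negligible_empty]) auto
    show "negligible {t \<in> {a..b} - {a<..b}. p s (g t - v) \<noteq> 0}"
      by (rule negligible_subset[OF negligible_sing[of a]]) auto
  qed
  finally show ?thesis .
qed

lemma indefinite_integral_continuous:
  assumes g: "frechet_integrable p {0..T} g" and t: "t \<in> {0..T}"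
  shows "tends (\<lambda>u. frechet_integral p {0..u} g) (frechet_integral p {0..t} g) (at t within {0..T})"
  unfolding tends_def
proof
  fix s
  define H where "H u = integral {0..u} (\<lambda>t. p s (g t - 0))" for u
  have int: "(\<lambda>t. p s (g t - 0)) integrable_on {0..T}"
    by (rule integrable_on_lebesgue_on[OF integrable_p_diff_on[OF g]]) auto
  have "continuous_on {0..T} H"
    unfolding H_def by (rule indefinite_integral_continuous_1[OF int])
  then have "(H \<longlongrightarrow> H t) (at t within {0..T})"
    using t unfolding continuous_on_def by blast
  then have "((\<lambda>u. \<bar>H u - H t\<bar>) \<longlongrightarrow> \<bar>H t - H t\<bar>) (at t within {0..T})"
    by (intro tendsto_rabs tendsto_diff tendsto_const)
  then have lim: "((\<lambda>u. \<bar>H u - H t\<bar>) \<longlongrightarrow> 0) (at t within {0..T})" by simp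
  have le: "p s (frechet_integral p {0..b} g - frechet_integral p {0..a} g) \<le> H b - H a"
    if "0 \<le> a" "a \<le> b" "b \<le> T" for a b
  proof -
    have "H a + integral {a..b} (\<lambda>t. p s (g t - 0)) = H b"
      unfolding H_def using that
      by (intro Henstock_Kurzweil_Integration.integral_combine integrable_on_subinterval[OF int]) auto
    then show ?thesis using indefinite_integral_bound[OF g that, of s 0] by simp
  qed
  have "p s (frechet_integral p {0..u} g - frechet_integral p {0..t} g) \<le> \<bar>H u - H t\<bar>" if "u \<in> {0..T}" for u
    using le[of t u] le[of u t] t that
      p_commute[of s "frechet_integral p {0..u} g" "frechet_integral p {0..t} g"]
    by (cases "t \<le> u") auto
  then have "eventually (\<lambda>u. p s (frechet_integral p {0..u} g - frechet_integral p {0..t} g) \<le> \<bar>H u - H t\<bar>)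
      (at t within {0..T})"
    by (auto simp: eventually_at_filter)
  then show "((\<lambda>u. p s (frechet_integral p {0..u} g - frechet_integral p {0..t} g)) \<longlongrightarrow> 0) (at t within {0..T})"
    by (intro tendsto_sandwich[OF _ _ tendsto_const lim]) (simp_all add: p_nonneg)
qed

text \<open>Lebesgue's differentiation theorem. The values of approximating step functions form a
  countable set that comes arbitrarily close to \<open>g t\<close> for almost every \<open>t\<close>, so it suffices to
  differentiate the integrals of the countably many real functions \<open>p s (g t - d)\<close> with \<open>d\<close>
  in this set.\<close>

lemma indefinite_integral_differentiable_AE:
  assumes g: "frechet_integrable p {0..T} g"
  shows "AE t in lebesgue_on {0..T}.
    tends (\<lambda>h. (frechet_integral p {0..t + h} g - frechet_integral p {0..t} g) /\<^sub>R h) (g t)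
      (at 0 within {h. t + h \<in> {0..T}})"
proof -
  let ?S = "{0..T}" and ?F = "\<lambda>t. frechet_integral p {0..t} g"
  obtain h where h: "approximating_steps p ?S g h" using g unfolding frechet_integrable_def by blast
  define D where "D = (\<Union>n. h n ` ?S)"
  have D: "countable D"
    using approximating_steps_step[OF h] unfolding D_def step_function_def
    by (auto intro: countable_finite)
  have "AE t in lebesgue_on ?S. \<forall>d\<in>D. \<forall>s. \<forall>\<epsilon>>0. \<exists>\<delta>>0. \<forall>u\<in>?S. u \<noteq> t \<longrightarrow> \<bar>u - t\<bar> < \<delta> \<longrightarrow>
      integral {min t u..max t u} (\<lambda>\<xi>. p s (g \<xi> - d)) < (p s (g t - d) + \<epsilon>) * \<bar>u - t\<bar>"
    unfolding AE_ball_countable[OF D] AE_all_countable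
    by (intro ballI allI two_sided_averages_AE integrable_p_diff_on[OF g]) auto
  then show ?thesis
    using approximating_steps_AE[OF h] AE_space[of "lebesgue_on ?S"]
  proof eventually_elim
    case (elim t)
    then have t: "t \<in> ?S" by simp
    show ?case unfolding tends_def
    proof (intro allI tendstoI)
      fix s and \<epsilon> :: real assume \<epsilon>: "0 < \<epsilon>"
      have "eventually (\<lambda>n. p s (h n t - g t) < \<epsilon> / 4) sequentially"
        using elim(2) \<epsilon> unfolding tends_def by (intro order_tendstoD(2)[of _ 0]) auto
      then obtain n where n: "p s (h n t - g t) < \<epsilon> / 4" unfolding eventually_sequentially by blast
      define d where "d = h n t"
      have d: "d \<in> D" unfolding d_def D_def using t by blast
      have close: "p s (g t - d) < \<epsilon> / 4" "p s (d - g t) < \<epsilon> / 4"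
        using n p_commute[of s "g t" d] by (simp_all add: d_def)
      have "0 < \<epsilon> / 4" using \<epsilon> by simp
      with elim(1) d obtain \<delta> where \<delta>: "0 < \<delta>" and av: "\<And>u. u \<in> ?S \<Longrightarrow> u \<noteq> t \<Longrightarrow> \<bar>u - t\<bar> < \<delta> \<Longrightarrow>
          integral {min t u..max t u} (\<lambda>\<xi>. p s (g \<xi> - d)) < (p s (g t - d) + \<epsilon> / 4) * \<bar>u - t\<bar>"
        by meson
      have quot: "p s ((?F (t + k) - ?F t) /\<^sub>R k - g t) < \<epsilon>"
        if k: "t + k \<in> ?S" "k \<noteq> 0" "\<bar>k\<bar> < \<delta>" for k
      proof -
        have "p s (?F (t + k) - ?F t - k *\<^sub>R d) \<le> integral {min t (t + k)..max t (t + k)} (\<lambda>\<xi>. p s (g \<xi> - d))"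
        proof (cases "0 < k")
          case True
          then show ?thesis using indefinite_integral_bound[OF g, of t "t + k" s d] t k by simp
        next
          case False
          have neg: "?F t - ?F (t + k) - (t - (t + k)) *\<^sub>R d = - (?F (t + k) - ?F t - k *\<^sub>R d)"
            by (simp add: algebra_simps)
          have "p s (?F t - ?F (t + k) - (t - (t + k)) *\<^sub>R d) \<le> integral {t + k..t} (\<lambda>\<xi>. p s (g \<xi> - d))"
            by (rule indefinite_integral_bound[OF g]) (use False t k in auto)
          moreover have "min t (t + k) = t + k" "max t (t + k) = t" using False by auto
          ultimately show ?thesis
            unfolding neg seminorm_minus[OF seminorm_p] by simp
        qed
        also have "\<dots> < (p s (g t - d) + \<epsilon> / 4) * \<bar>k\<bar>"
          using av[of "t + k"] k by simp
        finally have 1: "p s (?F (t + k) - ?F t - k *\<^sub>R d) < (p s (g t - d) + \<epsilon> / 4) * \<bar>k\<bar>" .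
        have "(?F (t + k) - ?F t) /\<^sub>R k - g t = (1 / k) *\<^sub>R (?F (t + k) - ?F t - k *\<^sub>R d) + (d - g t)"
          using k by (simp add: algebra_simps divide_inverse)
        then have "p s ((?F (t + k) - ?F t) /\<^sub>R k - g t)
            \<le> p s ((1 / k) *\<^sub>R (?F (t + k) - ?F t - k *\<^sub>R d)) + p s (d - g t)"
          using p_triangle by metis
        also have "p s ((1 / k) *\<^sub>R (?F (t + k) - ?F t - k *\<^sub>R d)) = p s (?F (t + k) - ?F t - k *\<^sub>R d) / \<bar>k\<bar>"
          by (simp only: p_scale) simp
        also have "p s (?F (t + k) - ?F t - k *\<^sub>R d) / \<bar>k\<bar> < p s (g t - d) + \<epsilon> / 4"
          using 1 k by (simp add: divide_less_eq)
        finally show ?thesis using close \<epsilon> by simp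
      qed
      have "eventually (\<lambda>k. p s ((?F (t + k) - ?F t) /\<^sub>R k - g t) < \<epsilon>) (at 0 within {k. t + k \<in> ?S})"
        unfolding eventually_at using quot \<delta> by (intro exI[of _ \<delta>]) (auto simp: dist_real_def)
      then show "eventually (\<lambda>k. dist (p s ((?F (t + k) - ?F t) /\<^sub>R k - g t)) 0 < \<epsilon>)
          (at 0 within {k. t + k \<in> ?S})"
        by eventually_elim (simp add: p_nonneg)
    qed
  qed
qed

end

section \<open>Order and integration\<close>

context unconditional
begin

lemma integral_order_mono:
  assumes "has_frechet_integral S g I" "has_frechet_integral S g' I'" and S: "S \<in> lmeasurable"
    and le: "\<And>t. t \<in> S \<Longrightarrow> g t \<lless> g' t"
  shows "I \<lless> I'"
  unfolding basis_le_def
proof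
  fix k
  obtain K N where K: "\<And>x. \<bar>coord x k\<bar> \<le> K * psum N x" using coord_dominated by blast
  have "0 \<le> coord (I' - I) k"
  proof (rule integral_nonneg_functional[OF has_integral_diff[OF assms(2,1) S] S, of "\<lambda>x. coord x k" K N])
    show "linear (\<lambda>x. coord x k)" by (rule linear_coord)
    show "\<bar>coord x k\<bar> \<le> K * (\<Sum>i\<le>N. p i x)" for x using K[of x] unfolding psum_def .
    show "0 \<le> coord (g' t - g t) k" if "t \<in> S" for t
      using le[OF that] unfolding basis_le_def by (simp add: coord_diff)
  qed
  then show "coord I k \<le> coord I' k" by (simp add: coord_diff)
qed

text \<open>Functions between \<open>lo\<close> and \<open>hi\<close> have a common integrable bound in every seminorm, since \<open>q s\<close>
  is monotone and bounded by finitely many seminorms \<open>p i\<close>; and coordinatewise convergence inside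
  an order interval is convergence.\<close>

lemma order_dominated_convergence:
  assumes g: "\<And>n. frechet_integrable p S (g n)" and S: "S \<in> lmeasurable"
    and lo: "frechet_integrable p S lo" and hi: "frechet_integrable p S hi"
    and between: "\<And>n t. t \<in> S \<Longrightarrow> lo t \<lless> g n t" "\<And>n t. t \<in> S \<Longrightarrow> g n t \<lless> hi t"
    and lim: "\<And>t k. t \<in> S \<Longrightarrow> (\<lambda>n. coord (g n t) k) \<longlonglongrightarrow> coord (g' t) k"
  shows "frechet_integrable p S g'"
    and "tends (\<lambda>n. frechet_integral p S (g n)) (frechet_integral p S g') sequentially"
proof -
  obtain K N where K: "\<And>s x. q s x \<le> K s * psum (N s) x" using q_dominated by metis
  have tends: "AE t in lebesgue_on S. tends (\<lambda>n. g n t) (g' t) sequentially"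
  proof (rule AE_I2)
    fix t assume "t \<in> space (lebesgue_on S)"
    then have t: "t \<in> S" by simp
    show "tends (\<lambda>n. g n t) (g' t) sequentially"
      by (rule order_interval_tends[OF between[OF t] lim[OF t]])
  qed
  have G: "integrable (lebesgue_on S) (\<lambda>t. p s (lo t) + K s * psum (N s) (hi t - lo t))" for s
    unfolding psum_def
    by (intro Bochner_Integration.integrable_add Bochner_Integration.integrable_mult_right
        Bochner_Integration.integrable_sum integrable_p integrable_diff lo hi S)
  have bound: "p s (g n t) \<le> p s (lo t) + K s * psum (N s) (hi t - lo t)" if "t \<in> S" for s n t
    using p_le_of_interval[OF between[OF that], of s n] K[of s "hi t - lo t"] by linarith
  show "frechet_integrable p S g'"
    "tends (\<lambda>n. frechet_integral p S (g n)) (frechet_integral p S g') sequentially"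
    using dominated_convergence[OF g S tends G bound] by blast+
qed

end

section \<open>Monotone iteration\<close>

lemma floor_double_eq:
  fixes x y :: real
  assumes "\<lfloor>2 * x\<rfloor> = \<lfloor>2 * y\<rfloor>" shows "\<lfloor>x\<rfloor> = \<lfloor>y\<rfloor>"
  using floor_divide_real_eq_div[of 2 "2 * x"] floor_divide_real_eq_div[of 2 "2 * y"] assms by simp

locale monotone_ivp = unconditional p e
  for p :: "nat \<Rightarrow> 'a::real_vector \<Rightarrow> real" and e :: "nat \<Rightarrow> 'a" +
  fixes T :: real and x_hat :: 'a and f :: "real \<Rightarrow> 'a \<Rightarrow> 'a" and C x_star :: 'a
  assumes T_pos: "0 < T"
    and left_cont: "\<And>k t. t \<in> {0..T} \<Longrightarrow> left_continuous p e (\<lambda>x. coord (f t x) k)"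
    and integrable_f: "\<And>x. frechet_integrable p {0..T} (\<lambda>t. f t x)"
    and upper: "\<And>t x. t \<in> {0..T} \<Longrightarrow> f t x \<lless> C"
    and lower: "\<And>t. t \<in> {0..T} \<Longrightarrow> x_star \<lless> x_hat + frechet_integral p {0..t} (\<lambda>\<xi>. f \<xi> x_star)"
    and mono: "\<And>x y t. t \<in> {0..T} \<Longrightarrow> x \<lless> y \<Longrightarrow> f t x \<lless> f t y"
begin

lemma le_refl: "x \<lless> x" and le_trans: "x \<lless> y \<Longrightarrow> y \<lless> z \<Longrightarrow> x \<lless> z"
  unfolding basis_le_def by (auto intro: order_trans)

lemma le_add_left: "x \<lless> y \<Longrightarrow> z + x \<lless> z + y"
  unfolding basis_le_def by (simp add: coord_add)

lemma f_left_limit: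
  assumes t: "t \<in> {0..T}" and inc: "\<And>n. y n \<lless> y (Suc n)" and lim: "tends y l sequentially"
  shows "(\<lambda>n. coord (f t (y n)) k) \<longlonglongrightarrow> coord (f t l) k"
  using left_cont[OF t, of k] inc lim unfolding left_continuous_def limitin_iff_tends by blast

text \<open>A continuous curve is the limit from below of the step functions that take, on every cell
  of a dyadic partition, the coordinatewise infimum of the curve over the cell. Such an infimum is
  the coordinate sequence of an element because it lies between \<open>x_star\<close> and the curve. Refining
  the partition increases the infima, so left continuity of \<open>f\<close> applies to the sequence.\<close>

lemma superposition_integrable:
  assumes cont: "\<And>t. t \<in> {0..T} \<Longrightarrow> tends x (x t) (at t within {0..T})"
    and above: "\<And>t. t \<in> {0..T} \<Longrightarrow> x_star \<lless> x t"
  shows "frechet_integrable p {0..T} (\<lambda>t. f t (x t))"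
proof -
  let ?S = "{0..T}"
  have S: "?S \<in> lmeasurable" by simp
  \<comment> \<open>The number of the dyadic cell of \<open>t\<close>; the end point \<open>T\<close> forms the cell \<open>2 ^ n\<close> by itself.\<close>
  define cl where "cl n t = \<lfloor>2 ^ n * t / T\<rfloor>" for n :: nat and t :: real
  define J where "J n j = {s \<in> ?S. cl n s = j}" for n j
  have refine: "J (Suc n) (cl (Suc n) t) \<subseteq> J n (cl n t)" for n t
  proof
    fix s assume "s \<in> J (Suc n) (cl (Suc n) t)"
    then have s: "s \<in> ?S" "\<lfloor>2 * (2 ^ n * s / T)\<rfloor> = \<lfloor>2 * (2 ^ n * t / T)\<rfloor>"
      unfolding J_def cl_def by (simp_all add: mult.assoc)
    from s(1) floor_double_eq[OF s(2)] show "s \<in> J n (cl n t)" unfolding J_def cl_def by simp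
  qed
  have diam: "\<bar>s - t\<bar> < T / 2 ^ n" if "s \<in> J n (cl n t)" for s t n
  proof -
    have "\<lfloor>2 ^ n * s / T\<rfloor> = \<lfloor>2 ^ n * t / T\<rfloor>" using that unfolding J_def cl_def by simp
    then have "\<bar>2 ^ n * s / T - 2 ^ n * t / T\<bar> < 1" by linarith
    moreover have "2 ^ n * s / T - 2 ^ n * t / T = (s - t) * (2 ^ n / T)"
      using T_pos by (simp add: field_simps)
    ultimately have "\<bar>s - t\<bar> * (2 ^ n / T) < 1" using T_pos by (simp add: abs_mult)
    then show ?thesis using T_pos by (simp add: field_simps)
  qed
  have J_sets: "J n j \<in> sets lebesgue" for n j
  proof -
    have "J n j = {0..T} \<inter> {of_int j * T / 2 ^ n..<(of_int j + 1) * T / 2 ^ n}"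
      using T_pos unfolding J_def cl_def by (auto simp: floor_eq_iff field_simps)
    then show ?thesis by simp
  qed
  have cl_range: "cl n t \<in> {0..2 ^ n}" if "t \<in> ?S" for n t
  proof -
    have "0 \<le> 2 ^ n * t / T" "2 ^ n * t / T \<le> 2 ^ n" using that T_pos by (auto simp: field_simps)
    then show ?thesis unfolding cl_def by (simp add: floor_le_iff le_floor_iff)
  qed
  define inf where "inf n j k = (INF s\<in>J n j. coord (x s) k)" for n j k
  have self: "t \<in> J n (cl n t)" if "t \<in> ?S" for n t using that by (simp add: J_def)
  have bdd: "bdd_below ((\<lambda>s. coord (x s) k) ` J n j)" for n j k
    using above by (intro bdd_belowI2[of _ "coord x_star k"]) (auto simp: J_def basis_le_def)
  have inf_lower: "coord x_star k \<le> inf n (cl n t) k" if "t \<in> ?S" for n t k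
    unfolding inf_def using self[OF that] above by (intro cINF_greatest) (auto simp: J_def basis_le_def)
  have inf_upper: "inf n (cl n t) k \<le> coord (x t) k" if "t \<in> ?S" for n t k
    unfolding inf_def by (rule cINF_lower[OF bdd self[OF that]])
  define Y where "Y n j = (SOME u. coord u = inf n j)" for n j
  define y where "y n t = Y n (cl n t)" for n t
  have coord_y: "coord (y n t) = inf n (cl n t)" if t: "t \<in> ?S" for n t
  proof -
    obtain u where "coord u = inf n (cl n t)"
      using order_interval_element[of x_star "inf n (cl n t)" "x t"] inf_lower[OF t] inf_upper[OF t] by blast
    then show ?thesis unfolding y_def Y_def by (rule someI)
  qed
  have y_lower: "x_star \<lless> y n t" and y_upper: "y n t \<lless> x t" if "t \<in> ?S" for n t
    unfolding basis_le_def coord_y[OF that] using inf_lower[OF that] inf_upper[OF that] by blast+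
  have y_inc: "y n t \<lless> y (Suc n) t" if "t \<in> ?S" for n t
    unfolding basis_le_def coord_y[OF that] inf_def
    using self[OF that] by (intro allI cINF_superset_mono bdd refine order_refl) auto
  have y_lim: "tends (\<lambda>n. y n t) (x t) sequentially" if t: "t \<in> ?S" for t
  proof (rule order_interval_tends[OF y_lower[OF t] y_upper[OF t]])
    fix k
    show "(\<lambda>n. coord (y n t) k) \<longlonglongrightarrow> coord (x t) k"
    proof (rule LIMSEQ_I)
      fix \<epsilon> :: real assume \<epsilon>: "0 < \<epsilon>"
      have "eventually (\<lambda>s. coord (x t) k - \<epsilon> / 2 < coord (x s) k) (at t within ?S)"
        using \<epsilon> by (intro order_tendstoD(1)[OF tends_coord[OF cont[OF t]]]) simp
      then obtain \<delta> where \<delta>: "0 < \<delta>"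
        and near: "\<And>s. s \<in> ?S \<Longrightarrow> s \<noteq> t \<Longrightarrow> \<bar>s - t\<bar> < \<delta> \<Longrightarrow> coord (x t) k - \<epsilon> / 2 < coord (x s) k"
        unfolding eventually_at dist_real_def by blast
      obtain N where N: "(1 / 2) ^ N < \<delta> / T" using real_arch_pow_inv[of "\<delta> / T" "1 / 2"] \<delta> T_pos by auto
      have "norm (coord (y n t) k - coord (x t) k) < \<epsilon>" if "N \<le> n" for n
      proof -
        have "(1 / 2 :: real) ^ n \<le> (1 / 2) ^ N" using that by (intro power_decreasing) auto
        then have "(1 / 2 :: real) ^ n < \<delta> / T" using N by (rule order_le_less_trans)
        then have "T * (1 / 2) ^ n < T * (\<delta> / T)" using T_pos by (rule mult_strict_left_mono)
        then have small: "T / 2 ^ n < \<delta>" using T_pos by (simp add: power_divide)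
        have "coord (x t) k - \<epsilon> / 2 \<le> coord (x s) k" if "s \<in> J n (cl n t)" for s
          using near[of s] diam[OF that] small that \<epsilon> by (cases "s = t") (auto simp: J_def)
        then have "coord (x t) k - \<epsilon> / 2 \<le> coord (y n t) k"
          unfolding coord_y[OF t] inf_def using self[OF t] by (intro cINF_greatest) auto
        moreover have "coord (y n t) k \<le> coord (x t) k" using y_upper[OF t] unfolding basis_le_def by blast
        ultimately show ?thesis using \<epsilon> by simp
      qed
      then show "\<exists>N. \<forall>n\<ge>N. norm (coord (y n t) k - coord (x t) k) < \<epsilon>" by blast
    qed
  qed
  have int_y: "frechet_integrable p ?S (\<lambda>t. f t (y n t))" for n
  proof -
    have "frechet_integrable p ?S (\<lambda>t. \<Sum>j\<in>{0..2 ^ n}. if t \<in> J n j then f t (Y n j) else 0)"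
    proof (rule integrable_sum[OF _ S])
      fix j
      have "J n j \<subseteq> ?S" by (auto simp: J_def)
      then show "frechet_integrable p ?S (\<lambda>t. if t \<in> J n j then f t (Y n j) else 0)"
        using has_integral_restrict[OF integrable_f[of "Y n j"] S J_sets] has_integral_integrable by blast
    qed
    then show ?thesis
    proof (rule integrable_cong)
      fix t assume t: "t \<in> ?S"
      have "(\<Sum>j\<in>{0..2 ^ n}. if t \<in> J n j then f t (Y n j) else 0)
        = (\<Sum>j\<in>{cl n t}. if t \<in> J n j then f t (Y n j) else 0)"
        using cl_range[OF t, of n] by (intro sum.mono_neutral_right) (auto simp: J_def)
      then show "(\<Sum>j\<in>{0..2 ^ n}. if t \<in> J n j then f t (Y n j) else 0) = f t (y n t)"
        using self[OF t, of n] by (simp add: y_def)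
    qed simp
  qed
  show ?thesis
  proof (rule order_dominated_convergence(1)[OF int_y S integrable_f[of x_star] integrable_const[OF S, of C]])
    show "f t x_star \<lless> f t (y n t)" if "t \<in> ?S" for n t by (rule mono[OF that y_lower[OF that]])
    show "f t (y n t) \<lless> C" if "t \<in> ?S" for n t by (rule upper[OF that])
    show "(\<lambda>n. coord (f t (y n t)) k) \<longlonglongrightarrow> coord (f t (x t)) k" if "t \<in> ?S" for t k
      by (rule f_left_limit[OF that y_inc[OF that] y_lim[OF that]])
  qed
qed

definition picard :: "(real \<Rightarrow> 'a) \<Rightarrow> real \<Rightarrow> 'a" where
  "picard x t = x_hat + frechet_integral p {0..t} (\<lambda>\<xi>. f \<xi> (x \<xi>))"

lemma has_integral_initial:
  assumes "frechet_integrable p {0..T} g" "t \<in> {0..T}"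
  shows "has_frechet_integral {0..t} g (frechet_integral p {0..t} g)"
  by (rule has_integral_frechet_integral[OF integrable_subset[OF assms(1)]]) (use assms in auto)

lemma picard_mono:
  assumes "frechet_integrable p {0..T} (\<lambda>t. f t (x t))" "frechet_integrable p {0..T} (\<lambda>t. f t (x' t))"
    and le: "\<And>t. t \<in> {0..T} \<Longrightarrow> x t \<lless> x' t" and t: "t \<in> {0..T}"
  shows "picard x t \<lless> picard x' t"
  unfolding picard_def
  by (rule le_add_left, rule integral_order_mono[OF has_integral_initial[OF assms(1) t] has_integral_initial[OF assms(2) t]])
    (use t le mono in auto)

lemma picard_upper:
  assumes "frechet_integrable p {0..T} (\<lambda>t. f t (x t))" and t: "t \<in> {0..T}"
  shows "picard x t \<lless> x_hat + t *\<^sub>R C"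
proof -
  have "has_frechet_integral {0..t} (\<lambda>\<xi>. C) (t *\<^sub>R C)"
    using has_integral_const[of "{0..t}" C] t by simp
  then show ?thesis unfolding picard_def
    by (intro le_add_left integral_order_mono[OF has_integral_initial[OF assms]])
      (use t upper in auto)
qed

lemma picard_continuous:
  assumes "frechet_integrable p {0..T} (\<lambda>t. f t (x t))" and t: "t \<in> {0..T}"
  shows "tends (picard x) (picard x t) (at t within {0..T})"
  unfolding picard_def[abs_def]
  by (rule tends_add[OF tends_const indefinite_integral_continuous[OF assms]])

text \<open>The Picard iterates starting at \<open>x_star\<close> increase and stay below \<open>x_hat + t *\<^sub>R C\<close>, hence
  converge; by left continuity the limit is a fixed point.\<close>

lemma fixed_point:
  "\<exists>x. frechet_integrable p {0..T} (\<lambda>t. f t (x t)) \<and> (\<forall>t\<in>{0..T}. x t = picard x t)"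
proof -
  let ?S = "{0..T}"
  define X where "X n = (picard ^^ n) (\<lambda>t. x_star)" for n
  have X0: "X 0 t = x_star" for t by (simp add: X_def)
  have XS: "X (Suc n) = picard (X n)" for n by (simp add: X_def)
  define good where "good n \<longleftrightarrow> (\<forall>t\<in>?S. x_star \<lless> X n t) \<and> frechet_integrable p ?S (\<lambda>t. f t (X n t))" for n
  have good_step: "good (Suc n)" if good: "good n" and inc: "\<And>t. t \<in> ?S \<Longrightarrow> X n t \<lless> X (Suc n) t" for n
  proof -
    have int: "frechet_integrable p ?S (\<lambda>t. f t (X n t))" using good unfolding good_def by blast
    have above: "x_star \<lless> X (Suc n) t" if "t \<in> ?S" for t
      using good inc[OF that] that le_trans unfolding good_def by blast
    have "frechet_integrable p ?S (\<lambda>t. f t (X (Suc n) t))"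
      by (rule superposition_integrable[OF _ above]) (simp only: XS picard_continuous[OF int])
    then show ?thesis unfolding good_def using above by blast
  qed
  have main: "good n \<and> (\<forall>t\<in>?S. X n t \<lless> X (Suc n) t)" for n
  proof (induction n)
    case 0
    have "X 0 t \<lless> X (Suc 0) t" if "t \<in> ?S" for t
      using lower[OF that] by (simp add: XS picard_def X0)
    moreover have "good 0" unfolding good_def X0 using le_refl integrable_f by blast
    ultimately show ?case by blast
  next
    case (Suc n)
    then have good': "good (Suc n)" using good_step by blast
    have "X (Suc n) t \<lless> X (Suc (Suc n)) t" if "t \<in> ?S" for t
      unfolding XS[of n] XS[of "Suc n"]
      by (rule picard_mono[OF _ _ _ that]) (use Suc good' in \<open>auto simp: good_def XS\<close>)
    then show ?case using good' by blast
  qed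
  then have int: "frechet_integrable p ?S (\<lambda>t. f t (X n t))"
    and above: "t \<in> ?S \<Longrightarrow> x_star \<lless> X n t" and inc: "t \<in> ?S \<Longrightarrow> X n t \<lless> X (Suc n) t" for n t
    unfolding good_def by blast+
  have below: "X n t \<lless> x_hat + t *\<^sub>R C" if "t \<in> ?S" for n t
    using le_trans[OF inc[OF that]] picard_upper[OF int that] unfolding XS by blast
  have "\<exists>u. tends (\<lambda>n. X n t) u sequentially" if t: "t \<in> ?S" for t
  proof -
    have "\<exists>a. (\<lambda>n. coord (X n t) k) \<longlonglongrightarrow> a" for k
    proof -
      have "incseq (\<lambda>n. coord (X n t) k)"
        using inc[OF t] unfolding basis_le_def by (intro incseq_SucI) blast
      moreover have "\<forall>n. coord (X n t) k \<le> coord (x_hat + t *\<^sub>R C) k"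
        using below[OF t] unfolding basis_le_def by blast
      ultimately show ?thesis by (rule incseq_convergent) blast
    qed
    then obtain a where a: "\<And>k. (\<lambda>n. coord (X n t) k) \<longlonglongrightarrow> a k" by metis
    have "coord x_star k \<le> a k" for k
      by (rule LIMSEQ_le_const[OF a]) (use above[OF t] in \<open>auto simp: basis_le_def\<close>)
    moreover have "a k \<le> coord (x_hat + t *\<^sub>R C) k" for k
      by (rule LIMSEQ_le_const2[OF a]) (use below[OF t] in \<open>auto simp: basis_le_def\<close>)
    ultimately obtain u where u: "coord u = a" by (rule order_interval_element)
    show ?thesis
      by (rule exI[of _ u], rule order_interval_tends[OF above[OF t] below[OF t]]) (simp only: u a)
  qed
  then obtain x where x: "\<And>t. t \<in> ?S \<Longrightarrow> tends (\<lambda>n. X n t) (x t) sequentially" by metis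
  have dct: "frechet_integrable p {0..t} (\<lambda>\<xi>. f \<xi> (x \<xi>))"
    "tends (\<lambda>n. frechet_integral p {0..t} (\<lambda>\<xi>. f \<xi> (X n \<xi>))) (frechet_integral p {0..t} (\<lambda>\<xi>. f \<xi> (x \<xi>))) sequentially"
    if t: "t \<in> ?S" for t
  proof -
    have St: "{0..t} \<in> lmeasurable" by simp
    have sub: "\<xi> \<in> ?S" if "\<xi> \<in> {0..t}" for \<xi> using that t by simp
    have ints: "frechet_integrable p {0..t} (\<lambda>\<xi>. f \<xi> (X n \<xi>))" for n
      by (rule has_integral_integrable[OF has_integral_initial[OF int t]])
    have int0: "frechet_integrable p {0..t} (\<lambda>\<xi>. f \<xi> x_star)"
      by (rule has_integral_integrable[OF has_integral_initial[OF integrable_f t]])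
    note conv = order_dominated_convergence[OF ints St int0 integrable_const[OF St]
        mono[OF sub above[OF sub]] upper[OF sub] f_left_limit[OF sub inc[OF sub] x[OF sub]]]
    show "frechet_integrable p {0..t} (\<lambda>\<xi>. f \<xi> (x \<xi>))"
      "tends (\<lambda>n. frechet_integral p {0..t} (\<lambda>\<xi>. f \<xi> (X n \<xi>))) (frechet_integral p {0..t} (\<lambda>\<xi>. f \<xi> (x \<xi>))) sequentially"
      using conv by blast+
  qed
  show ?thesis
  proof (intro exI[of _ x] conjI ballI)
    show "frechet_integrable p ?S (\<lambda>t. f t (x t))" by (rule dct(1)) (use T_pos in simp)
    fix t assume t: "t \<in> ?S"
    have "tends (\<lambda>n. X (Suc n) t) (picard x t) sequentially"
      unfolding XS picard_def by (rule tends_add[OF tends_const dct(2)[OF t]])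
    moreover have "tends (\<lambda>n. X (Suc n) t) (x t) sequentially"
      unfolding tends_def by (intro allI LIMSEQ_Suc[of "\<lambda>n. p _ (X n t - x t)"] x[OF t, unfolded tends_def, rule_format])
    ultimately show "x t = picard x t" using tends_unique[OF _ _ trivial_limit_sequentially] by blast
  qed
qed

lemma solution_exists:
  "\<exists>x x_dot. ivp_solution p T f x_hat x \<and>
      (AE t in lebesgue_on {0..T}. has_weak_derivative p {0..T} x (x_dot t) t) \<and>
      (AE t in lebesgue_on {0..T}. x_dot t = f t (x t))"
proof -
  let ?S = "{0..T}"
  obtain x where int: "frechet_integrable p ?S (\<lambda>t. f t (x t))" and x: "\<And>t. t \<in> ?S \<Longrightarrow> x t = picard x t"
    using fixed_point by blast
  have "continuous_map (top_of_set ?S) (frechet_topology p) x"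
    unfolding continuous_map_atin limitin_iff_tends
  proof
    fix t assume "t \<in> topspace (top_of_set ?S)"
    then have t: "t \<in> ?S" by simp
    have "eventually (\<lambda>u. x u = picard x u) (at t within ?S)"
      using x by (auto simp: eventually_at_filter)
    then have "tends x (x t) (at t within ?S)"
      using picard_continuous[OF int t] unfolding tends_def x[OF t]
      by (auto elim!: Lim_transform_eventually eventually_mono)
    moreover have "atin (top_of_set ?S) t = at t within ?S"
      using t by (intro filter_eqI)
        (auto simp: atin_subtopology_within eventually_atin_within eventually_at_topological)
    ultimately show "tends x (x t) (atin (top_of_set ?S) t)" by simp
  qed
  then have solution: "ivp_solution p T f x_hat x"
    unfolding ivp_solution_def using int x unfolding picard_def by blast
  have "AE t in lebesgue_on ?S. has_weak_derivative p ?S x (f t (x t)) t"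
    using indefinite_integral_differentiable_AE[OF int] AE_space[of "lebesgue_on ?S"]
  proof eventually_elim
    case (elim t)
    let ?F = "\<lambda>t. frechet_integral p {0..t} (\<lambda>\<xi>. f \<xi> (x \<xi>))"
    have t: "t \<in> ?S" using elim(2) by simp
    show ?case unfolding has_weak_derivative_def
    proof
      fix \<psi> assume "\<psi> \<in> dual_space p"
      then have "continuous_map (frechet_topology p) euclideanreal \<psi>" unfolding dual_space_def by blast
      from continuous_map_limit[OF this] elim(1)
      have "((\<lambda>h. \<psi> ((?F (t + h) - ?F t) /\<^sub>R h)) \<longlongrightarrow> \<psi> (f t (x t))) (at 0 within {h. t + h \<in> ?S})"
        unfolding limitin_iff_tends by (simp add: o_def)
      then show "((\<lambda>h. \<psi> ((x (t + h) - x t) /\<^sub>R h)) \<longlongrightarrow> \<psi> (f t (x t))) (at 0 within {h. t + h \<in> ?S})"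
      proof (rule Lim_transform_eventually)
        have "x (t + h) - x t = ?F (t + h) - ?F t" if "t + h \<in> ?S" for h
          using x[OF that] x[OF t] unfolding picard_def by simp
        then show "eventually (\<lambda>h. \<psi> ((?F (t + h) - ?F t) /\<^sub>R h) = \<psi> ((x (t + h) - x t) /\<^sub>R h))
            (at 0 within {h. t + h \<in> ?S})"
          by (auto simp: eventually_at_filter)
      qed
    qed
  qed
  with solution show ?thesis
    by (intro exI[of _ x] exI[of _ "\<lambda>t. f t (x t)"]) simp
qed

end

theorem theorem3:
  fixes p :: "nat \<Rightarrow> 'a::real_vector \<Rightarrow> real"
    and e :: "nat \<Rightarrow> 'a"
    and T :: real
    and x_hat :: 'a
    and f :: "real \<Rightarrow> 'a \<Rightarrow> 'a"
  assumes "frechet_space p"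
    and "reflexive_space p"
    and "unconditional_basis p e"
    and "0 < T"
    and left_cont: "\<forall>k. \<forall>t\<in>{0..T}. left_continuous p e (\<lambda>x. basis_coord p e (f t x) k)"
    and integrable: "\<forall>x. frechet_integrable p {0..T} (\<lambda>t. f t x)"
    and upper: "\<exists>C. \<forall>t\<in>{0..T}. \<forall>x. basis_le p e (f t x) C"
    and lower: "\<exists>x_star. \<forall>t\<in>{0..T}.
        basis_le p e x_star (x_hat + frechet_integral p {0..t} (\<lambda>\<xi>. f \<xi> x_star))"
    and mono: "\<forall>x y. \<forall>t\<in>{0..T}. basis_le p e x y \<longrightarrow> basis_le p e (f t x) (f t y)"
  shows "\<exists>x x_dot. ivp_solution p T f x_hat x \<and>
      (AE t in lebesgue_on {0..T}. has_weak_derivative p {0..T} x (x_dot t) t) \<and>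
      (AE t in lebesgue_on {0..T}. x_dot t = f t (x t))"
proof -
  obtain C where C: "\<And>t x. t \<in> {0..T} \<Longrightarrow> basis_le p e (f t x) C" using upper by blast
  obtain x_star where x_star: "\<And>t. t \<in> {0..T} \<Longrightarrow>
      basis_le p e x_star (x_hat + frechet_integral p {0..t} (\<lambda>\<xi>. f \<xi> x_star))"
    using lower by blast
  interpret monotone_ivp p e T x_hat f C x_star
    by unfold_locales (use assms(1,3,4) left_cont integrable C x_star mono in blast)+
  show ?thesis by (rule solution_exists)
qed

end
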